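(* Let $L=\mathbb{Q}(\sqrt{3})$ with ring of integers $\mathcal{O}_L$, and let $|q|<1$. Define \[ L_{5}(q) := q \sum_{n \geq 1} \sum_{k=1}^{n} \frac{(-1)_n (q)_{n-1}(-1)^{n+k}q^{n+k^2-k} }{(q)_{n-k} (q^2; q^2)_{k-1} (1-q^{2k-1})},\qquad L_{6}(q) := \sum_{n \geq 1} \sum_{k=1}^{n} \frac{(-1)_n (q)_{n-1} (-1)^{n+k}q^{n+k^2} }{(q)_{n-k} (q^2;q^2)_{k-1}(1-q^{2k-1})}, \] \[ L_{7}(q) := 2 {\sum_{n \geq 0}}^{*}\sum_{k=0}^{n} \frac{(q^2; q^2)_{n}(-1)^{n+k} q^{k^2 + k}}{(q)_{n-k}(q^2;q^2)_k(1-q^{2k+1})},\qquad L_{8}(q) := -1 + 2 {\sum_{n \geq 0}}^{*}\sum_{k=0}^{n} \frac{(q^2; q^2)_{n}(-1)^{n+k} q^{k^2} }{(q)_{n-k} (q^2; q^2)_k (1-q^{2k+1})}. \] Then \[ q^{-2} L_{5}(q^{2}) = 2\sum_{\substack{\mathfrak{a} \subset \mathcal{O}_{L},\ N(\mathfrak{a}) \equiv 0 \pmod{2} \\ \mathfrak{a} = (x),\ N(x) < 0}} q^{N(\mathfrak{a})},\qquad q^{-1} L_{6}(q^{2}) = 2\sum_{\substack{\mathfrak{a} \subset \mathcal{O}_{L},\ N(\mathfrak{a}) \equiv 1 \pmod{2} \\ \mathfrak{a} = (x),\ N(x) < 0}} q^{N(\mathfrak{a})}, \] \[ qL_{7}(q^{6})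 = \sum_{\substack{\mathfrak{a} \subset \mathcal{O}_{L} \\ N(\mathfrak{a}) \equiv 1 \pmod{6}}} q^{N(\mathfrak{a})},\qquad q^{-2} L_{8}(q^{6}) = \sum_{\substack{\mathfrak{a} \subset \mathcal{O}_{L} \\ N(\mathfrak{a}) \equiv 4 \pmod{6}}} q^{N(\mathfrak{a})}. \]
   Context: For $n\in\mathbb{N}\cup\{\infty\}$, $(a)_n=(a;q)_n=\prod_{k=1}^{n}(1-aq^{k-1})$ (empty product $=1$), and $(a;q^2)_n$ is defined likewise with $q$ replaced by $q^2$. The notation ${\sum_{n\ge 0}}^{*} c_n$ denotes the value defined as the average of the even and odd partial sums, i.e. $\lim_{N\to\infty}\frac12\left(\sum_{n=0}^{2N}c_n+\sum_{n=0}^{2N+1}c_n\right)$ (the series need not converge classically). The sums on the right run over nonzero ideals $\mathfrak{a}$ of $\mathcal{O}_L$ with absolute norm $N(\mathfrak{a})$ satisfying the stated conditions, each ideal counted once; the condition "$\mathfrak{a}=(x)$, $N(x)<0$" means $\mathfrak{a}$ is principal with a generator $x$ whose field norm $N(x)$ is negative. *)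

theory Defs
  imports "HOL-Analysis.Analysis" "HOL-Algebra.QuotRing"
begin

definition qpoch :: "complex \<Rightarrow> complex \<Rightarrow> nat \<Rightarrow> complex" where
  "qpoch a q n = (\<Prod>k<n. (1 - a * q ^ k))"

definition starsums :: "(nat \<Rightarrow> complex) \<Rightarrow> complex \<Rightarrow> bool" where
  "starsums c s \<longleftrightarrow>
     (\<lambda>N. ((\<Sum>n\<le>2*N. c n) + (\<Sum>n\<le>2*N+1. c n)) / 2) \<longlonglongrightarrow> s"

definition starsum :: "(nat \<Rightarrow> complex) \<Rightarrow> complex" where
  "starsum c = lim (\<lambda>N. ((\<Sum>n\<le>2*N. c n) + (\<Sum>n\<le>2*N+1. c n)) / 2)"

definition L5_term :: "complex \<Rightarrow> nat \<Rightarrow> complex" where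
  "L5_term q n = (\<Sum>k\<in>{1..n}.
      qpoch (-1) q n * qpoch q q (n - 1) * (-1) ^ (n + k) * q ^ (n + k^2 - k)
      / (qpoch q q (n - k) * qpoch (q^2) (q^2) (k - 1) * (1 - q ^ (2*k - 1))))"

definition L5 :: "complex \<Rightarrow> complex" where
  "L5 q = q * (\<Sum>n. L5_term q n)"

definition L6_term :: "complex \<Rightarrow> nat \<Rightarrow> complex" where
  "L6_term q n = (\<Sum>k\<in>{1..n}.
      qpoch (-1) q n * qpoch q q (n - 1) * (-1) ^ (n + k) * q ^ (n + k^2)
      / (qpoch q q (n - k) * qpoch (q^2) (q^2) (k - 1) * (1 - q ^ (2*k - 1))))"

definition L6 :: "complex \<Rightarrow> complex" where
  "L6 q = (\<Sum>n. L6_term q n)"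

definition L7_term :: "complex \<Rightarrow> nat \<Rightarrow> complex" where
  "L7_term q n = (\<Sum>k\<le>n.
      qpoch (q^2) (q^2) n * (-1) ^ (n + k) * q ^ (k^2 + k)
      / (qpoch q q (n - k) * qpoch (q^2) (q^2) k * (1 - q ^ (2*k + 1))))"

definition L8_term :: "complex \<Rightarrow> nat \<Rightarrow> complex" where
  "L8_term q n = (\<Sum>k\<le>n.
      qpoch (q^2) (q^2) n * (-1) ^ (n + k) * q ^ (k^2)
      / (qpoch q q (n - k) * qpoch (q^2) (q^2) k * (1 - q ^ (2*k + 1))))"

definition L7 :: "complex \<Rightarrow> complex" where
  "L7 q = 2 * starsum (L7_term q)"

definition L8 :: "complex \<Rightarrow> complex" where
  "L8 q = -1 + 2 * starsum (L8_term q)"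

(* The ring of integers of Q(sqrt 3) is Z[sqrt 3]; (a,b) represents a + b*sqrt 3 *)
definition OL :: "(int \<times> int) ring" where
  "OL = \<lparr>carrier = UNIV,
         mult = (\<lambda>(a,b) (c,d). (a*c + 3*b*d, a*d + b*c)),
         one = (1, 0),
         zero = (0, 0),
         add = (\<lambda>(a,b) (c,d). (a + c, b + d))\<rparr>"

definition elt_norm :: "int \<times> int \<Rightarrow> int" where
  "elt_norm x = (fst x)^2 - 3 * (snd x)^2"

definition nz_ideals :: "(int \<times> int) set set" where
  "nz_ideals = {I. ideal I OL \<and> I \<noteq> {\<zero>\<^bsub>OL\<^esub>}}"

definition ideal_norm :: "(int \<times> int) set \<Rightarrow> nat" where
  "ideal_norm I = card (carrier (OL Quot I))"

definition neg_principal :: "(int \<times> int) set \<Rightarrow> bool" where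
  "neg_principal I \<longleftrightarrow> (\<exists>x\<in>carrier OL. I = PIdl\<^bsub>OL\<^esub> x \<and> elt_norm x < 0)"

end

theory Submission
  imports Defs
begin

text \<open>
  A Bailey-type inversion turns each inner sum over \<open>k\<close> into a sum over \<open>r\<close> whose coefficients are, up to
  powers of \<open>q\<close>, the sums \<open>P5\<close> and \<open>P6\<close>. These satisfy a pair of first-order recurrences and equal
  \<open>\<Sum>i<n. q^(2i(n-i))\<close> and \<open>\<Sum>i<n. q^(2i(n-1-i))\<close>. After interchanging summations, the sum over
  \<open>n\<close> is evaluated in closed form (for the starred series after averaging), which leaves double series
  \<open>\<Sum>r i. q^Q(r,i)\<close> with \<open>Q\<close> an indefinite quadratic form over the triangle \<open>0 \<le> i \<le> r\<close>.
  The triangle parametrises a fundamental domain for the units of \<open>\<int>[\<surd>3]\<close> acting on the elements of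
  negative (resp. positive) norm with the required residue. Since the ring is norm-Euclidean, these elements
  are in bijection with the ideals in question. For \<open>N \<equiv> 1 (mod 3)\<close> every generator has positive norm.
\<close>

section \<open>The finite \<open>q\<close>-identities\<close>

text \<open>The obstacle is the denominator factor \<open>1 - q^(2k+1)\<close>, which rules out a
  product formula for the inner sums. It cancels in \<open>P6 (n+1) - P5 n\<close> and in
  \<open>P5 (n+1) - q^(2n) * P6 n\<close>, and what remains is a q-Chu-Vandermonde sum of value 1.
  Unrolling the two recurrences multiplies by q^(2(n-1)), q^(2(n-3)), and so on; i such factors
  accumulate to q^(2i(n-i)), which is where the indefinite form comes from. The inversion uses the
  Bailey kernel \<open>1 / (qf (n-r) * qf (n+r+e))\<close> with \<open>e = 2\<close> for
  \<open>L5\<close>, \<open>L6\<close> and \<open>e = 1\<close> for \<open>L7\<close>,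
  \<open>L8\<close>. Its exponent \<open>(r-k) * (r+k+e)\<close> absorbs the k^2 of each series, so
  that only a power depending on r and a binomial coefficient in r - k are left. The same values of
  e are the ones for which the sum over n is independent of r, so every coefficient enters with the
  same weight. All interchanges of limits rest on bounds for q-products that are uniform in
  r.\<close>

lemma Suc_choose_two: "Suc j choose 2 = j + (j choose 2)"
  by (simp add: numeral_2_eq_2)

lemma qpoch_0 [simp]: "qpoch a q 0 = 1"
  by (simp add: qpoch_def)

lemma qpoch_Suc: "qpoch a q (Suc n) = qpoch a q n * (1 - a * q ^ n)"
  by (simp add: qpoch_def)

lemma qpoch_Suc_shift: "qpoch a q (Suc n) = (1 - a) * qpoch (a * q) q n"
  by (simp add: qpoch_def prod.lessThan_Suc_shift mult.assoc del: prod.lessThan_Suc)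

lemma qpoch_add: "qpoch a q (m + n) = qpoch a q m * qpoch (a * q ^ m) q n"
  by (induction n) (simp_all add: qpoch_Suc power_add mult.assoc)

section \<open>Finite q-products in the unit disc\<close>

locale q_disc =
  fixes q :: complex
  assumes norm_q: "norm q < 1"
begin

lemma one_minus_neq_0: "norm a < 1 \<Longrightarrow> 1 - a \<noteq> (0::complex)"
  by auto

lemma norm_mult_power_less: "norm a < 1 \<Longrightarrow> norm (a * q ^ k) < 1"
  using norm_q power_le_one[of "norm q" k] mult_left_le[of "norm q ^ k" "norm a"]
  by (auto simp: norm_mult norm_power)

lemma norm_q_power_less: "k > 0 \<Longrightarrow> norm (q ^ k) < 1"
  using norm_q power_less_one_iff[of "norm q" k] by (auto simp: norm_power)

lemma one_minus_power_neq_0 [simp]: "k > 0 \<Longrightarrow> 1 - q ^ k \<noteq> 0"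
  using norm_q_power_less one_minus_neq_0 by blast

lemma qpoch_neq_0: "norm a < 1 \<Longrightarrow> qpoch a q n \<noteq> 0"
  using norm_mult_power_less[of a] one_minus_neq_0
  unfolding qpoch_def by (subst prod_zero_iff) blast+

definition qf :: "nat \<Rightarrow> complex" where "qf n = qpoch q q n"

definition qe :: "nat \<Rightarrow> complex" where "qe n = qpoch (q^2) (q^2) n"

lemma qf_0 [simp]: "qf 0 = 1" by (simp add: qf_def)
lemma qe_0 [simp]: "qe 0 = 1" by (simp add: qe_def)

lemma qf_Suc: "qf (Suc n) = qf n * (1 - q ^ Suc n)"
  by (simp add: qf_def qpoch_Suc)

lemma qe_Suc: "qe (Suc n) = qe n * (1 - q ^ (2 * n + 2))"
proof -
  have "q\<^sup>2 * (q\<^sup>2) ^ n = q ^ (2 * n + 2)"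
    by (simp only: power_mult[symmetric] power_add[symmetric] add.commute)
  then show ?thesis by (simp only: qe_def qpoch_Suc)
qed

lemma qf_neq_0 [simp]: "qf n \<noteq> 0"
  by (simp add: qf_def qpoch_neq_0 norm_q)

lemma qe_neq_0 [simp]: "qe n \<noteq> 0"
proof (induction n)
  case (Suc n)
  have "1 - q ^ (2 * n + 2) \<noteq> 0" by (rule one_minus_power_neq_0) simp
  with Suc show ?case by (metis qe_Suc mult_eq_0_iff)
qed simp

section \<open>A terminating sum of value 1\<close>

definition zt :: "nat \<Rightarrow> nat \<Rightarrow> complex" where
  "zt N k = q ^ (Suc (N - k) choose 2) * qf (N + k) / (qf (N - k) * qe k)"

text \<open>Partial sums over \<open>k \<le> K\<close> have closed-form differences in \<open>N\<close> (a WZ pair), which reduces the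
  evaluation of the full sum to a rational-function identity.\<close>

lemma zt_partial:
  "K \<le> N \<Longrightarrow> (\<Sum>k\<le>K. zt (Suc N) k - zt N k) = - (1 - q ^ (N + K + 1)) * zt N K"
proof (induction K)
  case 0
  have "1 - q ^ Suc N \<noteq> 0" by (rule one_minus_power_neq_0) simp
  then show ?case
    by (simp add: zt_def qf_Suc Suc_choose_two power_add field_simps del: one_minus_power_neq_0)
next
  case (Suc K)
  obtain j where j: "N = K + 1 + j" using Suc.prems by (metis add.commute le_Suc_ex Suc_eq_plus1)
  define X where "X = q ^ K"
  define Y where "Y = q ^ j"
  define E where "E = q ^ (j choose 2)"
  define A where "A = qf (N + K)"
  define B where "B = qf j"
  define D where "D = qe K"
  have nz: "1 - q * Y \<noteq> 0" "1 - q^2 * X^2 \<noteq> 0"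
    using one_minus_power_neq_0[of "Suc j"] one_minus_power_neq_0[of "2 * K + 2"]
    by (simp_all add: X_def Y_def power_add power_mult power2_eq_square mult_ac power_mult_distrib)
  have B: "B \<noteq> 0" "D \<noteq> 0" by (simp_all add: B_def D_def)
  have 1: "zt (Suc N) (Suc K) = E * Y^2 * q * (A * (1 - q^2 * X^2 * Y) * (1 - q^3 * X^2 * Y)) / (B * (1 - q * Y) * (D * (1 - q^2 * X^2)))"
    by (simp add: zt_def j Suc_choose_two qf_Suc qe_Suc E_def Y_def X_def A_def B_def D_def power_add eval_nat_numeral mult_ac)
  have 2: "zt N (Suc K) = E * Y * (A * (1 - q^2 * X^2 * Y)) / (B * (D * (1 - q^2 * X^2)))"
    by (simp add: zt_def j Suc_choose_two qf_Suc qe_Suc E_def Y_def X_def A_def B_def D_def power_add eval_nat_numeral mult_ac)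
  have 3: "zt N K = E * Y^2 * q * A / (B * (1 - q * Y) * D)"
    by (simp add: zt_def j Suc_choose_two qf_Suc qe_Suc E_def Y_def X_def A_def B_def D_def power_add eval_nat_numeral mult_ac)
  have e: "q ^ (N + K + 1) = q^2 * X^2 * Y" "q ^ (N + Suc K + 1) = q^3 * X^2 * Y"
    by (simp_all add: j X_def Y_def power_add eval_nat_numeral mult_ac)
  have "zt (Suc N) (Suc K) - zt N (Suc K) = - (1 - q ^ (N + Suc K + 1)) * zt N (Suc K) + (1 - q ^ (N + K + 1)) * zt N K"
    unfolding e 1 2 3 using nz B by (simp add: divide_simps) (simp add: algebra_simps power2_eq_square power3_eq_cube)
  with Suc show ?case by (simp only: sum.atMost_Suc) (simp add: left_diff_distrib)
qed

text \<open>This is the terminating q-Chu-Vandermonde sum with upper parameters q^(-N), q^(N+1) and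
  lower parameter -q; the power of q in \<open>zt\<close> normalises its value to 1. In the
  induction, \<open>zt_partial\<close> at \<open>K = N\<close> is cancelled by the one new term of
  the longer sum.\<close>

lemma zt_sum: "(\<Sum>k\<le>N. zt N k) = 1"
proof (induction N)
  case 0
  then show ?case by (simp add: zt_def numeral_2_eq_2)
next
  case (Suc N)
  have nz: "1 - q * q^Suc (2*N) \<noteq> 0" using one_minus_power_neq_0[of "2 * N + 2"] by (simp only: power_Suc[symmetric]) simp
  have "zt (Suc N) (Suc N) = (1 - q ^ (N + N + 1)) * zt N N"
    using nz by (simp add: zt_def qf_Suc qe_Suc mult_2)
  moreover have "(\<Sum>k\<le>N. zt (Suc N) k) - (\<Sum>k\<le>N. zt N k) = - (1 - q ^ (N + N + 1)) * zt N N"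
    using zt_partial[of N N] by (simp add: sum_subtractf)
  ultimately have "(\<Sum>k\<le>Suc N. zt (Suc N) k) = (\<Sum>k\<le>N. zt N k)"
    by (simp only: sum.atMost_Suc) (simp add: diff_eq_eq left_diff_distrib)
  with Suc show ?case by simp
qed

section \<open>Closed forms of the coefficient sums\<close>

definition dk :: "nat \<Rightarrow> complex" where "dk k = qe k * (1 - q ^ (2 * k + 1))"

lemma dk_neq_0 [simp]: "dk k \<noteq> 0"
  using one_minus_power_neq_0[of "2 * k + 1"] by (simp add: dk_def del: one_minus_power_neq_0)

definition wt :: "nat \<Rightarrow> nat \<Rightarrow> complex" where
  "wt n k = qf (n + k) / (qf (n - k) * dk k)"

text \<open>The inversion with \<open>e = 2\<close> gives \<open>L5\<close> and \<open>L6\<close>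
  the coefficients \<open>P5 (Suc r)\<close> and \<open>P6 (Suc r)\<close> up to powers of q. Those
  of \<open>L7\<close> and \<open>L8\<close> are combinations of \<open>P5\<close>, see
  \<open>w7_eq\<close> and \<open>w8_eq\<close>.\<close>

definition P5 :: "nat \<Rightarrow> complex" where
  "P5 n = (\<Sum>k<n. q ^ ((n - k) choose 2) * qf (n + k) / (qf (n - Suc k) * dk k))"

definition P6 :: "nat \<Rightarrow> complex" where
  "P6 n = (\<Sum>k<n. q ^ ((n - Suc k) choose 2) * qf (n + k) / (qf (n - Suc k) * dk k))"

lemma qf_ratio:
  "k < n \<Longrightarrow> 1 / qf (n - Suc k) = (1 - q ^ (n - k)) / qf (n - k)"
  using one_minus_power_neq_0[of "n - k"]
  by (simp add: Suc_diff_Suc[symmetric] qf_Suc del: power_Suc one_minus_power_neq_0)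

text \<open>This form and the next two share the weight \<open>wt n k\<close> and the range
  \<open>k <= n\<close>, so the sums can be compared term by term. The added term
  \<open>k = n\<close> vanishes through \<open>1 - q^0\<close>.\<close>

lemma P5_wt: "P5 n = (\<Sum>k\<le>n. q ^ ((n - k) choose 2) * (1 - q ^ (n - k)) * wt n k)"
proof -
  have "(\<Sum>k\<le>n. q ^ ((n - k) choose 2) * (1 - q ^ (n - k)) * wt n k) =
     (\<Sum>k<n. q ^ ((n - k) choose 2) * (1 - q ^ (n - k)) * wt n k)"
    by (simp add: lessThan_Suc_atMost[symmetric])
  also have "\<dots> = P5 n"
    unfolding P5_def
  proof (rule sum.cong)
    fix k assume "k \<in> {..<n}"
    then have "1 / qf (n - Suc k) = (1 - q ^ (n - k)) / qf (n - k)" using qf_ratio by auto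
    then have "q ^ ((n - k) choose 2) * qf (n + k) / dk k * (1 / qf (n - Suc k)) =
      q ^ ((n - k) choose 2) * qf (n + k) / dk k * ((1 - q ^ (n - k)) / qf (n - k))" by simp
    then show "q ^ ((n - k) choose 2) * (1 - q ^ (n - k)) * wt n k =
       q ^ ((n - k) choose 2) * qf (n + k) / (qf (n - Suc k) * dk k)"
      by (simp add: wt_def mult_ac)
  qed simp
  finally show ?thesis by simp
qed

lemma P5_Suc_wt:
  "P5 (Suc n) = (\<Sum>k\<le>n. q ^ (Suc (n - k) choose 2) * (1 - q ^ (n + k + 1)) * wt n k)"
  unfolding P5_def lessThan_Suc_atMost
  by (rule sum.cong) (auto simp: wt_def qf_Suc Suc_diff_le mult_ac)

lemma P6_Suc_wt:
  "P6 (Suc n) = (\<Sum>k\<le>n. q ^ ((n - k) choose 2) * (1 - q ^ (n + k + 1)) * wt n k)"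
  unfolding P6_def lessThan_Suc_atMost
  by (rule sum.cong) (auto simp: wt_def qf_Suc mult_ac)

lemma zt_wt: "zt n k = q ^ (Suc (n - k) choose 2) * (1 - q ^ (2 * k + 1)) * wt n k"
proof -
  have "1 - q ^ (2 * k + 1) \<noteq> 0" by (rule one_minus_power_neq_0) simp
  then show ?thesis by (simp add: zt_def wt_def dk_def del: one_minus_power_neq_0)
qed

text \<open>Termwise, \<open>(1 - q^(n+k+1)) - (1 - q^(n-k)) = q^(n-k) * (1 - q^(2k+1))\<close>. The
  last factor cancels the one in \<open>dk\<close>, which turns \<open>wt\<close> into
  \<open>zt\<close>.\<close>

lemma P6_Suc: "P6 (Suc n) = 1 + P5 n"
proof -
  have "P6 (Suc n) - P5 n = (\<Sum>k\<le>n. zt n k)"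
    unfolding P6_Suc_wt P5_wt sum_subtractf[symmetric]
  proof (rule sum.cong)
    fix k assume "k \<in> {..n}"
    then obtain j where j: "n = k + j" using le_Suc_ex by auto
    show "q ^ ((n - k) choose 2) * (1 - q ^ (n + k + 1)) * wt n k - q ^ ((n - k) choose 2) * (1 - q ^ (n - k)) * wt n k = zt n k"
      by (simp add: zt_wt j Suc_choose_two power_add mult_2 mult_2_right algebra_simps)
  qed simp
  then show ?thesis using zt_sum by (simp add: algebra_simps)
qed

text \<open>Termwise, \<open>(1 - q^(n+k+1)) - q^(2k+1) * (1 - q^(n-k)) = 1 - q^(2k+1)\<close>,
  which again turns \<open>wt\<close> into \<open>zt\<close>.\<close>

lemma P5_Suc: "P5 (Suc n) = 1 + q ^ (2 * n) * P6 n"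
proof -
  have P6: "q ^ (2 * n) * P6 n = (\<Sum>k\<le>n. q ^ (Suc (n - k) choose 2) * (q ^ (2 * k + 1) * (1 - q ^ (n - k))) * wt n k)"
  proof -
    have "(\<Sum>k\<le>n. q ^ (Suc (n - k) choose 2) * (q ^ (2 * k + 1) * (1 - q ^ (n - k))) * wt n k) =
       (\<Sum>k<n. q ^ (Suc (n - k) choose 2) * (q ^ (2 * k + 1) * (1 - q ^ (n - k))) * wt n k)"
      by (simp add: lessThan_Suc_atMost[symmetric])
    also have "\<dots> = q ^ (2 * n) * P6 n"
      unfolding P6_def sum_distrib_left
    proof (rule sum.cong)
      fix k assume "k \<in> {..<n}"
      then obtain j where j: "n = k + Suc j" using less_imp_Suc_add by fastforce
      have "1 - q ^ Suc j \<noteq> 0" by (rule one_minus_power_neq_0) simp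
      then show "q ^ (Suc (n - k) choose 2) * (q ^ (2 * k + 1) * (1 - q ^ (n - k))) * wt n k =
         q ^ (2 * n) * (q ^ ((n - Suc k) choose 2) * qf (n + k) / (qf (n - Suc k) * dk k))"
        by (simp add: j wt_def qf_Suc Suc_choose_two power_add mult_2 del: one_minus_power_neq_0)
    qed simp
    finally show ?thesis by simp
  qed
  have "P5 (Suc n) - q ^ (2 * n) * P6 n = (\<Sum>k\<le>n. zt n k)"
    unfolding P5_Suc_wt P6 sum_subtractf[symmetric]
  proof (rule sum.cong)
    fix k assume "k \<in> {..n}"
    then obtain j where j: "n = k + j" using le_Suc_ex by auto
    show "q ^ (Suc (n - k) choose 2) * (1 - q ^ (n + k + 1)) * wt n k - q ^ (Suc (n - k) choose 2) * (q ^ (2 * k + 1) * (1 - q ^ (n - k))) * wt n k = zt n k"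
      by (simp add: zt_wt j power_add mult_2 mult_2_right algebra_simps)
  qed simp
  then show ?thesis using zt_sum by (simp add: algebra_simps)
qed

text \<open>The explicit sums obey the same two recurrences: for \<open>P5\<close>, split off
  \<open>i = 0\<close> and use \<open>2(i+1)(n-i) = 2n + 2i(n-1-i)\<close>; for \<open>P6\<close>,
  split off the last term, which is 1.\<close>

lemma P5_P6_eq:
  "P5 n = (\<Sum>i<n. q ^ (2 * i * (n - i))) \<and> P6 n = (\<Sum>i<n. q ^ (2 * i * (n - Suc i)))"
proof (induction n)
  case 0
  show ?case by (simp add: P5_def P6_def)
next
  case (Suc n)
  have "(\<Sum>i<Suc n. q ^ (2 * i * (Suc n - i))) = 1 + (\<Sum>i<n. q ^ (2 * Suc i * (n - i)))"
    by (simp add: sum.lessThan_Suc_shift del: sum.lessThan_Suc)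
  also have "(\<Sum>i<n. q ^ (2 * Suc i * (n - i))) = (\<Sum>i<n. q ^ (2 * n) * q ^ (2 * i * (n - Suc i)))"
  proof (rule sum.cong)
    fix i assume "i \<in> {..<n}"
    then obtain j where j: "n = i + Suc j" using less_imp_Suc_add by fastforce
    show "q ^ (2 * Suc i * (n - i)) = q ^ (2 * n) * q ^ (2 * i * (n - Suc i))"
      unfolding power_add[symmetric] j by (rule arg_cong[where f = "\<lambda>x. q ^ x"]) (simp add: algebra_simps)
  qed simp
  finally have "(\<Sum>i<Suc n. q ^ (2 * i * (Suc n - i))) = P5 (Suc n)"
    using Suc P5_Suc by (simp add: sum_distrib_left)
  moreover have "(\<Sum>i<Suc n. q ^ (2 * i * (Suc n - Suc i))) = P6 (Suc n)"
    using Suc P6_Suc by simp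
  ultimately show ?case by simp
qed

text \<open>The numerator of the \<open>e = 1\<close> kernel splits as
  \<open>1 - q^(2r+1) = q^(r-k) * (1 - q^(r+k+1)) + (1 - q^(r-k))\<close>.\<close>

lemma w7_eq:
  "(1 - q ^ (2 * r + 1)) * (\<Sum>k\<le>r. q ^ ((r - k) choose 2) * wt r k) = P5 (Suc r) + P5 r"
  unfolding P5_wt[of r] P5_Suc_wt sum_distrib_left sum.distrib[symmetric]
proof (rule sum.cong)
  fix k assume "k \<in> {..r}"
  then obtain j where j: "r = k + j" using le_Suc_ex by auto
  show "(1 - q ^ (2 * r + 1)) * (q ^ ((r - k) choose 2) * wt r k) =
    q ^ (Suc (r - k) choose 2) * (1 - q ^ (r + k + 1)) * wt r k + q ^ ((r - k) choose 2) * (1 - q ^ (r - k)) * wt r k"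
    by (simp add: j Suc_choose_two power_add mult_2 mult_2_right algebra_simps)
qed simp

text \<open>Here the splitting is \<open>q^(r-k) * (1 - q^(2r+1)) = q^(r-k) * (1 - q^(r+k+1)) +
  q^(2r+1) * (1 - q^(r-k))\<close>.\<close>

lemma w8_eq:
  "(1 - q ^ (2 * r + 1)) * (\<Sum>k\<le>r. q ^ (Suc (r - k) choose 2) * wt r k) = P5 (Suc r) + q ^ (2 * r + 1) * P5 r"
  unfolding P5_wt[of r] P5_Suc_wt sum_distrib_left sum.distrib[symmetric]
proof (rule sum.cong)
  fix k assume "k \<in> {..r}"
  then obtain j where j: "r = k + j" using le_Suc_ex by auto
  show "(1 - q ^ (2 * r + 1)) * (q ^ (Suc (r - k) choose 2) * wt r k) =
    q ^ (Suc (r - k) choose 2) * (1 - q ^ (r + k + 1)) * wt r k + q ^ (2 * r + 1) * (q ^ ((r - k) choose 2) * (1 - q ^ (r - k)) * wt r k)"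
    by (simp add: j Suc_choose_two power_add mult_2 mult_2_right algebra_simps)
qed simp


text \<open>The summand of the inversion kernel, with base \<open>b = q^(2k + e)\<close> below.\<close>

definition bt :: "complex \<Rightarrow> nat \<Rightarrow> nat \<Rightarrow> complex" where
  "bt b N s = qf N * (-1) ^ s * b ^ s * q ^ (s\<^sup>2 + (s choose 2)) * (1 - b * q ^ (2 * s))
     / (qf s * qf (N - s) * qpoch (b * q ^ s) q (Suc N))"

lemma bt_alt: "bt b N s = qf N * ((-1) ^ s * b ^ s * q ^ (s\<^sup>2 + (s choose 2))) * (1 - b * q ^ (2 * s))
     / (qf s * qf (N - s) * qpoch (b * q ^ s) q (Suc N))"
  by (simp only: bt_def mult.assoc)

text \<open>The right side is the WZ partner of \<open>bt\<close>. At \<open>K = N\<close> it is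
  cancelled by the new term \<open>bt b (Suc N) (Suc N)\<close>, so the full sum does not depend on
  N.\<close>

lemma bt_partial:
  assumes b: "norm b < 1" and "K \<le> N"
  shows "(\<Sum>s\<le>K. bt b (Suc N) s - bt b N s) =
    qf N * (-1) ^ K * b ^ Suc K * q ^ (K\<^sup>2 + (K choose 2) + N + 2 * K + 1)
     / (qf K * qf (N - K) * qpoch (b * q ^ Suc K) q (Suc N))"
  using \<open>K \<le> N\<close>
proof (induction K)
  case 0
  define Q where "Q = qpoch (b * q) q N"
  define x where "x = 1 - b * q ^ Suc N"
  have nz: "Q \<noteq> 0" "x \<noteq> 0" "1 - b \<noteq> 0"
    using qpoch_neq_0[OF norm_mult_power_less[OF b, of 1]] norm_mult_power_less[OF b, of "Suc N"] b
    by (auto simp: Q_def x_def)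
  have e: "qpoch (b * q) q (Suc N) = Q * x" "qpoch b q (Suc N) = (1 - b) * Q"
    by (simp add: Q_def x_def qpoch_Suc mult.assoc) (simp add: Q_def qpoch_Suc_shift)
  have e': "qpoch b q (Suc (Suc N)) = (1 - b) * (Q * x)"
    by (subst qpoch_Suc_shift) (simp add: e)
  have "bt b (Suc N) 0 = 1 / (Q * x)" "bt b N 0 = 1 / Q"
    using nz by (simp_all add: bt_def numeral_2_eq_2 e e')
  moreover have "1 / (Q * x) - 1 / Q = b * q ^ Suc N / (Q * x)"
    using nz by (simp add: field_simps) (simp add: x_def)
  ultimately show ?case by (simp add: e numeral_2_eq_2)
next
  case (Suc K)
  obtain j where j: "N = K + 1 + j" using Suc.prems by (metis add.commute le_Suc_ex Suc_eq_plus1)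
  define X where "X = q ^ K"
  define Y where "Y = q ^ j"
  define E where "E = (-1) ^ K * b ^ K * q ^ (K\<^sup>2 + (K choose 2))"
  define B where "B = qpoch (b * q ^ Suc (Suc K)) q N"
  define A where "A = qf N"
  define C where "C = qf K"
  define D where "D = qf j"
  have X3: "X ^ 3 = q ^ (3 * K)" by (simp add: X_def mult.commute flip: power_mult)
  have N: "norm (b * q ^ k) < 1" for k by (rule norm_mult_power_less[OF b])
  have nz: "1 - b * q * X \<noteq> 0" "1 - b * X^2 * Y * q^3 \<noteq> 0"
    using one_minus_neq_0[OF N[of "Suc K"]] one_minus_neq_0[OF N[of "2 * K + j + 3"]]
    by (simp_all add: X_def Y_def power_add power_mult power2_eq_square power3_eq_cube mult_ac power_mult_distrib del: one_minus_power_neq_0)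
  have nz2: "1 - q * X \<noteq> 0" "1 - q * Y \<noteq> 0"
    using one_minus_power_neq_0[of "Suc K"] one_minus_power_neq_0[of "Suc j"] by (simp_all add: X_def Y_def)
  have nz3: "B \<noteq> 0" "C \<noteq> 0" "D \<noteq> 0"
    by (simp_all only: B_def C_def D_def qpoch_neq_0[OF N] qf_neq_0 not_False_eq_True)
  have Q1: "qpoch (b * q ^ Suc K) q (Suc N) = (1 - b * q * X) * B"
    by (subst qpoch_Suc_shift) (simp add: B_def X_def mult_ac)
  have Q2: "qpoch (b * q ^ Suc (Suc K)) q (Suc N) = B * (1 - b * X^2 * Y * q^3)"
    by (subst qpoch_Suc) (simp add: B_def X_def Y_def j power_add power2_eq_square power3_eq_cube mult_ac)
  have Q3: "qpoch (b * q ^ Suc K) q (Suc (Suc N)) = (1 - b * q * X) * (B * (1 - b * X^2 * Y * q^3))"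
    using Q2 by (subst qpoch_Suc_shift) (simp add: X_def mult_ac)
  have S: "(Suc K)\<^sup>2 + (Suc K choose 2) = (K\<^sup>2 + (K choose 2)) + (3 * K + 1)"
    by (simp add: Suc_choose_two power2_eq_square)
  have E': "(-1) ^ Suc K * b ^ Suc K * q ^ ((Suc K)\<^sup>2 + (Suc K choose 2)) = - (E * b * X^3 * q)"
  proof -
    have "q ^ (3 * K + 1) = X^3 * q" by (simp add: X_def mult.commute flip: power_mult)
    then show ?thesis unfolding S power_add[of q "K\<^sup>2 + (K choose 2)"] by (simp only: E_def power_Suc) simp
  qed
  have 1: "bt b (Suc N) (Suc K) = A * (1 - X * Y * q^2) * (- (E * b * X^3 * q)) * (1 - b * X^2 * q^2)
      / ((C * (1 - q * X)) * (D * (1 - q * Y)) * ((1 - b * q * X) * (B * (1 - b * X^2 * Y * q^3))))"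
  proof -
    have "qf (Suc N) = A * (1 - X * Y * q^2)"
      unfolding qf_Suc by (simp add: A_def X_def Y_def j power_add power2_eq_square mult_ac)
    moreover have "b * q ^ (2 * Suc K) = b * X^2 * q^2"
      by (simp add: X_def power_add mult_2 mult_2_right power2_eq_square mult_ac)
    moreover have "qf (Suc K) = C * (1 - q * X)" "qf (Suc N - Suc K) = D * (1 - q * Y)"
      by (simp_all add: C_def D_def j X_def Y_def qf_Suc)
    ultimately show ?thesis
      unfolding bt_alt Q3 E' by (simp only:)
  qed
  have 2: "bt b N (Suc K) = A * (- (E * b * X^3 * q)) * (1 - b * X^2 * q^2)
      / ((C * (1 - q * X)) * D * ((1 - b * q * X) * B))"
  proof -
    have "b * q ^ (2 * Suc K) = b * X^2 * q^2"
      by (simp add: X_def power_add mult_2 mult_2_right power2_eq_square mult_ac)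
    moreover have "qf (Suc K) = C * (1 - q * X)" "qf (N - Suc K) = D"
      by (simp_all add: C_def D_def j X_def Y_def qf_Suc)
    ultimately show ?thesis
      unfolding bt_alt Q1 E' by (simp only: A_def)
  qed
  have 3: "qf N * (-1) ^ K * b ^ Suc K * q ^ (K\<^sup>2 + (K choose 2) + N + 2 * K + 1)
     / (qf K * qf (N - K) * qpoch (b * q ^ Suc K) q (Suc N)) =
     A * E * b * (X^3 * Y * q^2) / (C * (D * (1 - q * Y)) * ((1 - b * q * X) * B))"
  proof -
    have "qf (N - K) = D * (1 - q * Y)"
      by (simp add: D_def j Y_def qf_Suc)
    moreover have "q ^ (K\<^sup>2 + (K choose 2) + N + 2 * K + 1) = q ^ (K\<^sup>2 + (K choose 2)) * (X^3 * Y * q^2)"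
      unfolding X3 Y_def power_add[symmetric] by (rule arg_cong[where f = "power q"]) (simp add: j)
    ultimately show ?thesis
      unfolding Q1 by (simp add: A_def E_def C_def mult_ac)
  qed
  have 4: "qf N * (-1) ^ Suc K * b ^ Suc (Suc K) * q ^ ((Suc K)\<^sup>2 + (Suc K choose 2) + N + 2 * Suc K + 1)
     / (qf (Suc K) * qf (N - Suc K) * qpoch (b * q ^ Suc (Suc K)) q (Suc N)) =
     A * (- (E * b * X^3 * q)) * b * (X^3 * Y * q^4) / ((C * (1 - q * X)) * D * (B * (1 - b * X^2 * Y * q^3)))"
  proof -
    have "qf (N - Suc K) = D" "qf (Suc K) = C * (1 - q * X)"
      by (simp_all add: D_def C_def j Y_def X_def qf_Suc)
    moreover have "q ^ ((Suc K)\<^sup>2 + (Suc K choose 2) + N + 2 * Suc K + 1) = q ^ ((Suc K)\<^sup>2 + (Suc K choose 2)) * (X^3 * Y * q^4)"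
      unfolding X3 Y_def power_add[symmetric] by (rule arg_cong[where f = "power q"]) (simp add: j)
    moreover have "(-1) ^ Suc K * b ^ Suc (Suc K) * q ^ ((Suc K)\<^sup>2 + (Suc K choose 2)) = - (E * b * X^3 * q) * b"
      unfolding E'[symmetric] by simp
    moreover have "qf N * (-1) ^ Suc K * b ^ Suc (Suc K) * (x * y) = qf N * ((-1) ^ Suc K * b ^ Suc (Suc K) * x) * y" for x y
      by (simp only: mult.assoc)
    ultimately show ?thesis
      unfolding Q2 A_def by (simp only: mult.assoc[of "qf N" _ b])
  qed
  have "bt b (Suc N) (Suc K) - bt b N (Suc K) =
     A * (- (E * b * X^3 * q)) * b * (X^3 * Y * q^4) / ((C * (1 - q * X)) * D * (B * (1 - b * X^2 * Y * q^3)))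
   - A * E * b * (X^3 * Y * q^2) / (C * (D * (1 - q * Y)) * ((1 - b * q * X) * B))"
  proof -
    \<comment> \<open>All terms share the factor \<open>V\<close>. Once it is removed, the claim is
      a polynomial identity in b, X, Y and q divided by \<open>d1\<close> to \<open>d4\<close>; the
      names keep these factors intact while denominators are cleared.\<close>
    define V where "V = A * E * b * X^3 * q / (C * D * B)"
    define n1 where "n1 = 1 - X * Y * q^2"
    define n2 where "n2 = 1 - b * X^2 * q^2"
    define d1 where "d1 = 1 - q * X"
    define d2 where "d2 = 1 - q * Y"
    define d3 where "d3 = 1 - b * q * X"
    define d4 where "d4 = 1 - b * X^2 * Y * q^3"
    have d: "d1 \<noteq> 0" "d2 \<noteq> 0" "d3 \<noteq> 0" "d4 \<noteq> 0" using nz nz2 by (simp_all add: d1_def d2_def d3_def d4_def)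
    have "- (1 - X * Y * q^2) * (1 - b * X^2 * q^2) + (1 - b * X^2 * q^2) * d2 * d4
      = - b * X^3 * Y * q^4 * d2 * d3 - Y * q * d1 * d4"
      unfolding d1_def d2_def d3_def d4_def by (simp add: algebra_simps eval_nat_numeral)
    then have "- n1 * n2 + n2 * d2 * d4 = - b * X^3 * Y * q^4 * d2 * d3 - Y * q * d1 * d4"
      by (simp only: n1_def n2_def)
    then have "- n1 * n2 / (d1 * d2 * d3 * d4) + n2 / (d1 * d3)
      = - b * X^3 * Y * q^4 / (d1 * d4) - Y * q / (d2 * d3)"
      using d by (simp add: divide_simps) (simp add: algebra_simps)
    then have "V * (- n1 * n2 / (d1 * d2 * d3 * d4) + n2 / (d1 * d3))
      = V * (- b * X^3 * Y * q^4 / (d1 * d4) - Y * q / (d2 * d3))" by simp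
    moreover have "bt b (Suc N) (Suc K) = V * (- n1 * n2 / (d1 * d2 * d3 * d4))"
      unfolding 1 d1_def[symmetric] d2_def[symmetric] d3_def[symmetric] d4_def[symmetric] n1_def[symmetric] n2_def[symmetric]
      by (simp add: V_def mult_ac)
    moreover have "bt b N (Suc K) = - (V * (n2 / (d1 * d3)))"
      unfolding 2 d1_def[symmetric] d2_def[symmetric] d3_def[symmetric] d4_def[symmetric] n1_def[symmetric] n2_def[symmetric]
      by (simp add: V_def mult_ac)
    moreover have "A * (- (E * b * X^3 * q)) * b * (X^3 * Y * q^4) / ((C * d1) * D * (B * d4)) = V * (- b * X^3 * Y * q^4 / (d1 * d4))"
      by (simp add: V_def mult_ac)
    moreover have "A * E * b * (X^3 * Y * q^2) / (C * (D * d2) * (d3 * B)) = V * (Y * q / (d2 * d3))"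
      by (simp add: V_def mult_ac power2_eq_square)
    ultimately show ?thesis
      unfolding d1_def[symmetric] d2_def[symmetric] d3_def[symmetric] d4_def[symmetric]
      by (simp only: right_diff_distrib distrib_left diff_minus_eq_add)
  qed
  then show ?case
    using Suc.IH Suc.prems unfolding 3 4 by (simp only: sum.atMost_Suc) simp
qed

text \<open>This is the terminating very-well-poised 6phi5 summation with two of its parameters sent
  to infinity.\<close>

lemma bt_sum:
  assumes b: "norm b < 1"
  shows "(\<Sum>s\<le>N. bt b N s) = 1"
proof (induction N)
  case 0
  have "1 - b \<noteq> 0" using b by auto
  then show ?case by (simp add: bt_def numeral_2_eq_2 qpoch_Suc)
next
  case (Suc N)
  have N: "norm (b * q ^ k) < 1" for k by (rule norm_mult_power_less[OF b])
  have S: "(Suc N)\<^sup>2 + (Suc N choose 2) = N\<^sup>2 + (N choose 2) + N + 2 * N + 1"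
    by (simp add: Suc_choose_two power2_eq_square)
  have "b * q ^ Suc N * q ^ Suc N = b * q ^ (2 * Suc N)"
    by (simp add: mult_2 mult_2_right power_add mult_ac)
  then have "qpoch (b * q ^ Suc N) q (Suc (Suc N)) = qpoch (b * q ^ Suc N) q (Suc N) * (1 - b * q ^ (2 * Suc N))"
    by (simp only: qpoch_Suc[of _ _ "Suc N"])
  moreover have "1 - b * q ^ (2 * Suc N) \<noteq> 0" "qpoch (b * q ^ Suc N) q (Suc N) \<noteq> 0"
    using one_minus_neq_0[OF N] qpoch_neq_0[OF N] by blast+
  ultimately have "bt b (Suc N) (Suc N) = - (qf N * (-1) ^ N * b ^ Suc N * q ^ (N\<^sup>2 + (N choose 2) + N + 2 * N + 1)
     / (qf N * qf (N - N) * qpoch (b * q ^ Suc N) q (Suc N)))"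
    unfolding bt_def S by simp
  moreover have "(\<Sum>s\<le>N. bt b (Suc N) s) - (\<Sum>s\<le>N. bt b N s) = qf N * (-1) ^ N * b ^ Suc N * q ^ (N\<^sup>2 + (N choose 2) + N + 2 * N + 1)
     / (qf N * qf (N - N) * qpoch (b * q ^ Suc N) q (Suc N))"
    using bt_partial[OF b, of N N] by (simp add: sum_subtractf)
  ultimately show ?case using Suc by (simp only: sum.atMost_Suc) (simp add: diff_eq_eq)
qed

section \<open>Inversion of the Bailey kernel\<close>

lemma bailey_inverse_kernel:
  assumes "e > 0"
  shows "1 / qf N = (\<Sum>s\<le>N. (1 - q ^ (2 * (k + s) + e)) / (qf (N - s) * qf (N + 2 * k + s + e))
     * ((-1) ^ s * q ^ (s * (s + 2 * k + e) + (s choose 2)) * qf (2 * k + s + e - 1) / qf s))"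
proof -
  obtain f where f: "e = Suc f" using assms by (cases e) auto
  define b where "b = q ^ (2 * k + e)"
  have b: "norm b < 1" unfolding b_def using assms norm_q_power_less by simp
  have "1 / qf N = (\<Sum>s\<le>N. bt b N s / qf N)"
    using bt_sum[OF b] by (simp flip: sum_divide_distrib)
  also have "\<dots> = (\<Sum>s\<le>N. (1 - q ^ (2 * (k + s) + e)) / (qf (N - s) * qf (N + 2 * k + s + e))
     * ((-1) ^ s * q ^ (s * (s + 2 * k + e) + (s choose 2)) * qf (2 * k + s + e - 1) / qf s))"
  proof (rule sum.cong)
    fix s
    have "qf (2 * k + s + f + Suc N) = qf (2 * k + s + f) * qpoch (b * q ^ s) q (Suc N)"
      unfolding qf_def qpoch_add[of q q "2 * k + s + f" "Suc N"] by (simp add: b_def f power_add mult_ac)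
    moreover have "2 * k + s + f + Suc N = N + 2 * k + s + e" "2 * k + s + f = 2 * k + s + e - 1" by (simp_all add: f)
    ultimately have 1: "qf (N + 2 * k + s + e) = qf (2 * k + s + e - 1) * qpoch (b * q ^ s) q (Suc N)" by metis
    have 2: "b * q ^ (2 * s) = q ^ (2 * (k + s) + e)" by (simp add: b_def algebra_simps flip: power_add)
    have 3: "b ^ s * q ^ (s\<^sup>2 + (s choose 2)) = q ^ (s * (s + 2 * k + e) + (s choose 2))"
      by (simp add: b_def power2_eq_square algebra_simps flip: power_add power_mult)
    have "bt b N s / qf N = (-1) ^ s * (b ^ s * q ^ (s\<^sup>2 + (s choose 2))) * (1 - b * q ^ (2 * s)) / (qf s * qf (N - s) * qpoch (b * q ^ s) q (Suc N))"
      by (simp add: bt_def mult.assoc del: qpoch_Suc)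
    then show "bt b N s / qf N = (1 - q ^ (2 * (k + s) + e)) / (qf (N - s) * qf (N + 2 * k + s + e))
     * ((-1) ^ s * q ^ (s * (s + 2 * k + e) + (s choose 2)) * qf (2 * k + s + e - 1) / qf s)"
      unfolding 1 3[symmetric] 2[symmetric] by (simp add: mult_ac)
  qed simp
  finally show ?thesis .
qed

text \<open>\<open>bailey_inverse_kernel\<close> expands each \<open>1 / qf (n - k)\<close> in the
  kernels with \<open>k <= r <= n\<close>; the coefficients appear after the sums over k and r are
  exchanged. Up to a constant, the left side is the beta sequence of a Bailey pair relative to q^e,
  and the right side supplies its alpha sequence.\<close>

lemma bailey_inverse:
  assumes "e > 0"
  shows "(\<Sum>k\<le>n. c k / qf (n - k)) = (\<Sum>r\<le>n. (1 - q ^ (2 * r + e)) / (qf (n - r) * qf (n + r + e))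
     * (\<Sum>k\<le>r. c k * (-1) ^ (r - k) * q ^ ((r - k) * (r + k + e) + ((r - k) choose 2)) * qf (r + k + e - 1) / qf (r - k)))"
proof -
  define g where "g r k = (1 - q ^ (2 * r + e)) / (qf (n - r) * qf (n + r + e))
     * (c k * (-1) ^ (r - k) * q ^ ((r - k) * (r + k + e) + ((r - k) choose 2)) * qf (r + k + e - 1) / qf (r - k))" for r k
  have "(\<Sum>k\<le>n. c k / qf (n - k)) = (\<Sum>k\<le>n. \<Sum>r\<in>{k..n}. g r k)"
  proof (rule sum.cong)
    fix k assume "k \<in> {..n}"
    then obtain N where N: "n = k + N" using le_Suc_ex by auto
    have "(\<Sum>r\<in>{k..n}. g r k) = (\<Sum>s\<le>N. g (s + k) k)"
      using sum.shift_bounds_cl_nat_ivl[of "\<lambda>r. g r k" 0 k N] by (simp add: N add.commute atMost_atLeast0)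
    also have "\<dots> = (\<Sum>s\<le>N. c k * ((1 - q ^ (2 * (k + s) + e)) / (qf (N - s) * qf (N + 2 * k + s + e))
     * ((-1) ^ s * q ^ (s * (s + 2 * k + e) + (s choose 2)) * qf (2 * k + s + e - 1) / qf s)))"
      by (rule sum.cong) (auto simp: g_def N algebra_simps mult_2 mult_2_right)
    also have "\<dots> = c k * (1 / qf N)"
      unfolding sum_distrib_left[symmetric] bailey_inverse_kernel[OF assms, symmetric] ..
    finally show "c k / qf (n - k) = (\<Sum>r\<in>{k..n}. g r k)" by (simp add: N)
  qed simp
  also have "\<dots> = (\<Sum>r\<le>n. \<Sum>k\<le>r. g r k)"
    by (subst (1 2) sum.Sigma)
      (auto intro!: sum.reindex_bij_witness[of _ "\<lambda>(r,k). (k,r)" "\<lambda>(k,r). (r,k)"])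
  also have "\<dots> = (\<Sum>r\<le>n. (1 - q ^ (2 * r + e)) / (qf (n - r) * qf (n + r + e))
     * (\<Sum>k\<le>r. c k * (-1) ^ (r - k) * q ^ ((r - k) * (r + k + e) + ((r - k) choose 2)) * qf (r + k + e - 1) / qf (r - k)))"
    by (simp add: g_def sum_distrib_left)
  finally show ?thesis .
qed

end

section \<open>Bounds and the sum over \<open>n\<close>\<close>

lemma norm_qpoch_le:
  assumes "norm a \<le> 1" "norm (q :: complex) < 1"
  shows "norm (qpoch a q n) \<le> exp (1 / (1 - norm q))"
proof -
  have "norm (qpoch a q n) = (\<Prod>k<n. norm (1 - a * q ^ k))"
    by (simp add: qpoch_def prod_norm)
  also have "\<dots> \<le> (\<Prod>k<n. exp (norm q ^ k))"
  proof (rule prod_mono, safe)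
    fix k
    have "norm (1 - a * q ^ k) \<le> 1 + norm a * norm q ^ k"
      using norm_triangle_ineq4[of 1 "a * q ^ k"] by (simp add: norm_mult norm_power)
    also have "\<dots> \<le> 1 + norm q ^ k"
      using assms by (simp add: mult_left_le_one_le)
    also have "\<dots> \<le> exp (norm q ^ k)" by (rule exp_ge_add_one_self)
    finally show "norm (1 - a * q ^ k) \<le> exp (norm q ^ k)" .
  qed simp
  also have "\<dots> = exp (\<Sum>k<n. norm q ^ k)" by (simp add: exp_sum)
  also have "\<dots> \<le> exp (1 / (1 - norm q))"
    using sum_le_suminf[OF summable_geometric[of "norm q"], of "{..<n}"] assms suminf_geometric[of "norm q"] by simp
  finally show ?thesis .
qed

text \<open>Each factor satisfies \<open>1 - x >= exp (- x / (1 - x))\<close> for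
  \<open>x = |q|^(k+1)\<close>. As \<open>x <= |q|\<close>, replacing the denominator by
  \<open>1 - |q|\<close> makes the exponents geometric. Like the upper bound, this one depends on
  neither a nor n, which is what domination in r requires.\<close>

lemma norm_qpoch_ge:
  assumes "norm a \<le> norm q" "norm (q :: complex) < 1"
  shows "norm (qpoch a q n) \<ge> exp (- (norm q / (1 - norm q)\<^sup>2))"
proof -
  define p where "p = norm q"
  have p: "0 \<le> p" "p < 1" using assms by (auto simp: p_def)
  have "(\<Sum>k<n. p ^ Suc k / (1 - p)) = p / (1 - p) * (\<Sum>k<n. p ^ k)"
    by (simp add: sum_distrib_left)
  also have "\<dots> \<le> p / (1 - p) * (1 / (1 - p))"
    using p sum_le_suminf[OF summable_geometric[of p], of "{..<n}"] suminf_geometric[of p]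
    by (intro mult_left_mono) auto
  finally have *: "(\<Sum>k<n. p ^ Suc k / (1 - p)) \<le> p / (1 - p)\<^sup>2" by (simp add: power2_eq_square)
  have "exp (- (p / (1 - p)\<^sup>2)) \<le> exp (- (\<Sum>k<n. p ^ Suc k / (1 - p)))" using * by simp
  also have "\<dots> = (\<Prod>k<n. exp (- (p ^ Suc k / (1 - p))))" by (simp add: exp_sum flip: sum_negf)
  also have "\<dots> \<le> (\<Prod>k<n. norm (1 - a * q ^ k))"
  proof (rule prod_mono, safe)
    fix k
    define x where "x = p ^ Suc k"
    have x: "0 \<le> x" "x \<le> p" using p by (auto simp: x_def mult_left_le power_le_one)
    then have "exp (- (x / (1 - p))) \<le> exp (- (x / (1 - x)))" using p by (simp add: frac_le)
    also have "\<dots> = 1 / exp (x / (1 - x))" by (simp add: exp_minus field_simps)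
    also have "\<dots> \<le> 1 / (1 + x / (1 - x))"
      using exp_ge_add_one_self[of "x / (1 - x)"] x p by (intro divide_left_mono mult_pos_pos add_pos_nonneg) auto
    also have "\<dots> = 1 - x" using x p by (simp add: field_simps)
    also have "\<dots> \<le> norm (1 - a * q ^ k)"
    proof -
      have "norm (a * q ^ k) \<le> x"
        using assms(1) by (simp add: norm_mult norm_power x_def p_def mult_right_mono)
      moreover have "norm (1 - a * q ^ k) \<ge> 1 - norm (a * q ^ k)"
        using norm_triangle_ineq2[of 1 "a * q ^ k"] by simp
      ultimately show ?thesis by linarith
    qed
    finally show "exp (- (p ^ Suc k / (1 - p))) \<le> norm (1 - a * q ^ k)" by (simp add: x_def)
  qed simp
  also have "\<dots> = norm (qpoch a q n)" by (simp add: qpoch_def prod_norm)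
  finally show ?thesis by (simp add: p_def)
qed

context q_disc
begin

text \<open>Adding the bounds for the bases q^2 and q gives one constant that serves both.\<close>

definition qpoch_ub :: real where "qpoch_ub = exp (1 / (1 - norm (q\<^sup>2))) + exp (1 / (1 - norm q))"
definition qpoch_lb :: real where "qpoch_lb = exp (- (norm q / (1 - norm q)\<^sup>2))"

lemma qpoch_ub_pos: "qpoch_ub > 0" by (simp add: qpoch_ub_def add_pos_pos)
lemma qpoch_lb_pos: "qpoch_lb > 0" by (simp add: qpoch_lb_def)

lemma norm_q2: "norm (q\<^sup>2) < 1"
  using norm_q_power_less[of 2] by simp

lemma norm_qpoch_le_ub:
  "norm a \<le> 1 \<Longrightarrow> norm (qpoch a q n) \<le> qpoch_ub" "norm a \<le> 1 \<Longrightarrow> norm (qpoch a (q\<^sup>2) n) \<le> qpoch_ub"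
  using norm_qpoch_le[OF _ norm_q, of a n] norm_qpoch_le[OF _ norm_q2, of a n]
  by (auto simp: qpoch_ub_def intro: order.trans add_increasing add_increasing2)

lemma lb_le_norm_qpoch: "norm a \<le> norm q \<Longrightarrow> qpoch_lb \<le> norm (qpoch a q n)"
  using norm_qpoch_ge[OF _ norm_q, of a n] by (simp add: qpoch_lb_def)

lemma norm_qe_le: "norm (qe n) \<le> qpoch_ub"
  unfolding qe_def using norm_q2 by (intro norm_qpoch_le_ub) simp

lemma lb_le_norm_qf: "qpoch_lb \<le> norm (qf n)"
  unfolding qf_def by (rule lb_le_norm_qpoch) simp

lemma norm_ratio_le: "norm (qe k / (qf m * qf n)) \<le> qpoch_ub / qpoch_lb\<^sup>2"
  using norm_qe_le[of k] lb_le_norm_qf[of m] lb_le_norm_qf[of n] qpoch_lb_pos qpoch_ub_pos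
  unfolding norm_divide norm_mult power2_eq_square
  by (intro frac_le mult_mono mult_pos_pos) auto

section \<open>An infinite q-series with a parameter\<close>

definition tt :: "complex \<Rightarrow> nat \<Rightarrow> complex" where
  "tt y m = qpoch y (q\<^sup>2) m * (- q) ^ m / (qf m * qpoch (y * q) q m)"

text \<open>The factor \<open>y (q - 1 - q^m) + y^2 q^(m + 1)\<close> with \<open>m = M + 1\<close> is the WZ certificate of the recurrence
  in \<open>y\<close>; the boundary term vanishes as \<open>M\<close> grows.\<close>

lemma tt_partial:
  assumes y: "norm y \<le> 1"
  shows "(\<Sum>m\<le>M. tt (y * q\<^sup>2) m - (1 - y * q) * tt y m) =
    - q * (y * (q - 1 - q ^ Suc M) + y\<^sup>2 * q ^ (M + 2)) * qpoch (y * q\<^sup>2) (q\<^sup>2) M * (- q) ^ M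
     / (qf M * qpoch (y * q\<^sup>2) q (Suc M))"
proof -
  have N: "norm (y * q ^ k) < 1" if "k > 0" for k
    using norm_q_power_less[OF that] y
    by (metis mult_left_le_one_le norm_ge_zero norm_mult order.strict_trans1)
  have N2: "1 - y * q ^ k \<noteq> 0" if "k > 0" for k
    using one_minus_neq_0 N[OF that] by blast
  show ?thesis
  proof (induction M)
    case 0
    have "1 - y * q\<^sup>2 \<noteq> 0" using N2[of 2] by simp
    then show ?case
      by (simp add: tt_def qpoch_Suc field_simps power2_eq_square)
  next
    case (Suc M)
    define X where "X = q ^ M"
    define V where "V = qpoch (y * q\<^sup>2) (q\<^sup>2) M * (- q) ^ M"
    define B where "B = qf M"
    define A where "A = qpoch (y * q ^ 3) q M"
    define m1 where "m1 = y * (q - 1 - q\<^sup>2 * X) + y\<^sup>2 * q ^ 3 * X"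
    define m2 where "m2 = 1 - y * q\<^sup>2 * X\<^sup>2"
    define m3 where "m3 = y * (q - 1 - q * X) + y\<^sup>2 * q\<^sup>2 * X"
    define d1 where "d1 = 1 - y * q\<^sup>2"
    define d2 where "d2 = 1 - y * q\<^sup>2 * X"
    define d3 where "d3 = 1 - y * q ^ 3 * X"
    define d4 where "d4 = 1 - q * X"
    define d5 where "d5 = 1 - y * q"
    have nz: "d1 \<noteq> 0" "d2 \<noteq> 0" "d3 \<noteq> 0" "d4 \<noteq> 0" "d5 \<noteq> 0" "A \<noteq> 0" "B \<noteq> 0"
      using N2[of 2] N2[of "2 + M"] N2[of "3 + M"] one_minus_power_neq_0[of "Suc M"] N2[of 1] qpoch_neq_0[OF N[of 3]]
      by (simp_all add: d1_def d2_def d3_def d4_def d5_def X_def A_def B_def power_add mult_ac eval_nat_numeral del: one_minus_power_neq_0)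
    have q3: "qpoch (y * q ^ 3) q (Suc M) = A * d3"
      by (simp add: qpoch_Suc A_def d3_def X_def)
    have yq2: "y * q\<^sup>2 * q = y * q ^ 3" by (simp add: power2_eq_square power3_eq_cube)
    have q2: "qpoch (y * q\<^sup>2) q (Suc M) = d1 * A" "qpoch (y * q\<^sup>2) q (Suc (Suc M)) = d1 * (A * d3)"
      by (simp_all add: qpoch_Suc_shift[of "y * q\<^sup>2"] d1_def A_def yq2 q3[unfolded A_def])
    have "qpoch (y * q\<^sup>2) q M * d2 = d1 * A"
      unfolding q2(1)[symmetric] by (simp add: qpoch_Suc d2_def X_def)
    then have q2': "qpoch (y * q\<^sup>2) q M = d1 * A / d2" using nz by (simp add: field_simps)
    have q1: "qpoch (y * q) q (Suc M) = d5 * (d1 * A / d2)"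
      by (simp add: qpoch_Suc_shift[of "y * q"] d5_def mult.assoc power2_eq_square[symmetric] q2')
    have p2: "qpoch y (q\<^sup>2) (Suc M) * (- q) ^ Suc M = - q * (1 - y) * V"
      by (simp add: qpoch_Suc_shift V_def)
    have p1: "qpoch (y * q\<^sup>2) (q\<^sup>2) (Suc M) * (- q) ^ Suc M = - q * V * (1 - y * q\<^sup>2 * X\<^sup>2)"
      by (simp add: qpoch_Suc V_def X_def mult.assoc mult.commute[of _ 2] flip: power_mult)
    have b: "qf (Suc M) = B * d4" by (simp add: qf_Suc B_def d4_def X_def)
    have t1: "tt (y * q\<^sup>2) (Suc M) = - q * V * (1 - y * q\<^sup>2 * X\<^sup>2) / (B * d4 * (A * d3))"
      unfolding tt_def yq2 q3 p1 b ..
    have t2: "d5 * tt y (Suc M) = - q * (1 - y) * V * d2 / (B * d4 * (d1 * A))"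
      unfolding tt_def q1 p2 b using nz by (simp add: mult.assoc)
    have r1: "- q * (y * (q - 1 - q ^ Suc M) + y\<^sup>2 * q ^ (M + 2)) * qpoch (y * q\<^sup>2) (q\<^sup>2) M * (- q) ^ M
     / (qf M * qpoch (y * q\<^sup>2) q (Suc M)) = - q * (y * (q - 1 - q * X) + y\<^sup>2 * q\<^sup>2 * X) * V / (B * (d1 * A))"
      unfolding q2 by (simp add: V_def B_def X_def power2_eq_square mult_ac)
    have r2: "- q * (y * (q - 1 - q ^ Suc (Suc M)) + y\<^sup>2 * q ^ (Suc M + 2)) * qpoch (y * q\<^sup>2) (q\<^sup>2) (Suc M) * (- q) ^ Suc M
     / (qf (Suc M) * qpoch (y * q\<^sup>2) q (Suc (Suc M)))
     = - q * (y * (q - 1 - q\<^sup>2 * X) + y\<^sup>2 * q ^ 3 * X) * (- q * V * (1 - y * q\<^sup>2 * X\<^sup>2)) / (B * d4 * (d1 * (A * d3)))"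
      unfolding q2 b p1[symmetric] by (simp add: X_def power2_eq_square power3_eq_cube mult_ac)
    have poly: "(1 - y * q\<^sup>2 * X\<^sup>2) * d1 - (1 - y) * d2 * d3
      = - q * (y * (q - 1 - q\<^sup>2 * X) + y\<^sup>2 * q ^ 3 * X) * (1 - y * q\<^sup>2 * X\<^sup>2)
        - (y * (q - 1 - q * X) + y\<^sup>2 * q\<^sup>2 * X) * d4 * d3"
      unfolding d1_def d2_def d3_def d4_def by (simp add: algebra_simps eval_nat_numeral)
    have "tt (y * q\<^sup>2) (Suc M) - d5 * tt y (Suc M)
       = - q * V / (B * d4 * d1 * A * d3) * ((1 - y * q\<^sup>2 * X\<^sup>2) * d1 - (1 - y) * d2 * d3)"
      unfolding t1 t2 using nz by (simp add: divide_simps) (simp add: algebra_simps)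
    also have "\<dots> = - q * V / (B * d4 * d1 * A * d3) * (- q * (y * (q - 1 - q\<^sup>2 * X) + y\<^sup>2 * q ^ 3 * X) * (1 - y * q\<^sup>2 * X\<^sup>2))
       - - q * V / (B * d4 * d1 * A * d3) * ((y * (q - 1 - q * X) + y\<^sup>2 * q\<^sup>2 * X) * d4 * d3)"
      unfolding poly by (rule right_diff_distrib)
    also have "\<dots> = - q * (y * (q - 1 - q\<^sup>2 * X) + y\<^sup>2 * q ^ 3 * X) * (- q * V * (1 - y * q\<^sup>2 * X\<^sup>2)) / (B * d4 * (d1 * (A * d3)))
       - - q * (y * (q - 1 - q * X) + y\<^sup>2 * q\<^sup>2 * X) * V / (B * (d1 * A))"
      using nz by (simp only: m1_def[symmetric] m2_def[symmetric] m3_def[symmetric]) (simp add: mult_ac)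
    finally show ?case
      unfolding sum.atMost_Suc Suc.IH unfolding r1 r2 d5_def by simp
  qed
qed

lemma norm_tt_le:
  assumes "norm y \<le> 1"
  shows "norm (tt y m) \<le> qpoch_ub / qpoch_lb\<^sup>2 * norm q ^ m"
proof -
  have yq: "norm (y * q) \<le> norm q" using assms by (simp add: norm_mult mult_left_le_one_le)
  have "norm (tt y m) = norm (qpoch y (q\<^sup>2) m) / (norm (qf m) * norm (qpoch (y * q) q m)) * norm q ^ m"
    by (simp add: tt_def norm_mult norm_divide norm_power)
  also have "\<dots> \<le> qpoch_ub / qpoch_lb\<^sup>2 * norm q ^ m"
    using norm_qpoch_le_ub(2)[OF assms] lb_le_norm_qf[of m] lb_le_norm_qpoch[OF yq] qpoch_lb_pos qpoch_ub_pos
    unfolding power2_eq_square by (intro mult_right_mono frac_le mult_mono mult_pos_pos) auto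
  finally show ?thesis .
qed

lemma summable_tt: "norm y \<le> 1 \<Longrightarrow> summable (tt y)"
  by (rule summable_comparison_test'[OF summable_mult[OF summable_geometric[of "norm q"]], of 0 _ "qpoch_ub / qpoch_lb\<^sup>2"])
    (use norm_q norm_tt_le in auto)

lemma tt_step:
  assumes y: "norm y \<le> 1"
  shows "suminf (tt (y * q\<^sup>2)) = (1 - y * q) * suminf (tt y)"
proof -
  \<comment> \<open>The lower bound \<open>lb_le_norm_qpoch\<close> asks for a parameter of norm at
    most \<open>norm q\<close>, not merely at most 1.\<close>
  have y2: "norm (y * q\<^sup>2) \<le> norm q"
    using mult_mono[OF y, of "norm q * norm q" "norm q"] mult_left_le[of "norm q" "norm q"] norm_q
    by (simp add: norm_mult power2_eq_square)
  then have y2': "norm (y * q\<^sup>2) \<le> 1" using norm_q by linarith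
  define R where "R M = - q * (y * (q - 1 - q ^ Suc M) + y\<^sup>2 * q ^ (M + 2)) * qpoch (y * q\<^sup>2) (q\<^sup>2) M * (- q) ^ M
     / (qf M * qpoch (y * q\<^sup>2) q (Suc M))" for M
  have "(\<lambda>M. \<Sum>m\<le>M. tt (y * q\<^sup>2) m - (1 - y * q) * tt y m) \<longlonglongrightarrow> (\<Sum>m. tt (y * q\<^sup>2) m - (1 - y * q) * tt y m)"
    using summable_tt[OF y] summable_tt[OF y2'] by (intro summable_LIMSEQ' summable_diff summable_mult)
  moreover have "R \<longlonglongrightarrow> 0"
  proof (rule Lim_null_comparison)
    show "\<forall>\<^sub>F M in sequentially. norm (R M) \<le> (norm q * 4 * qpoch_ub / qpoch_lb\<^sup>2) * norm q ^ M"
    proof (rule always_eventually, rule allI)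
      fix M
      have p: "norm q ^ k \<le> 1" for k using norm_q by (simp add: power_le_one)
      have "norm (y * (q - 1 - q ^ Suc M) + y\<^sup>2 * q ^ (M + 2)) \<le> norm (y * (q - 1 - q ^ Suc M)) + norm (y\<^sup>2 * q ^ (M + 2))"
        by (rule norm_triangle_ineq)
      also have "norm (y * (q - 1 - q ^ Suc M)) \<le> 1 * 3"
        unfolding norm_mult
      proof (intro mult_mono y)
        have "norm (q - 1 - q ^ Suc M) \<le> norm q + 1 + norm (q ^ Suc M)"
          using norm_triangle_ineq4[of "q - 1" "q ^ Suc M"] norm_triangle_ineq4[of q 1] by simp
        then show "norm (q - 1 - q ^ Suc M) \<le> 3" using norm_q p[of "Suc M"] by (simp only: norm_power)
      qed auto
      also have "norm (y\<^sup>2 * q ^ (M + 2)) \<le> 1 * 1"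
        unfolding norm_mult norm_power using y norm_q by (intro mult_mono power_le_one) auto
      finally have k: "norm (y * (q - 1 - q ^ Suc M) + y\<^sup>2 * q ^ (M + 2)) \<le> 4" by simp
      have "norm (R M) = norm q * norm (y * (q - 1 - q ^ Suc M) + y\<^sup>2 * q ^ (M + 2)) * norm (qpoch (y * q\<^sup>2) (q\<^sup>2) M) / (norm (qf M) * norm (qpoch (y * q\<^sup>2) q (Suc M))) * norm q ^ M"
        by (simp add: R_def norm_mult norm_divide norm_power)
      also have "\<dots> \<le> norm q * 4 * qpoch_ub / qpoch_lb\<^sup>2 * norm q ^ M"
        using k norm_qpoch_le_ub(2)[OF y2', of M] lb_le_norm_qf[of M] lb_le_norm_qpoch[OF y2, of "Suc M"] qpoch_lb_pos qpoch_ub_pos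
        unfolding power2_eq_square by (intro mult_right_mono frac_le mult_mono mult_pos_pos) auto
      finally show "norm (R M) \<le> (norm q * 4 * qpoch_ub / qpoch_lb\<^sup>2) * norm q ^ M" .
    qed
    show "(\<lambda>M. (norm q * 4 * qpoch_ub / qpoch_lb\<^sup>2) * norm q ^ M) \<longlonglongrightarrow> 0"
      using norm_q by (intro tendsto_mult_right_zero LIMSEQ_power_zero) simp
  qed
  then have "(\<lambda>M. \<Sum>m\<le>M. tt (y * q\<^sup>2) m - (1 - y * q) * tt y m) \<longlonglongrightarrow> 0"
    unfolding tt_partial[OF y] R_def .
  ultimately have "(\<Sum>m. tt (y * q\<^sup>2) m - (1 - y * q) * tt y m) = 0" using LIMSEQ_unique by blast
  moreover have "(\<Sum>m. tt (y * q\<^sup>2) m - (1 - y * q) * tt y m) = suminf (tt (y * q\<^sup>2)) - (1 - y * q) * suminf (tt y)"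
    using summable_tt[OF y] summable_tt[OF y2'] by (simp add: suminf_diff[symmetric] summable_mult suminf_mult)
  ultimately show ?thesis by simp
qed

text \<open>\<open>tt_step\<close> is iterated from \<open>y = 1\<close>, where
  \<open>qpoch 1 (q^2) m\<close> vanishes for m > 0 and only the term \<open>m = 0\<close> survives.
  With this starting point no limit in y has to be taken.\<close>

lemma suminf_tt: "suminf (tt (q ^ (2 * r))) = qpoch q (q\<^sup>2) r"
proof (induction r)
  case 0
  have "qpoch 1 (q\<^sup>2) (Suc m) = 0" for m
    by (subst qpoch_Suc_shift) simp
  then have *: "tt 1 (Suc m) = 0" for m
    by (simp add: tt_def)
  have "suminf (tt 1) = (\<Sum>m\<in>{0}. tt 1 m)"
    by (intro suminf_finite) (use * in \<open>auto simp: gr0_conv_Suc\<close>)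
  also have "\<dots> = 1" by (simp add: tt_def)
  finally show ?case by simp
next
  case (Suc r)
  have "norm (q ^ (2 * r)) \<le> 1" using norm_q by (simp add: norm_power power_le_one)
  from tt_step[OF this] have "suminf (tt (q ^ (2 * Suc r))) = (1 - q ^ (2 * r) * q) * suminf (tt (q ^ (2 * r)))"
    by (simp only: power_add[symmetric] mult_Suc_right add.commute)
  then show ?case
    unfolding Suc.IH unfolding qpoch_Suc power_mult[of q 2 r] by (simp only: mult.commute)
qed

lemma qf_double: "qf (2 * r) = qe r * qpoch q (q\<^sup>2) r"
proof (induction r)
  case (Suc r)
  have "qf (2 * Suc r) = qf (2 * r) * (1 - q * (q\<^sup>2) ^ r) * (1 - q ^ (2 * r + 2))"
    by (simp add: qf_Suc power_mult[of q 2 r])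
  then show ?case
    unfolding Suc.IH by (simp add: qe_Suc qpoch_Suc)
qed simp

section \<open>The weight of each coefficient in the sum over n\<close>

definition ut :: "nat \<Rightarrow> nat \<Rightarrow> complex" where
  "ut r m = (- q) ^ m * qe (r + m) * (1 - q ^ (2 * r + 2)) / (qf m * qf (m + 2 * r + 2))"

lemma ut_eq: "ut r m = qe (Suc r) / qf (2 * Suc r) * tt (q ^ (2 * Suc r)) m"
proof -
  have "qe (r + m) = qe r * qpoch (q ^ (2 * Suc r)) (q\<^sup>2) m"
    unfolding qe_def qpoch_add by (simp only: power_mult[symmetric] power_add[symmetric]) simp
  moreover have "qf (m + 2 * r + 2) = qf (2 * Suc r) * qpoch (q ^ (2 * Suc r) * q) q m"
    using qpoch_add[of q q "2 * Suc r" m] by (simp add: qf_def add_ac mult_ac)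
  ultimately show ?thesis
    by (simp add: ut_def tt_def qe_Suc mult_ac)
qed

text \<open>The factor independent of m is the reciprocal of the product in
  \<open>suminf_tt\<close>, because (q;q)_(2r) splits into its even and odd factors
  (\<open>qf_double\<close>).\<close>

lemma ut_sums: "ut r sums 1"
proof -
  have "norm (q ^ (2 * Suc r)) \<le> 1" using norm_q by (simp only: norm_power) (simp add: power_le_one del: power_Suc)
  from summable_sums[OF summable_tt[OF this]] have "ut r sums (qe (Suc r) / qf (2 * Suc r) * qpoch q (q\<^sup>2) (Suc r))"
    unfolding ut_eq suminf_tt by (rule sums_mult)
  moreover have "qe (Suc r) / qf (2 * Suc r) * qpoch q (q\<^sup>2) (Suc r) = 1"
    using qf_neq_0[of "2 * Suc r"] unfolding qf_double by simp
  ultimately show ?thesis by simp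
qed

lemma norm_ut_le: "norm (ut r m) \<le> 2 * (qpoch_ub / qpoch_lb\<^sup>2) * norm q ^ m"
proof -
  have "norm (1 - q ^ (2 * r + 2)) \<le> 2"
    using norm_triangle_ineq4[of 1 "q ^ (2 * r + 2)"] norm_q_power_less[of "2 * r + 2"] by simp
  then have "norm (1 - q ^ (2 * r + 2)) * norm (qe (r + m) / (qf m * qf (m + 2 * r + 2))) * norm q ^ m
     \<le> 2 * (qpoch_ub / qpoch_lb\<^sup>2) * norm q ^ m"
    by (intro mult_right_mono mult_mono norm_ratio_le) auto
  then show ?thesis by (simp add: ut_def norm_mult norm_divide norm_power mult_ac)
qed

definition ut_bound :: real where "ut_bound = 2 * (qpoch_ub / qpoch_lb\<^sup>2) / (1 - norm q)"

lemma norm_ut_sum_le: "norm (\<Sum>m<M. ut r m) \<le> ut_bound"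
proof -
  have "norm (\<Sum>m<M. ut r m) \<le> (\<Sum>m<M. 2 * (qpoch_ub / qpoch_lb\<^sup>2) * norm q ^ m)"
    by (rule sum_norm_le[OF norm_ut_le])
  also have "\<dots> = 2 * (qpoch_ub / qpoch_lb\<^sup>2) * (\<Sum>m<M. norm q ^ m)" by (simp add: sum_distrib_left)
  also have "\<dots> \<le> 2 * (qpoch_ub / qpoch_lb\<^sup>2) * (1 / (1 - norm q))"
    using norm_q sum_le_suminf[OF summable_geometric[of "norm q"], of "{..<M}"] suminf_geometric[of "norm q"] qpoch_ub_pos qpoch_lb_pos
    by (intro mult_left_mono) auto
  finally show ?thesis by (simp add: ut_bound_def)
qed

end

section \<open>The four series as single series in \<open>r\<close>\<close>

lemma tendsto_suminf_dominated:
  fixes a :: "nat \<Rightarrow> nat \<Rightarrow> complex"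
  assumes "\<And>r. a r \<longlonglongrightarrow> b r" "\<And>r n. norm (a r n) \<le> M r" "summable M"
  shows "(\<lambda>n. \<Sum>r. a r n) \<longlonglongrightarrow> suminf b"
proof -
  have "eventually (\<lambda>(k,n). norm (a k n) \<le> M k) (at_top \<times>\<^sub>F sequentially)"
    using assms(2) by (intro always_eventually) auto
  from tannerys_theorem[OF assms(1) this assms(3)] show ?thesis by simp
qed

lemma sum_triangle_diff:
  fixes y :: "nat \<Rightarrow> nat \<Rightarrow> complex"
  shows "(\<Sum>n<M. \<Sum>r\<le>n. B r * y r (n - r)) = (\<Sum>r<M. B r * (\<Sum>m<M - r. y r m))"
  unfolding sum_distrib_left
  by (subst (1 2) sum.Sigma)
    (auto intro!: sum.reindex_bij_witness[of _ "\<lambda>(r,m). (r + m,r)" "\<lambda>(n,r). (r,n - r)"])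

text \<open>For \<open>r >= M\<close> the difference \<open>M - r\<close> truncates to 0 and the
  inner sum is empty, so the range may be enlarged. Two partial sums of different length thus get a
  common range in r.\<close>

lemma sum_triangle_diff_suminf:
  fixes y :: "nat \<Rightarrow> nat \<Rightarrow> complex"
  assumes "M \<le> K"
  shows "(\<Sum>n<M. \<Sum>r\<le>n. B r * y r (n - r)) = (\<Sum>r<K. B r * (\<Sum>m<M - r. y r m))"
  unfolding sum_triangle_diff
  using assms by (intro sum.mono_neutral_left) auto

context q_disc
begin

text \<open>Tannery's theorem with majorant \<open>norm (B r) * ut_bound\<close>: the partial sums
  of \<open>ut r\<close> are bounded uniformly in r, and each tends to 1.\<close>

lemma ut_triangle_sums:
  assumes "summable (\<lambda>r. norm (B r))"
  shows "(\<lambda>n. \<Sum>r\<le>n. B r * ut r (n - r)) sums suminf B"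
proof -
  have "(\<lambda>M. \<Sum>r. B r * (\<Sum>m<M - r. ut r m)) \<longlonglongrightarrow> suminf B"
  proof (rule tendsto_suminf_dominated)
    fix r
    have "(\<lambda>M. \<Sum>m<M. ut r m) \<longlonglongrightarrow> 1" using ut_sums by (simp add: sums_def)
    then have "(\<lambda>M. \<Sum>m<M - r. ut r m) \<longlonglongrightarrow> 1"
      by (rule filterlim_compose) (simp add: filterlim_minus_const_nat_at_top)
    then have "(\<lambda>M. B r * (\<Sum>m<M - r. ut r m)) \<longlonglongrightarrow> B r * 1" by (intro tendsto_intros)
    then show "(\<lambda>M. B r * (\<Sum>m<M - r. ut r m)) \<longlonglongrightarrow> B r" by simp
    show "norm (B r * (\<Sum>m<M - r. ut r m)) \<le> norm (B r) * ut_bound" for M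
      unfolding norm_mult by (intro mult_left_mono norm_ut_sum_le) auto
  qed (use assms in \<open>simp add: summable_mult2\<close>)
  moreover have "(\<Sum>r. B r * (\<Sum>m<M - r. ut r m)) = (\<Sum>n<M. \<Sum>r\<le>n. B r * ut r (n - r))" for M
    unfolding sum_triangle_diff by (rule suminf_finite) auto
  ultimately show ?thesis by (simp add: sums_def)
qed

section \<open>Averaged summation\<close>

definition vt :: "nat \<Rightarrow> nat \<Rightarrow> complex" where
  "vt r m = (-1) ^ m * qe (r + m) / (qf m * qf (m + 2 * r + 1))"

lemma norm_vt_le: "norm (vt r m) \<le> qpoch_ub / qpoch_lb\<^sup>2"
  using norm_ratio_le[of "r + m" m "m + 2 * r + 1"]
  by (simp add: vt_def norm_mult norm_divide norm_power)

text \<open>Rearranged, \<open>vt r k + vt r (Suc k)\<close> equals \<open>ut r k\<close> plus the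
  increment of \<open>q^k * vt r k\<close>. This links the kernels for \<open>e = 1\<close> and
  \<open>e = 2\<close> and is the induction step of \<open>vt_average\<close>.\<close>

lemma vt_ut: "(1 + q ^ k) * vt r k + (1 - q ^ Suc k) * vt r (Suc k) = ut r k"
proof -
  define X where "X = q ^ k"
  define Y where "Y = q ^ (2 * r)"
  define A where "A = qe (r + k)"
  define B where "B = qf k"
  define C where "C = qf (k + 2 * r + 1)"
  define P where "P = (-1) ^ k * A / (B * (C * (1 - X * Y * q\<^sup>2)))"
  define d1 where "d1 = 1 - q * X"
  define d2 where "d2 = 1 - X * Y * q\<^sup>2"
  have nz: "B \<noteq> 0" "C \<noteq> 0" "d1 \<noteq> 0" "d2 \<noteq> 0"
    using one_minus_power_neq_0[of "Suc k"] one_minus_power_neq_0[of "k + 2 * r + 2"]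
    by (simp_all add: B_def C_def d1_def d2_def X_def Y_def power_add power2_eq_square mult_ac del: one_minus_power_neq_0)
  have e1: "qf (k + 2 * r + 2) = C * d2"
  proof -
    have "k + 2 * r + 2 = Suc (k + 2 * r + 1)" by simp
    then show ?thesis
      by (simp only: qf_Suc) (simp add: C_def d2_def X_def Y_def power_add power2_eq_square mult_ac)
  qed
  have e2: "qe (r + Suc k) = A * (1 - X\<^sup>2 * Y * q\<^sup>2)"
    by (simp add: qe_Suc A_def X_def Y_def power_add power2_eq_square mult_2 mult_2_right mult_ac)
  have 1: "vt r k = (-1) ^ k * A / (B * C)" by (simp add: vt_def A_def B_def C_def)
  have 2: "(1 - q ^ Suc k) * vt r (Suc k) = - ((-1) ^ k * A * (1 - X\<^sup>2 * Y * q\<^sup>2)) / (B * (C * d2))"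
  proof -
    have "qf (Suc k) = B * d1" "qf (Suc k + 2 * r + 1) = C * d2" "1 - q ^ Suc k = d1"
      using e1 by (simp_all add: qf_Suc B_def d1_def X_def)
    then show ?thesis
      unfolding vt_def e2 using nz by (simp only:) (simp add: mult_ac)
  qed
  have 3: "ut r k = (-1) ^ k * X * A * (1 - Y * q\<^sup>2) / (B * (C * d2))"
    unfolding ut_def e1 by (simp add: A_def B_def X_def Y_def power_add power_minus[of q] power2_eq_square mult_ac)
  have "(1 + X) * d2 - (1 - X\<^sup>2 * Y * q\<^sup>2) = X * (1 - Y * q\<^sup>2)"
    by (simp add: d2_def algebra_simps power2_eq_square)
  then have "P * ((1 + X) * d2) - P * (1 - X\<^sup>2 * Y * q\<^sup>2) = P * (X * (1 - Y * q\<^sup>2))"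
    by (simp only: right_diff_distrib[symmetric])
  moreover have "(1 + X) * vt r k = P * ((1 + X) * d2)"
    using nz by (simp add: 1 P_def d2_def)
  moreover have "(1 - q ^ Suc k) * vt r (Suc k) = - (P * (1 - X\<^sup>2 * Y * q\<^sup>2))"
    unfolding 2 P_def d2_def by simp
  moreover have "ut r k = P * (X * (1 - Y * q\<^sup>2))"
    unfolding 3 P_def d2_def by (simp add: mult_ac)
  ultimately show ?thesis unfolding X_def[symmetric] by (simp only: diff_conv_add_uminus)
qed

text \<open>The alternating terms \<open>vt r m\<close> do not tend to 0. Averaging two consecutive partial sums gives the
  convergent sum of \<open>ut r m\<close> up to a vanishing term.\<close>

lemma vt_average: "(\<Sum>m<k. vt r m) + (\<Sum>m<Suc k. vt r m) = (\<Sum>m<k. ut r m) + q ^ k * vt r k"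
proof (induction k)
  case (Suc k)
  then show ?case using vt_ut[of k r] by (simp add: algebra_simps)
qed simp

lemma vt_triangle_starsums:
  assumes "summable (\<lambda>r. norm (B r))"
  shows "starsums (\<lambda>n. \<Sum>r\<le>n. B r * vt r (n - r)) (suminf B / 2)"
proof -
  \<comment> \<open>For fixed r, the partial sums up to 2N and 2N + 1 contain 2N + 1 - r and 2N + 2
    - r terms of \<open>vt r\<close>. These numbers are consecutive, so \<open>vt_average\<close>
    applies whatever the parity of r; at \<open>r = 2N + 1\<close> the shorter sum is empty.\<close>
  define Z where "Z r N = (if r \<le> 2 * N + 1 then (\<Sum>m<2 * N + 1 - r. ut r m) + q ^ (2 * N + 1 - r) * vt r (2 * N + 1 - r) else 0)" for r N
  have ev: "(\<lambda>N. \<Sum>r. B r * Z r N) \<longlonglongrightarrow> suminf B"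
  proof (rule tendsto_suminf_dominated)
    fix r
    have lim: "filterlim (\<lambda>N. 2 * N + 1 - r) at_top sequentially"
      by (rule filterlim_at_top_mono[of "\<lambda>N. N - r"]) (auto intro!: filterlim_minus_const_nat_at_top always_eventually)
    have "(\<lambda>M. \<Sum>m<M. ut r m) \<longlonglongrightarrow> 1" using ut_sums by (simp add: sums_def)
    moreover have "(\<lambda>k. q ^ k * vt r k) \<longlonglongrightarrow> 0"
    proof (rule Lim_null_comparison)
      show "\<forall>\<^sub>F k in sequentially. norm (q ^ k * vt r k) \<le> norm q ^ k * (qpoch_ub / qpoch_lb\<^sup>2)"
        unfolding norm_mult norm_power by (intro always_eventually allI mult_left_mono norm_vt_le) auto
      show "(\<lambda>k. norm q ^ k * (qpoch_ub / qpoch_lb\<^sup>2)) \<longlonglongrightarrow> 0"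
        using norm_q by (intro tendsto_mult_left_zero LIMSEQ_power_zero) simp
    qed
    ultimately have "(\<lambda>k. (\<Sum>m<k. ut r m) + q ^ k * vt r k) \<longlonglongrightarrow> 1 + 0" by (rule tendsto_add)
    from filterlim_compose[OF this lim]
    have "(\<lambda>N. (\<Sum>m<2 * N + 1 - r. ut r m) + q ^ (2 * N + 1 - r) * vt r (2 * N + 1 - r)) \<longlonglongrightarrow> 1" by simp
    moreover have "\<forall>\<^sub>F N in sequentially. (\<Sum>m<2 * N + 1 - r. ut r m) + q ^ (2 * N + 1 - r) * vt r (2 * N + 1 - r) = Z r N"
      using eventually_ge_at_top[of r] by eventually_elim (simp add: Z_def)
    ultimately have "Z r \<longlonglongrightarrow> 1" by (rule Lim_transform_eventually)
    then have "(\<lambda>N. B r * Z r N) \<longlonglongrightarrow> B r * 1" by (intro tendsto_intros)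
    then show "(\<lambda>N. B r * Z r N) \<longlonglongrightarrow> B r" by simp
    show "norm (B r * Z r N) \<le> norm (B r) * (ut_bound + qpoch_ub / qpoch_lb\<^sup>2)" for N
      unfolding norm_mult
    proof (rule mult_left_mono)
      have "norm (q ^ k * vt r k) \<le> 1 * (qpoch_ub / qpoch_lb\<^sup>2)" for k
        unfolding norm_mult norm_power using norm_q by (intro mult_mono norm_vt_le power_le_one) auto
      then have "norm ((\<Sum>m<k. ut r m) + q ^ k * vt r k) \<le> ut_bound + qpoch_ub / qpoch_lb\<^sup>2" for k
        using norm_ut_sum_le[of r k] by (intro norm_triangle_le add_mono) auto
      moreover have "0 \<le> ut_bound + qpoch_ub / qpoch_lb\<^sup>2"
        using norm_q qpoch_ub_pos qpoch_lb_pos by (simp add: ut_bound_def)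
      ultimately show "norm (Z r N) \<le> ut_bound + qpoch_ub / qpoch_lb\<^sup>2" by (simp add: Z_def)
    qed simp
  qed (use assms in \<open>simp add: summable_mult2\<close>)
  have "(\<Sum>r. B r * Z r N) = (\<Sum>n\<le>2 * N. \<Sum>r\<le>n. B r * vt r (n - r)) + (\<Sum>n\<le>2 * N + 1. \<Sum>r\<le>n. B r * vt r (n - r))" for N
  proof -
    have "(\<Sum>n\<le>2 * N. \<Sum>r\<le>n. B r * vt r (n - r)) + (\<Sum>n\<le>2 * N + 1. \<Sum>r\<le>n. B r * vt r (n - r))
       = (\<Sum>r<2 * N + 2. B r * (\<Sum>m<2 * N + 1 - r. vt r m)) + (\<Sum>r<2 * N + 2. B r * (\<Sum>m<2 * N + 2 - r. vt r m))"
      using sum_triangle_diff_suminf[of "2 * N + 1" "2 * N + 2" B vt] sum_triangle_diff_suminf[of "2 * N + 2" "2 * N + 2" B vt]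
      by (simp add: lessThan_Suc_atMost)
    also have "\<dots> = (\<Sum>r<2 * N + 2. B r * Z r N)"
      unfolding sum.distrib[symmetric]
    proof (rule sum.cong)
      fix r assume "r \<in> {..<2 * N + 2}"
      then have r: "r \<le> 2 * N + 1" "2 * N + 2 - r = Suc (2 * N + 1 - r)" by auto
      show "B r * (\<Sum>m<2 * N + 1 - r. vt r m) + B r * (\<Sum>m<2 * N + 2 - r. vt r m) = B r * Z r N"
        unfolding r(2) distrib_left[symmetric] vt_average using r(1) by (simp add: Z_def)
    qed simp
    also have "\<dots> = (\<Sum>r. B r * Z r N)"
      by (rule suminf_finite[symmetric]) (auto simp: Z_def)
    finally show ?thesis by simp
  qed
  with tendsto_divide[OF ev tendsto_const[of "2"]] show ?thesis
    unfolding starsums_def by simp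
qed

section \<open>Expansion of the four series in P5 and P6\<close>

lemma norm_P5_le: "norm (P5 n) \<le> real n"
proof -
  have "norm (\<Sum>i<n. q ^ (2 * i * (n - i))) \<le> (\<Sum>i<n. 1)"
    by (rule sum_norm_le) (use norm_q in \<open>simp add: norm_power power_le_one\<close>)
  then show ?thesis using P5_P6_eq[of n] by simp
qed

lemma norm_P6_le: "norm (P6 n) \<le> real n"
proof -
  have "norm (\<Sum>i<n. q ^ (2 * i * (n - Suc i))) \<le> (\<Sum>i<n. 1)"
    by (rule sum_norm_le) (use norm_q in \<open>simp add: norm_power power_le_one\<close>)
  then show ?thesis using P5_P6_eq[of n] by simp
qed

lemma summable_power_le:
  assumes "\<And>r. r \<le> e r" "\<And>r. norm (A r) \<le> C * real (Suc r)"
  shows "summable (\<lambda>r. norm (q ^ e r * A r :: complex))"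
proof (rule summable_comparison_test')
  show "summable (\<lambda>r. C * (real (Suc r) * norm q ^ r))"
    using norm_q geometric_deriv_sums[of "norm q"] by (intro summable_mult) (auto simp: sums_iff)
  fix r
  have "norm q ^ e r \<le> norm q ^ r" using assms(1) norm_q by (intro power_decreasing) auto
  then have "norm q ^ e r * norm (A r) \<le> norm q ^ r * (C * real (Suc r))"
    using assms(2) by (intro mult_mono) auto
  then show "norm (norm (q ^ e r * A r)) \<le> C * (real (Suc r) * norm q ^ r)"
    by (simp add: norm_mult norm_power mult_ac)
qed

lemma qpoch_uminus: "qpoch (- q) q n * qf n = qe n"
proof (induction n)
  case (Suc n)
  have "(1 - (- q) * q ^ n) * (1 - q ^ Suc n) = 1 - q ^ (2 * n + 2)"
    by (simp add: algebra_simps power_add mult_2_right mult_2)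
  then show ?case
    using Suc by (simp add: qpoch_Suc qf_Suc qe_Suc del: power_Suc) (metis mult.assoc mult.commute mult.left_commute)
qed simp

text \<open>The prefactor simplifies by (-1)_(n+1) (q)_n = 2 (-q)_n (q)_n = 2 (q^2;q^2)_n. Shifting
  n and k by one brings the term into the shape handled by \<open>bailey_ut\<close>.\<close>

lemma L5_term_Suc:
  "L5_term q (Suc n) = 2 * q * (- q) ^ n * qe n * (\<Sum>k\<le>n. (-1) ^ k * q ^ (k\<^sup>2 + k) / dk k / qf (n - k))"
proof -
  have h: "qpoch (-1) q (Suc n) * qpoch q q n = 2 * qe n"
    using qpoch_uminus[of n] by (simp add: qpoch_Suc_shift qf_def)
  have "L5_term q (Suc n) = (\<Sum>k\<le>n. qpoch (-1) q (Suc n) * qpoch q q n * (-1) ^ (Suc n + Suc k) * q ^ (Suc n + (Suc k)\<^sup>2 - Suc k)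
      / (qpoch q q (n - k) * qpoch (q\<^sup>2) (q\<^sup>2) k * (1 - q ^ (2 * Suc k - 1))))"
    unfolding L5_term_def by (simp add: atMost_atLeast0 sum.atLeast_Suc_atMost_Suc_shift del: sum.cl_ivl_Suc)
  also have "\<dots> = (\<Sum>k\<le>n. 2 * q * (- q) ^ n * qe n * ((-1) ^ k * q ^ (k\<^sup>2 + k) / dk k / qf (n - k)))"
  proof (rule sum.cong)
    fix k
    have "Suc n + (Suc k)\<^sup>2 - Suc k = Suc n + (k\<^sup>2 + k)" by (simp add: power2_eq_square)
    then show "qpoch (-1) q (Suc n) * qpoch q q n * (-1) ^ (Suc n + Suc k) * q ^ (Suc n + (Suc k)\<^sup>2 - Suc k)
      / (qpoch q q (n - k) * qpoch (q\<^sup>2) (q\<^sup>2) k * (1 - q ^ (2 * Suc k - 1)))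
      = 2 * q * (- q) ^ n * qe n * ((-1) ^ k * q ^ (k\<^sup>2 + k) / dk k / qf (n - k))"
      unfolding h by (simp add: dk_def qf_def qe_def[symmetric] power_add power_minus[of q] mult_ac)
  qed simp
  finally show ?thesis by (simp only: sum_distrib_left)
qed

lemma L6_term_Suc:
  "L6_term q (Suc n) = 2 * q\<^sup>2 * (- q) ^ n * qe n * (\<Sum>k\<le>n. (-1) ^ k * q ^ (k\<^sup>2 + 2 * k) / dk k / qf (n - k))"
proof -
  have h: "qpoch (-1) q (Suc n) * qpoch q q n = 2 * qe n"
    using qpoch_uminus[of n] by (simp add: qpoch_Suc_shift qf_def)
  have "L6_term q (Suc n) = (\<Sum>k\<le>n. qpoch (-1) q (Suc n) * qpoch q q n * (-1) ^ (Suc n + Suc k) * q ^ (Suc n + (Suc k)\<^sup>2)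
      / (qpoch q q (n - k) * qpoch (q\<^sup>2) (q\<^sup>2) k * (1 - q ^ (2 * Suc k - 1))))"
    unfolding L6_term_def by (simp add: atMost_atLeast0 sum.atLeast_Suc_atMost_Suc_shift del: sum.cl_ivl_Suc)
  also have "\<dots> = (\<Sum>k\<le>n. 2 * q\<^sup>2 * (- q) ^ n * qe n * ((-1) ^ k * q ^ (k\<^sup>2 + 2 * k) / dk k / qf (n - k)))"
  proof (rule sum.cong)
    fix k
    have "Suc n + (Suc k)\<^sup>2 = 2 + n + (k\<^sup>2 + 2 * k)" by (simp add: power2_eq_square)
    then have "q ^ (Suc n + (Suc k)\<^sup>2) = q\<^sup>2 * q ^ n * q ^ (k\<^sup>2 + 2 * k)" by (simp only: power_add)
    then show "qpoch (-1) q (Suc n) * qpoch q q n * (-1) ^ (Suc n + Suc k) * q ^ (Suc n + (Suc k)\<^sup>2)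
      / (qpoch q q (n - k) * qpoch (q\<^sup>2) (q\<^sup>2) k * (1 - q ^ (2 * Suc k - 1)))
      = 2 * q\<^sup>2 * (- q) ^ n * qe n * ((-1) ^ k * q ^ (k\<^sup>2 + 2 * k) / dk k / qf (n - k))"
      unfolding h by (simp add: dk_def qf_def qe_def[symmetric] power_minus[of q] power_add[of "-1"] mult_ac)
  qed simp
  finally show ?thesis by (simp only: sum_distrib_left)
qed

lemma L7_term_eq:
  "L7_term q n = (-1) ^ n * qe n * (\<Sum>k\<le>n. (-1) ^ k * q ^ (k\<^sup>2 + k) / dk k / qf (n - k))"
  unfolding L7_term_def sum_distrib_left
  by (rule sum.cong) (simp_all add: dk_def qf_def qe_def[symmetric] power_add mult_ac)

lemma L8_term_eq:
  "L8_term q n = (-1) ^ n * qe n * (\<Sum>k\<le>n. (-1) ^ k * q ^ k\<^sup>2 / dk k / qf (n - k))"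
  unfolding L8_term_def sum_distrib_left
  by (rule sum.cong) (simp_all add: dk_def qf_def qe_def[symmetric] power_add mult_ac)

lemma minus_one_power_diff: "k \<le> r \<Longrightarrow> (-1) ^ k * (-1) ^ (r - k) = ((-1) ^ r :: complex)"
  by (simp flip: power_add)

text \<open>The exponent \<open>f\<close> stays open so that \<open>L7\<close> and \<open>L8\<close>
  are both covered. The signs of the series and of the inversion combine to (-1)^r, which together
  with (-1)^n becomes the sign of \<open>vt r (n - r)\<close>.\<close>

lemma bailey_vt:
  "(-1) ^ n * qe n * (\<Sum>k\<le>n. (-1) ^ k * q ^ f k / dk k / qf (n - k)) =
     (\<Sum>r\<le>n. (1 - q ^ (2 * r + 1)) * (\<Sum>k\<le>r. q ^ (f k + (r - k) * (r + k + 1) + ((r - k) choose 2)) * wt r k) * vt r (n - r))"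
proof (subst bailey_inverse[of 1, OF zero_less_one], subst sum_distrib_left, rule sum.cong)
  fix r assume "r \<in> {..n}"
  then obtain m where n: "n = r + m" using le_Suc_ex by auto
  have s: "(\<Sum>k\<le>r. (-1) ^ k * q ^ f k / dk k * (-1) ^ (r - k) * q ^ ((r - k) * (r + k + 1) + ((r - k) choose 2)) * qf (r + k + 1 - 1) / qf (r - k))
    = (-1) ^ r * (\<Sum>k\<le>r. q ^ (f k + (r - k) * (r + k + 1) + ((r - k) choose 2)) * wt r k)"
    unfolding sum_distrib_left
  proof (rule sum.cong)
    fix k assume "k \<in> {..r}"
    then have "(-1) ^ r = (-1) ^ k * ((-1) ^ (r - k) :: complex)" using minus_one_power_diff[of k r] by simp
    then show "(-1) ^ k * q ^ f k / dk k * (-1) ^ (r - k) * q ^ ((r - k) * (r + k + 1) + ((r - k) choose 2)) * qf (r + k + 1 - 1) / qf (r - k)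
      = (-1) ^ r * (q ^ (f k + (r - k) * (r + k + 1) + ((r - k) choose 2)) * wt r k)"
      by (simp add: wt_def power_add mult_ac)
  qed simp
  have sgn: "(-1) ^ n * (-1) ^ r = ((-1) ^ (n - r) :: complex)" by (simp add: n power_add mult_ac flip: power_mult_distrib)
  have idx: "n + r + 1 = n - r + 2 * r + 1" "r + (n - r) = n" by (simp_all add: n)
  show "(-1) ^ n * qe n * ((1 - q ^ (2 * r + 1)) / (qf (n - r) * qf (n + r + 1)) *
      (\<Sum>k\<le>r. (-1) ^ k * q ^ f k / dk k * (-1) ^ (r - k) * q ^ ((r - k) * (r + k + 1) + ((r - k) choose 2)) * qf (r + k + 1 - 1) / qf (r - k)))
    = (1 - q ^ (2 * r + 1)) * (\<Sum>k\<le>r. q ^ (f k + (r - k) * (r + k + 1) + ((r - k) choose 2)) * wt r k) * vt r (n - r)"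
    unfolding s vt_def idx sgn[symmetric] by (simp add: mult_ac)
qed simp

text \<open>As in \<open>bailey_vt\<close>, now with \<open>e = 2\<close>. The additional q^n is
  shared out: q^r goes to the coefficient and q^(n-r) to \<open>ut\<close>.\<close>

lemma bailey_ut:
  "(- q) ^ n * qe n * (\<Sum>k\<le>n. (-1) ^ k * q ^ f k / dk k / qf (n - k)) =
     (\<Sum>r\<le>n. q ^ r * (\<Sum>k\<le>r. q ^ (f k + (r - k) * (r + k + 2) + ((r - k) choose 2)) * qf (Suc r + k) / (qf (r - k) * dk k)) * ut r (n - r))"
proof (subst bailey_inverse[of 2, OF zero_less_numeral], subst sum_distrib_left, rule sum.cong)
  fix r assume "r \<in> {..n}"
  then obtain m where n: "n = r + m" using le_Suc_ex by auto
  have s: "(\<Sum>k\<le>r. (-1) ^ k * q ^ f k / dk k * (-1) ^ (r - k) * q ^ ((r - k) * (r + k + 2) + ((r - k) choose 2)) * qf (r + k + 2 - 1) / qf (r - k))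
    = (-1) ^ r * (\<Sum>k\<le>r. q ^ (f k + (r - k) * (r + k + 2) + ((r - k) choose 2)) * qf (Suc r + k) / (qf (r - k) * dk k))"
    unfolding sum_distrib_left
  proof (rule sum.cong)
    fix k assume "k \<in> {..r}"
    then have "(-1) ^ r = (-1) ^ k * ((-1) ^ (r - k) :: complex)" using minus_one_power_diff[of k r] by simp
    then show "(-1) ^ k * q ^ f k / dk k * (-1) ^ (r - k) * q ^ ((r - k) * (r + k + 2) + ((r - k) choose 2)) * qf (r + k + 2 - 1) / qf (r - k)
      = (-1) ^ r * (q ^ (f k + (r - k) * (r + k + 2) + ((r - k) choose 2)) * qf (Suc r + k) / (qf (r - k) * dk k))"
      by (simp add: power_add mult_ac)
  qed simp
  have sgn: "(- q) ^ n * (-1) ^ r = q ^ r * (- q) ^ (n - r)"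
  proof -
    have "(- q) ^ n * (-1) ^ r = ((- q) ^ r * (-1) ^ r) * (- q) ^ m" by (simp add: n power_add)
    also have "(- q) ^ r * (-1) ^ r = q ^ r" by (simp flip: power_mult_distrib)
    finally show ?thesis by (simp add: n)
  qed
  have idx: "n + r + 2 = n - r + 2 * r + 2" "r + (n - r) = n" by (simp_all add: n)
  have "(- q) ^ n * qe n * (x / (y * z) * ((-1) ^ r * S)) = q ^ r * S * ((- q) ^ (n - r) * qe n * x / (y * z))" for x y z S
  proof -
    have "(- q) ^ n * qe n * (x / (y * z) * ((-1) ^ r * S)) = ((- q) ^ n * (-1) ^ r) * (qe n * x * S / (y * z))"
      by (simp add: mult_ac)
    then show ?thesis unfolding sgn by (simp add: mult_ac)
  qed
  then show "(- q) ^ n * qe n * ((1 - q ^ (2 * r + 2)) / (qf (n - r) * qf (n + r + 2)) *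
      (\<Sum>k\<le>r. (-1) ^ k * q ^ f k / dk k * (-1) ^ (r - k) * q ^ ((r - k) * (r + k + 2) + ((r - k) choose 2)) * qf (r + k + 2 - 1) / qf (r - k)))
    = q ^ r * (\<Sum>k\<le>r. q ^ (f k + (r - k) * (r + k + 2) + ((r - k) choose 2)) * qf (Suc r + k) / (qf (r - k) * dk k)) * ut r (n - r)"
    unfolding s ut_def idx .
qed simp

lemma L5_term_sums: "L5_term q sums (\<Sum>r. 2 * q ^ (r\<^sup>2 + 2 * r + 1) * P5 (Suc r))"
proof -
  have beta: "q ^ r * (\<Sum>k\<le>r. q ^ (k\<^sup>2 + k + (r - k) * (r + k + 2) + ((r - k) choose 2)) * qf (Suc r + k) / (qf (r - k) * dk k))
     = q ^ (r\<^sup>2 + 2 * r) * P5 (Suc r)" for r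
    unfolding P5_def lessThan_Suc_atMost sum_distrib_left
  proof (rule sum.cong)
    fix k assume "k \<in> {..r}"
    then obtain j where r: "r = k + j" using le_Suc_ex by auto
    \<comment> \<open>The squares combine to r^2. The linear part is 2r + (r - k), and the excess r
      - k raises the binomial coefficient from r - k to r + 1 - k, as \<open>P5 (Suc r)\<close>
      requires.\<close>
    have "q ^ r * q ^ (k\<^sup>2 + k + (r - k) * (r + k + 2) + ((r - k) choose 2)) = q ^ (r\<^sup>2 + 2 * r) * q ^ (Suc r - k choose 2)"
      unfolding power_add[symmetric] by (rule arg_cong[where f = "power q"]) (simp add: r Suc_diff_le Suc_choose_two power2_eq_square algebra_simps)
    then have "q ^ r * q ^ (k\<^sup>2 + k + (r - k) * (r + k + 2) + ((r - k) choose 2)) * x = q ^ (r\<^sup>2 + 2 * r) * q ^ (Suc r - k choose 2) * x" for x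
      by simp
    then show "q ^ r * (q ^ (k\<^sup>2 + k + (r - k) * (r + k + 2) + ((r - k) choose 2)) * qf (Suc r + k) / (qf (r - k) * dk k))
      = q ^ (r\<^sup>2 + 2 * r) * (q ^ (Suc r - k choose 2) * qf (Suc r + k) / (qf (Suc r - Suc k) * dk k))"
      by (simp only: times_divide_eq_right mult.assoc[symmetric] diff_Suc_Suc)
  qed simp
  have "L5_term q (Suc n) = (\<Sum>r\<le>n. 2 * q ^ (r\<^sup>2 + 2 * r + 1) * P5 (Suc r) * ut r (n - r))" for n
  proof -
    have "L5_term q (Suc n) = 2 * q * ((- q) ^ n * qe n * (\<Sum>k\<le>n. (-1) ^ k * q ^ (k\<^sup>2 + k) / dk k / qf (n - k)))"
      by (simp only: L5_term_Suc mult.assoc)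
    also have "\<dots> = (\<Sum>r\<le>n. 2 * q * (q ^ (r\<^sup>2 + 2 * r) * P5 (Suc r) * ut r (n - r)))"
      unfolding bailey_ut beta by (rule sum_distrib_left)
    also have "\<dots> = (\<Sum>r\<le>n. 2 * q ^ (r\<^sup>2 + 2 * r + 1) * P5 (Suc r) * ut r (n - r))"
      by (simp add: mult_ac)
    finally show ?thesis .
  qed
  moreover have "summable (\<lambda>r. norm (2 * q ^ (r\<^sup>2 + 2 * r + 1) * P5 (Suc r)))"
  proof -
    have "summable (\<lambda>r. norm (q ^ (r\<^sup>2 + 2 * r + 1) * (2 * P5 (Suc r))))"
    proof (rule summable_power_le)
      show "norm (2 * P5 (Suc r)) \<le> 2 * real (Suc r)" for r
        using norm_P5_le[of "Suc r"] by (simp add: norm_mult del: of_nat_Suc)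
    qed simp
    then show ?thesis by (simp only: mult.assoc mult.left_commute[of 2])
  qed
  ultimately have "(\<lambda>n. L5_term q (Suc n)) sums (\<Sum>r. 2 * q ^ (r\<^sup>2 + 2 * r + 1) * P5 (Suc r))"
    using ut_triangle_sums[of "\<lambda>r. 2 * q ^ (r\<^sup>2 + 2 * r + 1) * P5 (Suc r)"] by simp
  moreover have "L5_term q 0 = 0" by (simp add: L5_term_def)
  ultimately show ?thesis by (simp only: sums_Suc_iff) simp
qed

lemma L6_term_sums: "L6_term q sums (\<Sum>r. 2 * q ^ (r\<^sup>2 + 3 * r + 2) * P6 (Suc r))"
proof -
  have beta: "q ^ r * (\<Sum>k\<le>r. q ^ (k\<^sup>2 + 2 * k + (r - k) * (r + k + 2) + ((r - k) choose 2)) * qf (Suc r + k) / (qf (r - k) * dk k))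
     = q ^ (r\<^sup>2 + 3 * r) * P6 (Suc r)" for r
    unfolding P6_def lessThan_Suc_atMost sum_distrib_left
  proof (rule sum.cong)
    fix k assume "k \<in> {..r}"
    then obtain j where r: "r = k + j" using le_Suc_ex by auto
    \<comment> \<open>Here the linear part is 3r, free of k, so the binomial coefficient stays that
      of r - k, as in \<open>P6 (Suc r)\<close>.\<close>
    have "q ^ r * q ^ (k\<^sup>2 + 2 * k + (r - k) * (r + k + 2) + ((r - k) choose 2)) = q ^ (r\<^sup>2 + 3 * r) * q ^ (Suc r - Suc k choose 2)"
      unfolding power_add[symmetric] by (rule arg_cong[where f = "power q"]) (simp add: r power2_eq_square algebra_simps)
    then have "q ^ r * q ^ (k\<^sup>2 + 2 * k + (r - k) * (r + k + 2) + ((r - k) choose 2)) * x = q ^ (r\<^sup>2 + 3 * r) * q ^ (Suc r - Suc k choose 2) * x" for x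
      by simp
    then show "q ^ r * (q ^ (k\<^sup>2 + 2 * k + (r - k) * (r + k + 2) + ((r - k) choose 2)) * qf (Suc r + k) / (qf (r - k) * dk k))
      = q ^ (r\<^sup>2 + 3 * r) * (q ^ (Suc r - Suc k choose 2) * qf (Suc r + k) / (qf (Suc r - Suc k) * dk k))"
      by (simp only: times_divide_eq_right mult.assoc[symmetric] diff_Suc_Suc)
  qed simp
  have "L6_term q (Suc n) = (\<Sum>r\<le>n. 2 * q ^ (r\<^sup>2 + 3 * r + 2) * P6 (Suc r) * ut r (n - r))" for n
  proof -
    have "L6_term q (Suc n) = 2 * q\<^sup>2 * ((- q) ^ n * qe n * (\<Sum>k\<le>n. (-1) ^ k * q ^ (k\<^sup>2 + 2 * k) / dk k / qf (n - k)))"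
      by (simp only: L6_term_Suc mult.assoc)
    also have "\<dots> = (\<Sum>r\<le>n. 2 * q\<^sup>2 * (q ^ (r\<^sup>2 + 3 * r) * P6 (Suc r) * ut r (n - r)))"
      unfolding bailey_ut beta by (rule sum_distrib_left)
    also have "\<dots> = (\<Sum>r\<le>n. 2 * q ^ (r\<^sup>2 + 3 * r + 2) * P6 (Suc r) * ut r (n - r))"
      by (simp add: mult_ac power2_eq_square)
    finally show ?thesis .
  qed
  moreover have "summable (\<lambda>r. norm (2 * q ^ (r\<^sup>2 + 3 * r + 2) * P6 (Suc r)))"
  proof -
    have "summable (\<lambda>r. norm (q ^ (r\<^sup>2 + 3 * r + 2) * (2 * P6 (Suc r))))"
    proof (rule summable_power_le)
      show "norm (2 * P6 (Suc r)) \<le> 2 * real (Suc r)" for r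
        using norm_P6_le[of "Suc r"] by (simp add: norm_mult del: of_nat_Suc)
    qed simp
    then show ?thesis by (simp only: mult.assoc mult.left_commute[of 2])
  qed
  ultimately have "(\<lambda>n. L6_term q (Suc n)) sums (\<Sum>r. 2 * q ^ (r\<^sup>2 + 3 * r + 2) * P6 (Suc r))"
    using ut_triangle_sums[of "\<lambda>r. 2 * q ^ (r\<^sup>2 + 3 * r + 2) * P6 (Suc r)"] by simp
  moreover have "L6_term q 0 = 0" by (simp add: L6_term_def)
  ultimately show ?thesis by (simp only: sums_Suc_iff) simp
qed

lemma L7_term_starsums: "starsums (L7_term q) ((\<Sum>r. q ^ (r\<^sup>2 + r) * (P5 (Suc r) + P5 r)) / 2)"
proof -
  have beta: "(1 - q ^ (2 * r + 1)) * (\<Sum>k\<le>r. q ^ (k\<^sup>2 + k + (r - k) * (r + k + 1) + ((r - k) choose 2)) * wt r k)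
     = q ^ (r\<^sup>2 + r) * (P5 (Suc r) + P5 r)" for r
  proof -
    have "(\<Sum>k\<le>r. q ^ (k\<^sup>2 + k + (r - k) * (r + k + 1) + ((r - k) choose 2)) * wt r k)
       = q ^ (r\<^sup>2 + r) * (\<Sum>k\<le>r. q ^ ((r - k) choose 2) * wt r k)"
      unfolding sum_distrib_left
    proof (rule sum.cong)
      fix k assume "k \<in> {..r}"
      then obtain j where r: "r = k + j" using le_Suc_ex by auto
      have "k\<^sup>2 + k + (r - k) * (r + k + 1) = r\<^sup>2 + r" by (simp add: r power2_eq_square algebra_simps)
      then show "q ^ (k\<^sup>2 + k + (r - k) * (r + k + 1) + ((r - k) choose 2)) * wt r k = q ^ (r\<^sup>2 + r) * (q ^ ((r - k) choose 2) * wt r k)"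
        by (simp only: power_add mult.assoc)
    qed simp
    then show ?thesis unfolding w7_eq[symmetric] by simp
  qed
  have "summable (\<lambda>r. norm (q ^ (r\<^sup>2 + r) * (P5 (Suc r) + P5 r)))"
  proof (rule summable_power_le)
    show "norm (P5 (Suc r) + P5 r) \<le> 2 * real (Suc r)" for r
      using norm_triangle_ineq[of "P5 (Suc r)" "P5 r"] norm_P5_le[of r] norm_P5_le[of "Suc r"] by simp
  qed simp
  from vt_triangle_starsums[OF this] show ?thesis
    by (simp only: L7_term_eq[abs_def] bailey_vt beta)
qed

lemma L8_term_starsums: "starsums (L8_term q) ((\<Sum>r. q ^ r\<^sup>2 * (P5 (Suc r) + q ^ (2 * r + 1) * P5 r)) / 2)"
proof -
  have beta: "(1 - q ^ (2 * r + 1)) * (\<Sum>k\<le>r. q ^ (k\<^sup>2 + (r - k) * (r + k + 1) + ((r - k) choose 2)) * wt r k)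
     = q ^ r\<^sup>2 * (P5 (Suc r) + q ^ (2 * r + 1) * P5 r)" for r
  proof -
    have "(\<Sum>k\<le>r. q ^ (k\<^sup>2 + (r - k) * (r + k + 1) + ((r - k) choose 2)) * wt r k)
       = q ^ r\<^sup>2 * (\<Sum>k\<le>r. q ^ (Suc (r - k) choose 2) * wt r k)"
      unfolding sum_distrib_left
    proof (rule sum.cong)
      fix k assume "k \<in> {..r}"
      then obtain j where r: "r = k + j" using le_Suc_ex by auto
      have "k\<^sup>2 + (r - k) * (r + k + 1) + ((r - k) choose 2) = r\<^sup>2 + (Suc (r - k) choose 2)"
        by (simp add: r power2_eq_square algebra_simps Suc_choose_two)
      then show "q ^ (k\<^sup>2 + (r - k) * (r + k + 1) + ((r - k) choose 2)) * wt r k = q ^ r\<^sup>2 * (q ^ (Suc (r - k) choose 2) * wt r k)"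
        by (simp only: power_add mult.assoc)
    qed simp
    then show ?thesis unfolding w8_eq[symmetric] by simp
  qed
  have "summable (\<lambda>r. norm (q ^ r\<^sup>2 * (P5 (Suc r) + q ^ (2 * r + 1) * P5 r)))"
  proof (rule summable_power_le)
    show "norm (P5 (Suc r) + q ^ (2 * r + 1) * P5 r) \<le> 2 * real (Suc r)" for r
    proof -
      have "norm (q ^ (2 * r + 1) * P5 r) \<le> 1 * real r"
        unfolding norm_mult norm_power using norm_q norm_P5_le by (intro mult_mono power_le_one) auto
      then show ?thesis
        using norm_triangle_ineq[of "P5 (Suc r)" "q ^ (2 * r + 1) * P5 r"] norm_P5_le[of "Suc r"] by simp
    qed
  qed (simp add: power2_eq_square)
  from vt_triangle_starsums[OF this] show ?thesis
    by (simp only: L8_term_eq[abs_def] bailey_vt beta)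
qed

end

section \<open>Ideals of \<open>\<int>[\<surd>3]\<close>\<close>

lemma OL_simps [simp]:
  "carrier OL = UNIV" "\<zero>\<^bsub>OL\<^esub> = (0, 0)" "\<one>\<^bsub>OL\<^esub> = (1, 0)"
  "(a, b) \<otimes>\<^bsub>OL\<^esub> (c, d) = (a * c + 3 * b * d, a * d + b * c)"
  "(a, b) \<oplus>\<^bsub>OL\<^esub> (c, d) = (a + c, b + d)"
  by (simp_all add: OL_def)

lemma cring_OL: "cring OL"
proof (rule cringI)
  show "abelian_group OL"
  proof (rule abelian_groupI)
    fix x assume "x \<in> carrier OL"
    show "\<exists>y\<in>carrier OL. y \<oplus>\<^bsub>OL\<^esub> x = \<zero>\<^bsub>OL\<^esub>"
      by (cases x, rule bexI[of _ "(- fst x, - snd x)"]) auto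
  qed auto
  show "comm_monoid OL"
    by (rule comm_monoidI) (auto simp: algebra_simps)
qed (auto simp: algebra_simps)

interpretation OL: cring OL by (rule cring_OL)

lemma elt_norm_pair: "elt_norm (a, b) = a\<^sup>2 - 3 * b\<^sup>2"
  by (simp add: elt_norm_def)

lemma elt_norm_mult: "elt_norm (x \<otimes>\<^bsub>OL\<^esub> y) = elt_norm x * elt_norm y"
  by (cases x; cases y) (simp add: elt_norm_def algebra_simps power2_eq_square)

text \<open>In a^2 = 3 b^2 with nonzero a and b, the multiplicity of 3 would be even on the left and
  odd on the right.\<close>

lemma elt_norm_eq_0_iff: "elt_norm x = 0 \<longleftrightarrow> x = (0, 0)"
proof (cases x)
  case (Pair a b)
  have "a = 0 \<and> b = 0" if eq: "a\<^sup>2 = 3 * b\<^sup>2"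
  proof (rule ccontr)
    assume "\<not> ?thesis"
    with eq have nz: "a \<noteq> 0" "b \<noteq> 0" by auto
    have p: "prime_elem (3 :: int)" by (simp add: prime_imp_prime_elem)
    have "multiplicity 3 (a\<^sup>2) = 2 * multiplicity 3 a"
      using p nz by (simp add: prime_elem_multiplicity_power_distrib)
    moreover have "multiplicity 3 (3 * b\<^sup>2) = 1 + 2 * multiplicity 3 b"
      using p nz by (simp add: prime_elem_multiplicity_mult_distrib prime_elem_multiplicity_power_distrib)
    ultimately have "2 * multiplicity 3 a = 1 + 2 * multiplicity (3 :: int) b" using eq by simp
    then show False by presburger
  qed
  then show ?thesis by (auto simp: Pair elt_norm_def)
qed

lemma mem_PIdl_iff: "(u, v) \<in> PIdl\<^bsub>OL\<^esub> (a, b) \<longleftrightarrow> (\<exists>m n. u = m * a + 3 * n * b \<and> v = m * b + n * a)"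
  by (auto simp: cgenideal_def)

lemma PIdl_subset: "y = x \<otimes>\<^bsub>OL\<^esub> z \<Longrightarrow> PIdl\<^bsub>OL\<^esub> y \<subseteq> PIdl\<^bsub>OL\<^esub> x"
proof -
  assume "y = x \<otimes>\<^bsub>OL\<^esub> z"
  then have "y = z \<otimes>\<^bsub>OL\<^esub> x" using OL.m_comm[of x z] by simp
  then have "y \<in> PIdl\<^bsub>OL\<^esub> x" unfolding cgenideal_def OL_simps(1) by blast
  then show ?thesis by (intro OL.cgenideal_minimal[OF OL.cgenideal_ideal]) simp_all
qed

lemma PIdl_mult_unit:
  assumes "u \<otimes>\<^bsub>OL\<^esub> w = \<one>\<^bsub>OL\<^esub>"
  shows "PIdl\<^bsub>OL\<^esub> (x \<otimes>\<^bsub>OL\<^esub> u) = PIdl\<^bsub>OL\<^esub> x"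
proof
  have "x = (x \<otimes>\<^bsub>OL\<^esub> u) \<otimes>\<^bsub>OL\<^esub> w" using assms OL.r_one[of x] by (simp add: OL.m_assoc del: OL_simps(2-))
  then show "PIdl\<^bsub>OL\<^esub> x \<subseteq> PIdl\<^bsub>OL\<^esub> (x \<otimes>\<^bsub>OL\<^esub> u)" by (rule PIdl_subset)
qed (rule PIdl_subset[OF refl])

lemma PIdl_eqD:
  assumes "PIdl\<^bsub>OL\<^esub> x = PIdl\<^bsub>OL\<^esub> y"
  shows "\<exists>u. y = x \<otimes>\<^bsub>OL\<^esub> u"
proof -
  have "y \<in> PIdl\<^bsub>OL\<^esub> x" using OL.cgenideal_self[of y] assms by simp
  then obtain u where "y = u \<otimes>\<^bsub>OL\<^esub> x" unfolding cgenideal_def by blast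
  then show ?thesis using OL.m_comm[of u x] by (intro exI[of _ u]) simp
qed

section \<open>Division with remainder and principal ideals\<close>

lemma exists_near_multiple: "n \<noteq> 0 \<Longrightarrow> \<exists>m. 2 * \<bar>p - m * n\<bar> \<le> \<bar>n\<bar>" for n p :: int
proof -
  assume n: "n \<noteq> 0"
  define k where "k = \<bar>n\<bar>"
  have k: "k > 0" using n by (simp add: k_def)
  have "\<exists>m. 2 * \<bar>p - m * k\<bar> \<le> k"
  proof (cases "2 * (p mod k) \<le> k")
    case True
    moreover have "p - (p div k) * k = p mod k" by (simp add: minus_div_mult_eq_mod)
    ultimately show ?thesis using k pos_mod_sign[of k p] by (intro exI[of _ "p div k"]) auto
  next
    case False
    define z where "z = p mod k"
    have "2 * \<bar>z - k\<bar> \<le> k" using pos_mod_bound[OF k, of p] False by (simp add: z_def[symmetric])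
    moreover have "p - (p div k + 1) * k = z - k" unfolding z_def by (simp add: algebra_simps minus_div_mult_eq_mod[symmetric])
    ultimately show ?thesis by metis
  qed
  then obtain m where m: "2 * \<bar>p - m * k\<bar> \<le> k" by blast
  have "m * k = (m * sgn n) * n" by (simp add: k_def abs_sgn mult_ac)
  with m show ?thesis unfolding k_def by metis
qed

text \<open>Both coordinates of y/x = ((ca - 3db) + (da - cb) sqrt 3) / n are rounded to a nearest
  integer. The errors e/n and f/n are at most 1/2 in size, so the error has norm between -3/4 and
  1/4.\<close>

lemma euclidean_division:
  assumes "x \<noteq> (0, 0)"
  shows "\<exists>z r. y = x \<otimes>\<^bsub>OL\<^esub> z \<oplus>\<^bsub>OL\<^esub> r \<and> \<bar>elt_norm r\<bar> < \<bar>elt_norm x\<bar>"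
proof -
  obtain a b where x: "x = (a, b)" by fastforce
  obtain c d where y: "y = (c, d)" by fastforce
  define n where "n = a\<^sup>2 - 3 * b\<^sup>2"
  have n: "n \<noteq> 0" using assms elt_norm_eq_0_iff[of x] by (simp add: x n_def elt_norm_pair)
  obtain m where m: "2 * \<bar>(c * a - 3 * d * b) - m * n\<bar> \<le> \<bar>n\<bar>" using exists_near_multiple[OF n] by blast
  obtain k where k: "2 * \<bar>(d * a - c * b) - k * n\<bar> \<le> \<bar>n\<bar>" using exists_near_multiple[OF n] by blast
  define e where "e = (c * a - 3 * d * b) - m * n"
  define f where "f = (d * a - c * b) - k * n"
  define r where "r = (c - (a * m + 3 * b * k), d - (a * k + b * m))"
  have rn: "elt_norm r * n = e\<^sup>2 - 3 * f\<^sup>2"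
    unfolding r_def elt_norm_pair e_def f_def n_def by (simp add: algebra_simps power2_eq_square)
  have sq: "4 * x\<^sup>2 \<le> n\<^sup>2" if "2 * \<bar>x\<bar> \<le> \<bar>n\<bar>" for x
  proof -
    have "\<bar>2 * x\<bar> \<le> \<bar>n\<bar>" using that by (simp add: abs_mult)
    then have "(2 * x)\<^sup>2 \<le> n\<^sup>2" by (simp only: abs_le_square_iff)
    then show ?thesis by (simp add: power_mult_distrib)
  qed
  have "4 * e\<^sup>2 \<le> n\<^sup>2" "4 * f\<^sup>2 \<le> n\<^sup>2"
    using sq m k unfolding e_def f_def by blast+
  then have "\<bar>e\<^sup>2 - 3 * f\<^sup>2\<bar> < n\<^sup>2" using n zero_le_power2[of e] zero_le_power2[of f] zero_less_power2[of n] by linarith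
  then have "\<bar>elt_norm r\<bar> * \<bar>n\<bar> < \<bar>n\<bar> * \<bar>n\<bar>" by (simp only: abs_mult[symmetric] rn power2_eq_square[symmetric] power2_abs)
  then have "\<bar>elt_norm r\<bar> < \<bar>n\<bar>" by (rule mult_right_less_imp_less) simp
  then show ?thesis
    by (intro exI[of _ "(m, k)"] exI[of _ r]) (simp add: x y r_def elt_norm_pair n_def)
qed

lemma nz_ideal_principal:
  assumes "I \<in> nz_ideals"
  shows "\<exists>x. x \<noteq> (0, 0) \<and> I = PIdl\<^bsub>OL\<^esub> x"
proof -
  interpret ideal I OL using assms by (simp add: nz_ideals_def)
  have "(0, 0) \<in> I" using zero_closed by simp
  then obtain x0 where "x0 \<in> I" "x0 \<noteq> (0, 0)" using assms by (auto simp: nz_ideals_def)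
  then obtain x where x: "x \<in> I" "x \<noteq> (0, 0)"
    and min: "\<And>y. y \<in> I \<Longrightarrow> y \<noteq> (0, 0) \<Longrightarrow> nat \<bar>elt_norm x\<bar> \<le> nat \<bar>elt_norm y\<bar>"
    using arg_min_nat_lemma[of "\<lambda>x. x \<in> I \<and> x \<noteq> (0, 0)" x0 "\<lambda>x. nat \<bar>elt_norm x\<bar>"] by blast
  have "I \<subseteq> PIdl\<^bsub>OL\<^esub> x"
  proof
    fix y assume y: "y \<in> I"
    obtain z r where zr: "y = x \<otimes>\<^bsub>OL\<^esub> z \<oplus>\<^bsub>OL\<^esub> r" "\<bar>elt_norm r\<bar> < \<bar>elt_norm x\<bar>"
      using euclidean_division[OF x(2)] by blast
    have "r = y \<oplus>\<^bsub>OL\<^esub> (x \<otimes>\<^bsub>OL\<^esub> (- fst z, - snd z))"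
      unfolding zr(1) by (cases x; cases z; cases r) simp
    then have "r \<in> I" using y x(1) by (simp add: I_r_closed a_closed)
    then have "r = (0, 0)" using min[of r] zr(2) by force
    then have "y = z \<otimes>\<^bsub>OL\<^esub> x" using zr(1) by (cases x; cases z) (simp add: algebra_simps)
    then show "y \<in> PIdl\<^bsub>OL\<^esub> x" unfolding cgenideal_def OL_simps(1) by blast
  qed
  moreover have "PIdl\<^bsub>OL\<^esub> x \<subseteq> I" by (rule OL.cgenideal_minimal[OF is_ideal x(1)])
  ultimately show ?thesis using x by blast
qed

lemma PIdl_nz_ideals: "x \<noteq> (0, 0) \<Longrightarrow> PIdl\<^bsub>OL\<^esub> x \<in> nz_ideals"
  using OL.cgenideal_self[of x] OL.cgenideal_ideal[of x] by (auto simp: nz_ideals_def)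

text \<open>Hermite normal form of the lattice spanned by \<open>(a, b)\<close> and \<open>(3b, a)\<close>.\<close>

lemma PIdl_hermite:
  assumes "(a, b) \<noteq> (0, 0)"
  obtains g h s where "g > 0" "h > 0" "g * h = \<bar>elt_norm (a, b)\<bar>"
    "\<And>u v. (u, v) \<in> PIdl\<^bsub>OL\<^esub> (a, b) \<longleftrightarrow> g dvd v \<and> h dvd u - s * (v div g)"
proof -
  define g where "g = gcd a b"
  have g: "g > 0" using assms by (auto simp: g_def)
  obtain a' where a: "a = g * a'" using dvdE[of g a] by (auto simp: g_def)
  obtain b' where b: "b = g * b'" using dvdE[of g b] by (auto simp: g_def)
  obtain n m where "n * a + m * b = g" using bezout_int[of a b] by (auto simp: g_def)
  then have "g * (n * a' + m * b') = g * 1" by (simp add: a b algebra_simps)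
  then have bez: "n * a' + m * b' = 1" using g by (simp only: mult_left_cancel)
  define t where "t = a'\<^sup>2 - 3 * b'\<^sup>2"
  define h where "h = g * \<bar>t\<bar>"
  \<comment> \<open>By the Bezout relation, m (a, b) + n (3b, a) = (s, g), a lattice vector with the
    least positive second coordinate.\<close>
  define s where "s = m * a + 3 * n * b"
  have N: "elt_norm (a, b) = g * (g * t)" by (simp add: elt_norm_pair a b t_def power2_eq_square algebra_simps)
  have "t \<noteq> 0" using N elt_norm_eq_0_iff[of "(a, b)"] assms by auto
  then have h: "h > 0" using g by (simp add: h_def)
  have "h = \<bar>g * t\<bar>" using g by (simp add: h_def abs_mult)
  then have hd: "h dvd x \<longleftrightarrow> g * t dvd x" for x by (simp only: abs_dvd_iff)
  have iff: "(u, v) \<in> PIdl\<^bsub>OL\<^esub> (a, b) \<longleftrightarrow> g dvd v \<and> h dvd u - s * (v div g)" for u v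
  proof
    assume "(u, v) \<in> PIdl\<^bsub>OL\<^esub> (a, b)"
    then obtain M R where MR: "u = M * a + 3 * R * b" "v = M * b + R * a" by (auto simp: mem_PIdl_iff)
    have v: "v = g * (M * b' + R * a')" by (simp add: MR a b algebra_simps)
    then have vg: "v div g = M * b' + R * a'" using g by simp
    have "u - s * (M * b' + R * a') = (n * a' + m * b') * u - s * (M * b' + R * a')" by (simp add: bez)
    also have "\<dots> = (M * n - m * R) * (g * t)"
      unfolding MR s_def a b t_def by (simp add: algebra_simps power2_eq_square)
    finally show "g dvd v \<and> h dvd u - s * (v div g)" unfolding vg hd by (simp add: v)
  next
    assume *: "g dvd v \<and> h dvd u - s * (v div g)"
    then obtain w where w: "v = g * w" by blast
    with * g obtain k where k: "u - s * w = g * t * k" unfolding hd by (auto simp: dvd_def)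
    \<comment> \<open>This is w copies of (s, g) plus k copies of (g t, 0) = a' (a, b) - b' (3b,
      a).\<close>
    have "u = (m * w + a' * k) * a + 3 * (n * w - b' * k) * b"
      using k by (simp add: s_def a b t_def algebra_simps power2_eq_square)
    moreover have "v = (m * w + a' * k) * b + (n * w - b' * k) * a"
    proof -
      have "(m * w + a' * k) * b + (n * w - b' * k) * a = g * w * (n * a' + m * b')" by (simp add: a b algebra_simps)
      then show ?thesis by (simp add: w bez)
    qed
    ultimately show "(u, v) \<in> PIdl\<^bsub>OL\<^esub> (a, b)" unfolding mem_PIdl_iff by blast
  qed
  have "g * h = \<bar>elt_norm (a, b)\<bar>" using g by (simp add: N h_def abs_mult)
  from that[OF g h this iff] show ?thesis .
qed

text \<open>In the Hermite form the ideal has the basis (s, g), (h, 0), so every coset has exactly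
  one representative in an h by g box.\<close>

lemma ideal_norm_PIdl:
  assumes "x \<noteq> (0, 0)"
  shows "ideal_norm (PIdl\<^bsub>OL\<^esub> x) = nat \<bar>elt_norm x\<bar>"
proof -
  obtain a b where x: "x = (a, b)" by fastforce
  define I where "I = PIdl\<^bsub>OL\<^esub> x"
  interpret ideal I OL unfolding I_def by (rule OL.cgenideal_ideal) simp
  obtain g h s where gh: "g > 0" "h > 0" "g * h = \<bar>elt_norm x\<bar>"
    and mem: "\<And>u v. (u, v) \<in> I \<longleftrightarrow> g dvd v \<and> h dvd u - s * (v div g)"
    using PIdl_hermite[of a b] assms unfolding x I_def by metis
  have eqI: "I +>\<^bsub>OL\<^esub> (u, v) = I +>\<^bsub>OL\<^esub> (u', v') \<longleftrightarrow> (u - u', v - v') \<in> I" for u v u' v'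
  proof
    assume "I +>\<^bsub>OL\<^esub> (u, v) = I +>\<^bsub>OL\<^esub> (u', v')"
    moreover have "(u, v) \<in> I +>\<^bsub>OL\<^esub> (u, v)" using a_rcos_self[of "(u, v)"] by simp
    ultimately have "(u, v) \<in> I +>\<^bsub>OL\<^esub> (u', v')" by simp
    then show "(u - u', v - v') \<in> I" by (auto simp: a_r_coset_def')
  next
    assume "(u - u', v - v') \<in> I"
    then have "(u, v) \<in> I +>\<^bsub>OL\<^esub> (u', v')" by (force simp: a_r_coset_def')
    then show "I +>\<^bsub>OL\<^esub> (u, v) = I +>\<^bsub>OL\<^esub> (u', v')" using a_repr_independence'[of "(u, v)" "(u', v')"] by simp
  qed
  define R where "R = {0..<h} \<times> {0..<g}"
  have "carrier (OL Quot I) = (\<lambda>z. I +>\<^bsub>OL\<^esub> z) ` R"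
  proof
    show "carrier (OL Quot I) \<subseteq> (\<lambda>z. I +>\<^bsub>OL\<^esub> z) ` R"
    proof
      fix C assume "C \<in> carrier (OL Quot I)"
      then obtain u v where C: "C = I +>\<^bsub>OL\<^esub> (u, v)" by (auto simp: FactRing_def A_RCOSETS_def')
      \<comment> \<open>Reducing v modulo g subtracts \<open>v div g\<close> copies of (s, g). This
        lowers u by \<open>s * (v div g)\<close> before u is reduced modulo h.\<close>
      define u0 where "u0 = (u - s * (v div g)) mod h"
      have "g dvd v - v mod g" "(v - v mod g) div g = v div g" using gh by (simp_all add: minus_mod_eq_mult_div)
      moreover have "h dvd u - u0 - s * (v div g)"
      proof -
        have "u - u0 - s * (v div g) = (u - s * (v div g)) - (u - s * (v div g)) mod h"
          by (simp add: u0_def)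
        then show ?thesis by (simp only: dvd_minus_mod)
      qed
      ultimately have "(u - u0, v - v mod g) \<in> I" by (simp add: mem)
      then have "C = I +>\<^bsub>OL\<^esub> (u0, v mod g)" by (simp add: C eqI)
      moreover have "(u0, v mod g) \<in> R" using gh by (simp add: R_def u0_def)
      ultimately show "C \<in> (\<lambda>z. I +>\<^bsub>OL\<^esub> z) ` R" by blast
    qed
  qed (auto simp: FactRing_def A_RCOSETS_def')
  moreover have "inj_on (\<lambda>z. I +>\<^bsub>OL\<^esub> z) R"
  proof (rule inj_onI, clarsimp simp: R_def eqI mem)
    fix u v u' v' :: int
    assume b: "0 \<le> u" "u < h" "0 \<le> v" "v < g" "0 \<le> u'" "u' < h" "0 \<le> v'" "v' < g"
      and d: "g dvd v - v'" "h dvd u - u' - s * ((v - v') div g)"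
    have "v = v'" using b d(1) by (metis mod_eq_dvd_iff mod_pos_pos_trivial)
    moreover from this have "u = u'" using b d(2) by (simp) (metis mod_eq_dvd_iff mod_pos_pos_trivial)
    ultimately show "u = u' \<and> v = v'" by simp
  qed
  ultimately have "ideal_norm I = card R" by (simp add: ideal_norm_def card_image)
  also have "\<dots> = nat (g * h)" using gh(1,2) by (simp add: R_def nat_mult_distrib)
  finally show ?thesis using gh(3) by (simp add: I_def)
qed

text \<open>A fundamental domain for the action of the units \<open>\<plusminus>(2 + \<surd>3)\<^sup>n\<close> on the elements of negative norm:
  \<open>2 + \<surd>3\<close> sends the ray \<open>a = -b\<close> to the ray \<open>a = b\<close>.\<close>

definition neg_dom :: "(int \<times> int) set" where
  "neg_dom = {(a, b). b > 0 \<and> - b < a \<and> a \<le> b}"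

text \<open>A unit e + f sqrt 3 of norm 1 with e > 0 and f nonzero has e <= 2|f|, so it moves a ray
  at least as far as 2 + sqrt 3 or its inverse does, that is, by the whole width of the domain. The
  half-open boundary excludes the case of equality.\<close>

lemma neg_dom_unique:
  assumes "x \<in> neg_dom" "x \<otimes>\<^bsub>OL\<^esub> u \<in> neg_dom" "elt_norm u = 1"
  shows "x \<otimes>\<^bsub>OL\<^esub> u = x"
proof -
  obtain a b where x: "x = (a, b)" by fastforce
  obtain e f where u: "u = (e, f)" by fastforce
  have n: "e\<^sup>2 = 1 + 3 * f\<^sup>2" using assms(3) by (simp add: u elt_norm_pair)
  have ab: "b > 0" "- b < a" "a \<le> b" using assms(1) by (auto simp: x neg_dom_def)
  have cd: "a * f + b * e > 0" "- (a * f + b * e) < a * e + 3 * b * f" "a * e + 3 * b * f \<le> a * f + b * e"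
    using assms(2) by (auto simp: x u neg_dom_def)
  have ef: "\<bar>f\<bar> < \<bar>e\<bar>"
    by (rule power2_less_imp_less) (use n in \<open>auto simp: intro: add_pos_nonneg\<close>)
  have e_pos: "e > 0"
  proof (rule ccontr)
    assume "\<not> e > 0"
    then have e: "\<bar>f\<bar> < - e" using ef by simp
    have "a * f \<le> \<bar>a\<bar> * \<bar>f\<bar>" by (metis abs_ge_self abs_mult)
    also have "\<dots> \<le> b * \<bar>f\<bar>" using ab by (intro mult_right_mono) auto
    also have "\<dots> < b * (- e)" using ab e by (intro mult_strict_left_mono) auto
    finally show False using cd by simp
  qed
  have f0: "f = 0"
  proof (rule ccontr)
    assume "f \<noteq> 0"
    then have "f\<^sup>2 \<ge> 1" using zero_less_power2[of f] by linarith
    then have "e\<^sup>2 \<le> (2 * \<bar>f\<bar>)\<^sup>2" using n by (simp add: power_mult_distrib)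
    then have e2: "e \<le> 2 * \<bar>f\<bar>" using e_pos by (metis abs_ge_zero mult_nonneg_nonneg power2_le_imp_le zero_le_numeral)
    show False
    proof (cases "f > 0")
      case True
      have "- b * (e - f) < a * (e - f)" using ab ef e_pos by (intro mult_strict_right_mono) auto
      moreover have "b * (2 * (2 * f - e)) \<ge> 0" using ab e2 True by simp
      ultimately show False using cd(3) by (simp add: algebra_simps)
    next
      case False
      have "a * (e + f) \<le> b * (e + f)" using ab ef e_pos by (intro mult_right_mono) auto
      moreover have "b * (2 * (- 2 * f - e)) \<ge> 0" using ab e2 False by simp
      ultimately show False using cd(2) by (simp add: algebra_simps)
    qed
  qed
  then have "e = 1" using n e_pos by (simp add: power2_eq_1_iff)
  with f0 show ?thesis by (simp add: x u)
qed

text \<open>Descent on |b|. Negative norm gives |a| < 2|b|; as long as |a| > |b|, the factor 2 -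
  sqrt 3 or 2 + sqrt 3, chosen by the sign of ab, replaces b by 2b - a or 2b + a, which is smaller
  in size. Once |a| <= |b|, a sign makes b positive and the excluded ray a = -b is moved to a =
  b.\<close>

lemma neg_dom_exists:
  assumes "elt_norm x < 0"
  shows "\<exists>u w. u \<otimes>\<^bsub>OL\<^esub> w = \<one>\<^bsub>OL\<^esub> \<and> x \<otimes>\<^bsub>OL\<^esub> u \<in> neg_dom"
  using assms
proof (induction "nat \<bar>snd x\<bar>" arbitrary: x rule: less_induct)
  case less
  have step: ?case if "v \<otimes>\<^bsub>OL\<^esub> v' = \<one>\<^bsub>OL\<^esub>" "elt_norm v = 1" "\<bar>snd (x \<otimes>\<^bsub>OL\<^esub> v)\<bar> < \<bar>snd x\<bar>" for v v'
  proof -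
    have "elt_norm (x \<otimes>\<^bsub>OL\<^esub> v) < 0" using less.prems that by (simp add: elt_norm_mult)
    moreover have "nat \<bar>snd (x \<otimes>\<^bsub>OL\<^esub> v)\<bar> < nat \<bar>snd x\<bar>" using that by simp
    ultimately obtain u w where uw: "u \<otimes>\<^bsub>OL\<^esub> w = \<one>\<^bsub>OL\<^esub>" "(x \<otimes>\<^bsub>OL\<^esub> v) \<otimes>\<^bsub>OL\<^esub> u \<in> neg_dom"
      using less.hyps by blast
    have "(v \<otimes>\<^bsub>OL\<^esub> u) \<otimes>\<^bsub>OL\<^esub> (v' \<otimes>\<^bsub>OL\<^esub> w) = (v \<otimes>\<^bsub>OL\<^esub> v') \<otimes>\<^bsub>OL\<^esub> (u \<otimes>\<^bsub>OL\<^esub> w)"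
      by (simp add: OL.m_ac del: OL_simps(2-))
    also have "\<dots> = \<one>\<^bsub>OL\<^esub>" unfolding that(1) uw(1) by simp
    finally have "(v \<otimes>\<^bsub>OL\<^esub> u) \<otimes>\<^bsub>OL\<^esub> (v' \<otimes>\<^bsub>OL\<^esub> w) = \<one>\<^bsub>OL\<^esub>" .
    moreover have "x \<otimes>\<^bsub>OL\<^esub> (v \<otimes>\<^bsub>OL\<^esub> u) \<in> neg_dom" using uw(2) by (simp add: OL.m_assoc del: OL_simps(2-))
    ultimately show ?thesis by blast
  qed
  obtain a b where x: "x = (a, b)" by fastforce
  have n: "a\<^sup>2 < 3 * b\<^sup>2" using less.prems by (simp add: x elt_norm_pair)
  have ab: "\<bar>a\<bar> < 2 * \<bar>b\<bar>"
  proof (rule power2_less_imp_less)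
    have "a\<^sup>2 < 4 * b\<^sup>2" using n zero_le_power2[of b] by linarith
    then show "\<bar>a\<bar>\<^sup>2 < (2 * \<bar>b\<bar>)\<^sup>2" by (simp add: power_mult_distrib)
  qed simp
  consider "\<bar>b\<bar> < \<bar>a\<bar>" "a * b > 0" | "\<bar>b\<bar> < \<bar>a\<bar>" "a * b < 0" | "\<bar>a\<bar> \<le> \<bar>b\<bar>"
  proof -
    have "a * b \<noteq> 0 \<or> \<bar>a\<bar> \<le> \<bar>b\<bar>" using ab by auto
    then show thesis using that by (meson linorder_neqE_linordered_idom not_le)
  qed
  then show ?case
  proof cases
    case 1
    then have "\<bar>2 * b - a\<bar> < \<bar>b\<bar>" using ab by (auto simp: zero_less_mult_iff)
    then show ?thesis using step[of "(2, -1)" "(2, 1)"] by (simp add: x elt_norm_pair algebra_simps)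
  next
    case 2
    then have "\<bar>2 * b + a\<bar> < \<bar>b\<bar>" using ab by (auto simp: mult_less_0_iff)
    then show ?thesis using step[of "(2, 1)" "(2, -1)"] by (simp add: x elt_norm_pair algebra_simps)
  next
    case 3
    then have "b \<noteq> 0" using ab by auto
    then consider "b > 0" "a \<noteq> - b" | "b < 0" "a \<noteq> - b" | "b > 0" "a = - b" | "b < 0" "a = - b" by linarith
    then show ?thesis
    proof cases
      case 1
      then show ?thesis using 3 by (intro exI[of _ "(1, 0)"]) (auto simp: x neg_dom_def)
    next
      case 2
      then show ?thesis using 3
        by (intro exI[of _ "(-1, 0)"] exI[of _ "(-1, 0)"]) (auto simp: x neg_dom_def)
    next
      case 3
      then show ?thesis
        by (intro exI[of _ "(2, 1)"] exI[of _ "(2, -1)"]) (auto simp: x neg_dom_def)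
    next
      case 4
      then show ?thesis
        by (intro exI[of _ "(-2, -1)"] exI[of _ "(-2, 1)"]) (auto simp: x neg_dom_def)
    qed
  qed
qed

section \<open>Ideals parametrised by the two domains\<close>

lemma associated_norm:
  assumes "PIdl\<^bsub>OL\<^esub> x = PIdl\<^bsub>OL\<^esub> y" "elt_norm x * elt_norm y > 0"
  shows "\<exists>u. y = x \<otimes>\<^bsub>OL\<^esub> u \<and> elt_norm u = 1"
proof -
  obtain u where u: "y = x \<otimes>\<^bsub>OL\<^esub> u" using PIdl_eqD[OF assms(1)] by blast
  obtain w where w: "x = y \<otimes>\<^bsub>OL\<^esub> w" using PIdl_eqD[OF assms(1)[symmetric]] by blast
  have nu: "elt_norm y = elt_norm x * elt_norm u" unfolding u by (rule elt_norm_mult)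
  have "elt_norm x = elt_norm y * elt_norm w" by (subst w) (rule elt_norm_mult)
  then have "elt_norm x * (elt_norm u * elt_norm w) = elt_norm x * 1" using nu by (simp add: mult.assoc)
  then have "elt_norm u * elt_norm w = 1" using assms(2) mult_left_cancel by force
  then have "elt_norm u = 1 \<or> elt_norm u = - 1" using zmult_eq_1_iff by auto
  moreover have "elt_norm u \<noteq> - 1"
  proof
    assume "elt_norm u = - 1"
    then have "elt_norm x * elt_norm y = - (elt_norm x)\<^sup>2" using nu by (simp add: power2_eq_square)
    then show False using assms(2) by simp
  qed
  ultimately show ?thesis using u by blast
qed

lemma neg_dom_norm: "x \<in> neg_dom \<Longrightarrow> elt_norm x < 0"
proof -
  assume "x \<in> neg_dom"
  then obtain a b where x: "x = (a, b)" "b > 0" "\<bar>a\<bar> \<le> b" by (auto simp: neg_dom_def)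
  then have "a\<^sup>2 \<le> b\<^sup>2" using abs_le_square_iff[of a b] by simp
  then have "a\<^sup>2 < 3 * b\<^sup>2" using zero_less_power[OF x(2), of 2] by linarith
  then show ?thesis by (simp add: x elt_norm_pair)
qed

lemma inj_on_PIdl_neg_dom: "inj_on (\<lambda>x. PIdl\<^bsub>OL\<^esub> x) neg_dom"
proof (rule inj_onI)
  fix x y assume xy: "x \<in> neg_dom" "y \<in> neg_dom" and eq: "PIdl\<^bsub>OL\<^esub> x = PIdl\<^bsub>OL\<^esub> y"
  have "elt_norm x * elt_norm y > 0" using neg_dom_norm xy by (simp add: mult_neg_neg)
  from associated_norm[OF eq this] show "x = y" using neg_dom_unique xy by metis
qed

text \<open>Multiplication by \<open>\<surd>3\<close> changes the sign of the norm and carries this domain to \<open>neg_dom\<close>.\<close>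

definition pos_dom :: "(int \<times> int) set" where
  "pos_dom = {(a, b). a > 0 \<and> - a < 3 * b \<and> 3 * b \<le> a}"

lemma mult_sqrt3_neg_dom: "x \<otimes>\<^bsub>OL\<^esub> (0, 1) \<in> neg_dom \<longleftrightarrow> x \<in> pos_dom"
  by (cases x) (auto simp: neg_dom_def pos_dom_def)

lemma pos_dom_norm: "x \<in> pos_dom \<Longrightarrow> elt_norm x > 0"
  using neg_dom_norm[of "x \<otimes>\<^bsub>OL\<^esub> (0, 1)"] by (simp add: mult_sqrt3_neg_dom elt_norm_mult) (simp add: elt_norm_pair)

lemma inj_on_PIdl_pos_dom: "inj_on (\<lambda>x. PIdl\<^bsub>OL\<^esub> x) pos_dom"
proof (rule inj_onI)
  fix x y assume xy: "x \<in> pos_dom" "y \<in> pos_dom" and eq: "PIdl\<^bsub>OL\<^esub> x = PIdl\<^bsub>OL\<^esub> y"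
  have "elt_norm x * elt_norm y > 0" using pos_dom_norm xy by simp
  from associated_norm[OF eq this] obtain u where u: "y = x \<otimes>\<^bsub>OL\<^esub> u" "elt_norm u = 1" by blast
  have yx: "y \<otimes>\<^bsub>OL\<^esub> (0, 1) = (x \<otimes>\<^bsub>OL\<^esub> (0, 1)) \<otimes>\<^bsub>OL\<^esub> u"
    unfolding u(1) by (cases x; cases u) (simp add: algebra_simps)
  then have "y \<otimes>\<^bsub>OL\<^esub> (0, 1) = x \<otimes>\<^bsub>OL\<^esub> (0, 1)"
    using neg_dom_unique[of "x \<otimes>\<^bsub>OL\<^esub> (0, 1)" u] u(2) xy mult_sqrt3_neg_dom by metis
  then show "x = y" by (cases x; cases y) auto
qed

lemma dom_neq_zero: "x \<in> neg_dom \<or> x \<in> pos_dom \<Longrightarrow> x \<noteq> (0, 0)"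
  by (auto simp: neg_dom_def pos_dom_def)

lemma neg_principal_ideals:
  "{I \<in> nz_ideals. P (ideal_norm I) \<and> neg_principal I} =
     (\<lambda>x. PIdl\<^bsub>OL\<^esub> x) ` {x \<in> neg_dom. P (nat \<bar>elt_norm x\<bar>)}"
proof (intro equalityI subsetI)
  fix I assume I: "I \<in> {I \<in> nz_ideals. P (ideal_norm I) \<and> neg_principal I}"
  then obtain x where x: "I = PIdl\<^bsub>OL\<^esub> x" "elt_norm x < 0" by (auto simp: neg_principal_def)
  obtain u w where uw: "u \<otimes>\<^bsub>OL\<^esub> w = \<one>\<^bsub>OL\<^esub>" "x \<otimes>\<^bsub>OL\<^esub> u \<in> neg_dom" using neg_dom_exists[OF x(2)] by blast
  have "I = PIdl\<^bsub>OL\<^esub> (x \<otimes>\<^bsub>OL\<^esub> u)" using PIdl_mult_unit[OF uw(1)] x by simp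
  moreover from this have "P (nat \<bar>elt_norm (x \<otimes>\<^bsub>OL\<^esub> u)\<bar>)"
    using I ideal_norm_PIdl[of "x \<otimes>\<^bsub>OL\<^esub> u"] dom_neq_zero uw(2) by auto
  ultimately show "I \<in> (\<lambda>x. PIdl\<^bsub>OL\<^esub> x) ` {x \<in> neg_dom. P (nat \<bar>elt_norm x\<bar>)}" using uw(2) by blast
next
  fix I assume "I \<in> (\<lambda>x. PIdl\<^bsub>OL\<^esub> x) ` {x \<in> neg_dom. P (nat \<bar>elt_norm x\<bar>)}"
  then obtain x where x: "I = PIdl\<^bsub>OL\<^esub> x" "x \<in> neg_dom" "P (nat \<bar>elt_norm x\<bar>)" by blast
  have "neg_principal I" unfolding neg_principal_def using x neg_dom_norm by (intro bexI[of _ x]) simp_all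
  then show "I \<in> {I \<in> nz_ideals. P (ideal_norm I) \<and> neg_principal I}"
    using x dom_neq_zero[of x] ideal_norm_PIdl[of x] PIdl_nz_ideals[of x] by simp
qed

lemma square_mod_3: "(a :: int)\<^sup>2 mod 3 = (if a mod 3 = 0 then 0 else 1)"
proof -
  have "a\<^sup>2 mod 3 = (a mod 3)\<^sup>2 mod 3" by (simp add: power_mod)
  moreover have "a mod 3 = 0 \<or> a mod 3 = 1 \<or> a mod 3 = 2" by presburger
  ultimately show ?thesis by auto
qed

text \<open>A generator of negative norm would give N = 3b^2 - a^2, which is 0 or 2 modulo 3. A
  generator of positive norm is multiplied by sqrt 3, reduced with \<open>neg_dom_exists\<close>,
  and carried back by \<open>mult_sqrt3_neg_dom\<close>.\<close>

lemma ideals_norm_1_mod_3: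
  assumes "\<And>n. P n \<Longrightarrow> n mod 3 = 1"
  shows "{I \<in> nz_ideals. P (ideal_norm I)} =
     (\<lambda>x. PIdl\<^bsub>OL\<^esub> x) ` {x \<in> pos_dom. P (nat \<bar>elt_norm x\<bar>)}"
proof (intro equalityI subsetI)
  fix I assume I: "I \<in> {I \<in> nz_ideals. P (ideal_norm I)}"
  then obtain x where x: "I = PIdl\<^bsub>OL\<^esub> x" "x \<noteq> (0, 0)" using nz_ideal_principal by blast
  obtain a b where ab: "x = (a, b)" by fastforce
  have "int (nat \<bar>elt_norm x\<bar>) mod 3 = 1"
    using assms[of "ideal_norm I"] I x ideal_norm_PIdl[OF x(2)] by (metis (mono_tags, lifting) mem_Collect_eq of_nat_1 of_nat_mod of_nat_numeral)
  then have m: "\<bar>elt_norm x\<bar> mod 3 = 1" by simp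
  have "elt_norm x > 0"
  proof (rule ccontr)
    assume "\<not> elt_norm x > 0"
    then have "\<bar>elt_norm x\<bar> = 3 * b\<^sup>2 - a\<^sup>2" by (simp add: ab elt_norm_pair)
    then have "(3 * b\<^sup>2 - a\<^sup>2) mod 3 = 1" using m by simp
    then show False using square_mod_3[of a] by presburger
  qed
  then have "elt_norm (x \<otimes>\<^bsub>OL\<^esub> (0, 1)) < 0" by (simp add: elt_norm_mult) (simp add: elt_norm_pair)
  then obtain u w where uw: "u \<otimes>\<^bsub>OL\<^esub> w = \<one>\<^bsub>OL\<^esub>" "(x \<otimes>\<^bsub>OL\<^esub> (0, 1)) \<otimes>\<^bsub>OL\<^esub> u \<in> neg_dom" using neg_dom_exists by blast
  have "(x \<otimes>\<^bsub>OL\<^esub> (0, 1)) \<otimes>\<^bsub>OL\<^esub> u = (x \<otimes>\<^bsub>OL\<^esub> u) \<otimes>\<^bsub>OL\<^esub> (0, 1)"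
    by (cases x; cases u) (simp add: algebra_simps)
  then have pos: "x \<otimes>\<^bsub>OL\<^esub> u \<in> pos_dom" using uw(2) mult_sqrt3_neg_dom by metis
  have "I = PIdl\<^bsub>OL\<^esub> (x \<otimes>\<^bsub>OL\<^esub> u)" using PIdl_mult_unit[OF uw(1)] x by simp
  moreover from this have "P (nat \<bar>elt_norm (x \<otimes>\<^bsub>OL\<^esub> u)\<bar>)"
    using I ideal_norm_PIdl[of "x \<otimes>\<^bsub>OL\<^esub> u"] dom_neq_zero pos by auto
  ultimately show "I \<in> (\<lambda>x. PIdl\<^bsub>OL\<^esub> x) ` {x \<in> pos_dom. P (nat \<bar>elt_norm x\<bar>)}" using pos by blast
next
  fix I assume "I \<in> (\<lambda>x. PIdl\<^bsub>OL\<^esub> x) ` {x \<in> pos_dom. P (nat \<bar>elt_norm x\<bar>)}"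
  then obtain x where x: "I = PIdl\<^bsub>OL\<^esub> x" "x \<in> pos_dom" "P (nat \<bar>elt_norm x\<bar>)" by blast
  then show "I \<in> {I \<in> nz_ideals. P (ideal_norm I)}"
    using dom_neq_zero[of x] ideal_norm_PIdl[of x] PIdl_nz_ideals[of x] by simp
qed

section \<open>Sums over ideals as double series\<close>

lemma has_sum_PIdl:
  assumes "inj_on (\<lambda>x. PIdl\<^bsub>OL\<^esub> x) S" "(0, 0) \<notin> S" "((\<lambda>x. q ^ nat \<bar>elt_norm x\<bar>) has_sum s) S"
  shows "((\<lambda>I. q ^ ideal_norm I) has_sum (s :: complex)) ((\<lambda>x. PIdl\<^bsub>OL\<^esub> x) ` S)"
proof -
  have "((\<lambda>I. q ^ ideal_norm I) has_sum s) ((\<lambda>x. PIdl\<^bsub>OL\<^esub> x) ` S) \<longleftrightarrow>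
    ((\<lambda>x. q ^ ideal_norm (PIdl\<^bsub>OL\<^esub> x)) has_sum s) S"
    using has_sum_reindex[OF assms(1)] by (simp add: o_def)
  also have "\<dots> \<longleftrightarrow> ((\<lambda>x. q ^ nat \<bar>elt_norm x\<bar>) has_sum s) S"
    by (rule has_sum_cong) (use assms(2) ideal_norm_PIdl in metis)
  finally show ?thesis using assms(3) by simp
qed

definition triangle_pairs :: "(nat \<times> nat) set" where
  "triangle_pairs = (SIGMA r:UNIV. {..r})"

lemma summable_triangle:
  fixes q :: complex
  assumes q: "norm q < 1" and e: "\<And>r i. r \<le> e r i"
  shows "summable (\<lambda>r. \<Sum>i\<le>r. norm (q ^ e r i))"
proof (rule summable_comparison_test')
  show "summable (\<lambda>r. real (Suc r) * norm q ^ r)"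
    using q geometric_deriv_sums[of "norm q"] by (auto simp: sums_iff)
  fix r
  have "(\<Sum>i\<le>r. norm (q ^ e r i)) \<le> (\<Sum>i\<le>r. norm q ^ r)"
    using q e by (intro sum_mono) (simp add: norm_power power_decreasing)
  then show "norm (\<Sum>i\<le>r. norm (q ^ e r i)) \<le> real (Suc r) * norm q ^ r"
    by (simp add: sum_nonneg)
qed

text \<open>Row r has r + 1 terms of norm at most |q|^r, so the family is absolutely summable, and
  the iterated series equals the unordered sum that \<open>has_sum\<close> speaks of.\<close>

lemma has_sum_triangle:
  fixes q :: complex
  assumes q: "norm q < 1" and e: "\<And>r i. r \<le> e r i"
  shows "summable (\<lambda>r. \<Sum>i\<le>r. q ^ e r i)"
    and "((\<lambda>(r, i). q ^ e r i) has_sum (\<Sum>r. \<Sum>i\<le>r. q ^ e r i)) triangle_pairs"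
proof -
  have n: "summable (\<lambda>r. norm (\<Sum>i\<le>r. q ^ e r i))"
  proof (rule summable_comparison_test')
    show "norm (norm (\<Sum>i\<le>r. q ^ e r i)) \<le> (\<Sum>i\<le>r. norm (q ^ e r i))" for r
      unfolding real_norm_def abs_norm_cancel by (rule norm_sum)
  qed (rule summable_triangle[OF assms])
  then show s: "summable (\<lambda>r. \<Sum>i\<le>r. q ^ e r i)" by (rule summable_norm_cancel)
  show "((\<lambda>(r, i). q ^ e r i) has_sum (\<Sum>r. \<Sum>i\<le>r. q ^ e r i)) triangle_pairs"
    unfolding triangle_pairs_def
  proof (rule has_sum_SigmaI)
    show "((\<lambda>i. case (r, i) of (r, i) \<Rightarrow> q ^ e r i) has_sum (\<Sum>i\<le>r. q ^ e r i)) {..r}" for r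
      by (simp add: has_sum_finite)
    show "((\<lambda>r. \<Sum>i\<le>r. q ^ e r i) has_sum (\<Sum>r. \<Sum>i\<le>r. q ^ e r i)) UNIV"
      using n summable_sums[OF s] by (rule norm_summable_imp_has_sum)
    have "(\<lambda>x. norm ((\<lambda>(r, i). q ^ e r i) x)) summable_on (SIGMA r:UNIV. {..r})"
    proof (rule summable_on_SigmaI)
      show "((\<lambda>i. norm (case (r, i) of (r, i) \<Rightarrow> q ^ e r i)) has_sum (\<Sum>i\<le>r. norm (q ^ e r i))) {..r}" for r
        by (simp add: has_sum_finite)
      show "(\<lambda>r. \<Sum>i\<le>r. norm (q ^ e r i)) summable_on UNIV"
        using summable_triangle[OF assms] by (intro norm_summable_imp_summable_on) (simp add: sum_nonneg)
    qed auto
    then show "(\<lambda>(r, i). q ^ e r i) summable_on (SIGMA r:UNIV. {..r})" by (rule abs_summable_summable)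
  qed
qed

lemma has_sum_image_triangle:
  fixes q :: complex
  assumes "norm q < 1" "\<And>r i. r \<le> e r i" "inj_on g triangle_pairs"
    "\<And>r i. i \<le> r \<Longrightarrow> \<bar>elt_norm (g (r, i))\<bar> = int (e r i)"
  shows "((\<lambda>x. q ^ nat \<bar>elt_norm x\<bar>) has_sum (\<Sum>r. \<Sum>i\<le>r. q ^ e r i)) (g ` triangle_pairs)"
proof -
  have "((\<lambda>x. q ^ nat \<bar>elt_norm x\<bar>) has_sum s) (g ` triangle_pairs) \<longleftrightarrow>
     ((\<lambda>(r, i). q ^ e r i) has_sum s) triangle_pairs" for s
    unfolding has_sum_reindex[OF assms(3)] o_def
    by (rule has_sum_cong) (auto simp: triangle_pairs_def assms(4))
  then show ?thesis using has_sum_triangle(2)[of q e] assms(1,2) by simp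
qed

section \<open>Points of the domains by residue of the norm\<close>

lemma even_norm_iff: "even (nat \<bar>elt_norm (a, b)\<bar>) \<longleftrightarrow> even (b - a)"
  by (auto simp: even_nat_iff elt_norm_pair)

text \<open>With b = r + 1 and a = b - 2i, the range -b < a <= b becomes 0 <= i <= r: the ray a = b
  is the edge \<open>i = 0\<close>, and the excluded ray a = -b would be
  \<open>i = r + 1\<close>.\<close>

lemma neg_dom_even:
  "{x \<in> neg_dom. nat \<bar>elt_norm x\<bar> mod 2 = 0} = (\<lambda>(r, i). (int r + 1 - 2 * int i, int r + 1)) ` triangle_pairs"
proof (intro equalityI subsetI)
  fix x assume x: "x \<in> {x \<in> neg_dom. nat \<bar>elt_norm x\<bar> mod 2 = 0}"
  obtain a b where ab: "x = (a, b)" by fastforce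
  have "nat \<bar>elt_norm (a, b)\<bar> mod 2 = 0" using x unfolding ab by blast
  then have "even (nat \<bar>elt_norm (a, b)\<bar>)" by presburger
  then have "even (b - a)" by (simp only: even_norm_iff)
  then obtain i where i: "b - a = 2 * i" by blast
  have "0 \<le> i" "i \<le> b - 1" "0 < b" using x i by (auto simp: ab neg_dom_def)
  then have "x = (\<lambda>(r, i). (int r + 1 - 2 * int i, int r + 1)) (nat (b - 1), nat i)" "(nat (b - 1), nat i) \<in> triangle_pairs"
    using i by (auto simp: ab triangle_pairs_def)
  then show "x \<in> (\<lambda>(r, i). (int r + 1 - 2 * int i, int r + 1)) ` triangle_pairs" by blast
next
  fix x assume "x \<in> (\<lambda>(r, i). (int r + 1 - 2 * int i, int r + 1)) ` triangle_pairs"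
  then obtain r i where x: "x = (int r + 1 - 2 * int i, int r + 1)" "i \<le> r" by (auto simp: triangle_pairs_def)
  have "even (nat \<bar>elt_norm x\<bar>)" unfolding x(1) even_norm_iff by simp
  then have "nat \<bar>elt_norm x\<bar> mod 2 = 0" by presburger
  moreover have "x \<in> neg_dom" using x by (simp add: neg_dom_def)
  ultimately show "x \<in> {x \<in> neg_dom. nat \<bar>elt_norm x\<bar> mod 2 = 0}" by blast
qed

text \<open>Here a = b - 1 - 2i, and parity keeps the points off both boundary rays.\<close>

lemma neg_dom_odd:
  "{x \<in> neg_dom. nat \<bar>elt_norm x\<bar> mod 2 = 1} = (\<lambda>(r, i). (int r - 2 * int i, int r + 1)) ` triangle_pairs"
proof (intro equalityI subsetI)
  fix x assume x: "x \<in> {x \<in> neg_dom. nat \<bar>elt_norm x\<bar> mod 2 = 1}"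
  obtain a b where ab: "x = (a, b)" by fastforce
  have "nat \<bar>elt_norm (a, b)\<bar> mod 2 = 1" using x unfolding ab by blast
  then have "odd (nat \<bar>elt_norm (a, b)\<bar>)" by presburger
  then have "odd (b - a)" by (simp only: even_norm_iff simp_thms)
  then obtain i where i: "b - a = 2 * i + 1" by (rule oddE)
  have "0 \<le> i" "i \<le> b - 1" "0 < b" using x i by (auto simp: ab neg_dom_def)
  then have "x = (\<lambda>(r, i). (int r - 2 * int i, int r + 1)) (nat (b - 1), nat i)" "(nat (b - 1), nat i) \<in> triangle_pairs"
    using i by (auto simp: ab triangle_pairs_def)
  then show "x \<in> (\<lambda>(r, i). (int r - 2 * int i, int r + 1)) ` triangle_pairs" by blast
next
  fix x assume "x \<in> (\<lambda>(r, i). (int r - 2 * int i, int r + 1)) ` triangle_pairs"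
  then obtain r i where x: "x = (int r - 2 * int i, int r + 1)" "i \<le> r" by (auto simp: triangle_pairs_def)
  have "odd (nat \<bar>elt_norm x\<bar>)" unfolding x(1) even_norm_iff by simp
  then have "nat \<bar>elt_norm x\<bar> mod 2 = 1" by presburger
  moreover have "x \<in> neg_dom" using x by (simp add: neg_dom_def)
  ultimately show "x \<in> {x \<in> neg_dom. nat \<bar>elt_norm x\<bar> mod 2 = 1}" by blast
qed

text \<open>For fixed r, the second coordinate runs over the integers in [-r, r] of the parity of r.
  The values of c used are 1, 2, 4, 5; as 3 does not divide them, no point meets the boundary rays a
  = 3b and a = -3b.\<close>

definition pos_family :: "nat \<Rightarrow> nat \<times> nat \<Rightarrow> int \<times> int" where
  "pos_family c = (\<lambda>(r, i). (3 * int r + int c, int r - 2 * int i))"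

lemma inj_pos_family: "inj_on (pos_family c) triangle_pairs"
  by (auto simp: inj_on_def pos_family_def)

lemma elt_norm_pos_family:
  assumes "i \<le> r"
  shows "elt_norm (pos_family c (r, i)) = int (6 * r\<^sup>2 + 6 * c * r + c\<^sup>2 + 12 * i * (r - i))"
proof -
  obtain j where "r = i + j" using assms le_Suc_ex by blast
  then show ?thesis by (simp add: pos_family_def elt_norm_pair algebra_simps power2_eq_square)
qed

lemma mem_pos_family_iff:
  "(a, b) \<in> pos_family c ` triangle_pairs \<longleftrightarrow>
     (\<exists>r. r \<ge> 0 \<and> a = 3 * r + int c \<and> \<bar>b\<bar> \<le> r \<and> even (r - b))"
proof
  assume "\<exists>r. r \<ge> 0 \<and> a = 3 * r + int c \<and> \<bar>b\<bar> \<le> r \<and> even (r - b)"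
  then obtain r i where r: "r \<ge> 0" "a = 3 * r + int c" "\<bar>b\<bar> \<le> r" "r - b = 2 * i" by blast
  then have "(a, b) = pos_family c (nat r, nat i)" "(nat r, nat i) \<in> triangle_pairs"
    by (auto simp: pos_family_def triangle_pairs_def)
  then show "(a, b) \<in> pos_family c ` triangle_pairs" by blast
qed (auto simp: pos_family_def triangle_pairs_def)

lemma norm_mod_6:
  assumes "a\<^sup>2 - 3 * b\<^sup>2 > (0 :: int)"
  shows "nat \<bar>elt_norm (a, b)\<bar> mod 6 = 1 \<longleftrightarrow> odd (a + b) \<and> a mod 3 \<noteq> 0"
    and "nat \<bar>elt_norm (a, b)\<bar> mod 6 = 4 \<longleftrightarrow> even (a + b) \<and> a mod 3 \<noteq> 0"
proof -
  define n where "n = a\<^sup>2 - 3 * b\<^sup>2"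
  have n: "n > 0" using assms by (simp add: n_def)
  have e: "even n \<longleftrightarrow> even (a + b)" by (simp add: n_def)
  have t: "n mod 3 = (if a mod 3 = 0 then 0 else 1)"
    using square_mod_3[of a] unfolding n_def by presburger
  have "n mod 6 = 1 \<longleftrightarrow> odd n \<and> n mod 3 = 1" "n mod 6 = 4 \<longleftrightarrow> even n \<and> n mod 3 = 1" by presburger+
  moreover have "nat \<bar>elt_norm (a, b)\<bar> mod 6 = k \<longleftrightarrow> n mod 6 = int k" for k
  proof -
    obtain m where m: "n = int m" using n zero_le_imp_eq_int[of n] by auto
    have "n mod 6 = int (m mod 6)" by (simp add: m zmod_int)
    moreover have "nat \<bar>elt_norm (a, b)\<bar> = m" using m by (simp add: elt_norm_pair n_def)
    ultimately show ?thesis by simp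
  qed
  ultimately show "nat \<bar>elt_norm (a, b)\<bar> mod 6 = 1 \<longleftrightarrow> odd (a + b) \<and> a mod 3 \<noteq> 0"
    "nat \<bar>elt_norm (a, b)\<bar> mod 6 = 4 \<longleftrightarrow> even (a + b) \<and> a mod 3 \<noteq> 0"
    using e t by auto
qed

text \<open>For a = 3k + 1 or a = 3k + 2 the domain says |b| <= k. If a + b is odd, then k - b is
  even in the first case, so \<open>r = k\<close> and \<open>c = 1\<close>; in the second case k - b
  is odd, which excludes |b| = k, so \<open>r = k - 1\<close> and \<open>c = 5\<close>.\<close>

lemma pos_dom_1_mod_6:
  "{x \<in> pos_dom. nat \<bar>elt_norm x\<bar> mod 6 = 1} = pos_family 1 ` triangle_pairs \<union> pos_family 5 ` triangle_pairs"
proof (rule Set.set_eqI)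
  fix x :: "int \<times> int"
  obtain a b where x: "x = (a, b)" by fastforce
  let ?r = "\<lambda>c. \<exists>r. r \<ge> 0 \<and> a = 3 * r + c \<and> \<bar>b\<bar> \<le> r \<and> even (r - b)"
  have "x \<in> {x \<in> pos_dom. nat \<bar>elt_norm x\<bar> mod 6 = 1} \<longleftrightarrow> x \<in> pos_dom \<and> odd (a + b) \<and> a mod 3 \<noteq> 0"
    using norm_mod_6(1)[of a b, unfolded elt_norm_pair] pos_dom_norm[of x] unfolding x elt_norm_pair[of a b] mem_Collect_eq by argo
  also have "\<dots> \<longleftrightarrow> ?r 1 \<or> ?r 5"
  proof
    assume "x \<in> pos_dom \<and> odd (a + b) \<and> a mod 3 \<noteq> 0"
    then have L: "- a < 3 * b" "3 * b \<le> a" "odd (a + b)" "a mod 3 \<noteq> 0"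
      by (simp_all add: x pos_dom_def)
    have "a = 3 * (a div 3) + 1 \<or> a = 3 * (a div 3) + 2" using L(4) by presburger
    then consider k where "a = 3 * k + 1" | k where "a = 3 * k + 2" by blast
    then show "?r 1 \<or> ?r 5"
    proof cases
      case 1
      with L have "k \<ge> 0" "a = 3 * k + 1" "\<bar>b\<bar> \<le> k" "even (k - b)"
        by presburger+
      then show ?thesis by blast
    next
      case 2
      with L have "(k - 1) \<ge> 0" "a = 3 * (k - 1) + 5" "\<bar>b\<bar> \<le> (k - 1)" "even ((k - 1) - b)"
        by presburger+
      then show ?thesis by blast
    qed
  next
    assume "?r 1 \<or> ?r 5"
    then obtain r where r: "r \<ge> 0" "\<bar>b\<bar> \<le> r" "even (r - b)" "a = 3 * r + 1 \<or> a = 3 * r + 5" by blast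
    have "- r \<le> b" "b \<le> r" using r(2) by auto
    then have "x \<in> pos_dom" using r(1,4) by (auto simp: x pos_dom_def)
    moreover have "odd (a + b)" using r(3,4) by auto
    moreover have "a mod 3 \<noteq> 0" using r(4) by presburger
    ultimately show "x \<in> pos_dom \<and> odd (a + b) \<and> a mod 3 \<noteq> 0" by simp
  qed
  also have "\<dots> \<longleftrightarrow> x \<in> pos_family 1 ` triangle_pairs \<union> pos_family 5 ` triangle_pairs"
    by (simp add: x mem_pos_family_iff)
  finally show "x \<in> {x \<in> pos_dom. nat \<bar>elt_norm x\<bar> mod 6 = 1} \<longleftrightarrow> x \<in> pos_family 1 ` triangle_pairs \<union> pos_family 5 ` triangle_pairs" .
qed

text \<open>With a + b even the parities swap: a = 3k + 2 gives \<open>r = k\<close>,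
  \<open>c = 2\<close>, and a = 3k + 1 gives \<open>r = k - 1\<close>, \<open>c = 4\<close>.\<close>

lemma pos_dom_4_mod_6:
  "{x \<in> pos_dom. nat \<bar>elt_norm x\<bar> mod 6 = 4} = pos_family 2 ` triangle_pairs \<union> pos_family 4 ` triangle_pairs"
proof (rule Set.set_eqI)
  fix x :: "int \<times> int"
  obtain a b where x: "x = (a, b)" by fastforce
  let ?r = "\<lambda>c. \<exists>r. r \<ge> 0 \<and> a = 3 * r + c \<and> \<bar>b\<bar> \<le> r \<and> even (r - b)"
  have "x \<in> {x \<in> pos_dom. nat \<bar>elt_norm x\<bar> mod 6 = 4} \<longleftrightarrow> x \<in> pos_dom \<and> even (a + b) \<and> a mod 3 \<noteq> 0"
    using norm_mod_6(2)[of a b, unfolded elt_norm_pair] pos_dom_norm[of x] unfolding x elt_norm_pair[of a b] mem_Collect_eq by argo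
  also have "\<dots> \<longleftrightarrow> ?r 2 \<or> ?r 4"
  proof
    assume "x \<in> pos_dom \<and> even (a + b) \<and> a mod 3 \<noteq> 0"
    then have L: "- a < 3 * b" "3 * b \<le> a" "even (a + b)" "a mod 3 \<noteq> 0"
      by (simp_all add: x pos_dom_def)
    have "a = 3 * (a div 3) + 1 \<or> a = 3 * (a div 3) + 2" using L(4) by presburger
    then consider k where "a = 3 * k + 1" | k where "a = 3 * k + 2" by blast
    then show "?r 2 \<or> ?r 4"
    proof cases
      case 1
      with L have "(k - 1) \<ge> 0" "a = 3 * (k - 1) + 4" "\<bar>b\<bar> \<le> (k - 1)" "even ((k - 1) - b)"
        by presburger+
      then show ?thesis by blast
    next
      case 2
      with L have "k \<ge> 0" "a = 3 * k + 2" "\<bar>b\<bar> \<le> k" "even (k - b)"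
        by presburger+
      then show ?thesis by blast
    qed
  next
    assume "?r 2 \<or> ?r 4"
    then obtain r where r: "r \<ge> 0" "\<bar>b\<bar> \<le> r" "even (r - b)" "a = 3 * r + 2 \<or> a = 3 * r + 4" by blast
    have "- r \<le> b" "b \<le> r" using r(2) by auto
    then have "x \<in> pos_dom" using r(1,4) by (auto simp: x pos_dom_def)
    moreover have "even (a + b)" using r(3,4) by auto
    moreover have "a mod 3 \<noteq> 0" using r(4) by presburger
    ultimately show "x \<in> pos_dom \<and> even (a + b) \<and> a mod 3 \<noteq> 0" by simp
  qed
  also have "\<dots> \<longleftrightarrow> x \<in> pos_family 2 ` triangle_pairs \<union> pos_family 4 ` triangle_pairs"
    by (simp add: x mem_pos_family_iff)
  finally show "x \<in> {x \<in> pos_dom. nat \<bar>elt_norm x\<bar> mod 6 = 4} \<longleftrightarrow> x \<in> pos_family 2 ` triangle_pairs \<union> pos_family 4 ` triangle_pairs" .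
qed

section \<open>Norm generating functions\<close>

definition pos_term :: "complex \<Rightarrow> nat \<Rightarrow> nat \<Rightarrow> complex" where
  "pos_term q c r = (\<Sum>i\<le>r. q ^ (6 * r\<^sup>2 + 6 * c * r + c\<^sup>2 + 12 * i * (r - i)))"

lemma pos_term_exponent: "c > 0 \<Longrightarrow> r \<le> 6 * r\<^sup>2 + 6 * c * r + c\<^sup>2 + 12 * i * (r - i)" for r :: nat
  by (simp add: power2_eq_square trans_le_add1)

lemma has_sum_pos_families:
  assumes q: "norm q < 1" and c: "0 < c" "0 < d" "c mod 3 \<noteq> d mod 3"
  shows "((\<lambda>x. q ^ nat \<bar>elt_norm x\<bar>) has_sum (suminf (pos_term q c) + suminf (pos_term q d)))
     (pos_family c ` triangle_pairs \<union> pos_family d ` triangle_pairs)"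
proof (rule has_sum_Un_disjoint)
  have "((\<lambda>x. q ^ nat \<bar>elt_norm x\<bar>) has_sum suminf (pos_term q c)) (pos_family c ` triangle_pairs)" if "c > 0" for c
    unfolding pos_term_def
    by (rule has_sum_image_triangle[OF q pos_term_exponent[OF that] inj_pos_family])
      (simp add: elt_norm_pos_family)
  then show "((\<lambda>x. q ^ nat \<bar>elt_norm x\<bar>) has_sum suminf (pos_term q c)) (pos_family c ` triangle_pairs)"
    "((\<lambda>x. q ^ nat \<bar>elt_norm x\<bar>) has_sum suminf (pos_term q d)) (pos_family d ` triangle_pairs)"
    using c by auto
  have "int c mod 3 \<noteq> int d mod 3" using c(3) by (metis of_nat_mod of_nat_numeral of_nat_eq_iff)
  moreover have "fst x mod 3 = int c mod 3" if "x \<in> pos_family c ` triangle_pairs" for x c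
    using that by (auto simp: pos_family_def)
  ultimately show "pos_family c ` triangle_pairs \<inter> pos_family d ` triangle_pairs = {}" by (metis disjoint_iff)
qed

lemma pos_term_sums:
  assumes "norm q < 1" "c > 0"
  shows "pos_term q c sums suminf (pos_term q c)"
  unfolding pos_term_def
  by (rule summable_sums[OF has_sum_triangle(1)[OF assms(1) pos_term_exponent[OF assms(2)]]])

lemma starsum_eq: "starsums c s \<Longrightarrow> starsum c = s"
  unfolding starsums_def starsum_def by (rule limI)

lemma has_sum_even_neg_principal:
  fixes q :: complex
  assumes "norm q < 1"
  shows "((\<lambda>I. q ^ ideal_norm I) has_sum (\<Sum>r. \<Sum>i\<le>r. q ^ (2 * (r + 1)\<^sup>2 + 4 * i * (r + 1 - i))))
    {I \<in> nz_ideals. ideal_norm I mod 2 = 0 \<and> neg_principal I}"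
proof -
  let ?g = "\<lambda>(r, i). (int r + 1 - 2 * int i, int r + 1)"
  have "((\<lambda>x. q ^ nat \<bar>elt_norm x\<bar>) has_sum (\<Sum>r. \<Sum>i\<le>r. q ^ (2 * (r + 1)\<^sup>2 + 4 * i * (r + 1 - i)))) (?g ` triangle_pairs)"
  proof (rule has_sum_image_triangle[OF assms])
    show "inj_on ?g triangle_pairs" by (auto simp: inj_on_def)
    fix r i :: nat
    show "r \<le> 2 * (r + 1)\<^sup>2 + 4 * i * (r + 1 - i)" by (simp add: power2_eq_square)
    assume "i \<le> r"
    then obtain j where "r = i + j" using le_Suc_ex by blast
    then have "elt_norm (?g (r, i)) = - int (2 * (r + 1)\<^sup>2 + 4 * i * (r + 1 - i))"
      by (simp add: elt_norm_pair algebra_simps power2_eq_square)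
    then show "\<bar>elt_norm (?g (r, i))\<bar> = int (2 * (r + 1)\<^sup>2 + 4 * i * (r + 1 - i))"
      by (simp only: abs_minus_cancel abs_of_nat)
  qed
  then show ?thesis
    unfolding neg_principal_ideals[of "\<lambda>n. n mod 2 = 0"] neg_dom_even[symmetric]
    by (intro has_sum_PIdl inj_on_subset[OF inj_on_PIdl_neg_dom]) (auto simp: neg_dom_def)
qed

lemma has_sum_odd_neg_principal:
  fixes q :: complex
  assumes "norm q < 1"
  shows "((\<lambda>I. q ^ ideal_norm I) has_sum (\<Sum>r. \<Sum>i\<le>r. q ^ (2 * r\<^sup>2 + 6 * r + 3 + 4 * i * (r - i))))
    {I \<in> nz_ideals. ideal_norm I mod 2 = 1 \<and> neg_principal I}"
proof -
  let ?g = "\<lambda>(r, i). (int r - 2 * int i, int r + 1)"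
  have "((\<lambda>x. q ^ nat \<bar>elt_norm x\<bar>) has_sum (\<Sum>r. \<Sum>i\<le>r. q ^ (2 * r\<^sup>2 + 6 * r + 3 + 4 * i * (r - i)))) (?g ` triangle_pairs)"
  proof (rule has_sum_image_triangle[OF assms])
    show "inj_on ?g triangle_pairs" by (auto simp: inj_on_def)
    fix r i :: nat
    show "r \<le> 2 * r\<^sup>2 + 6 * r + 3 + 4 * i * (r - i)" by simp
    assume "i \<le> r"
    then obtain j where "r = i + j" using le_Suc_ex by blast
    then have "elt_norm (?g (r, i)) = - int (2 * r\<^sup>2 + 6 * r + 3 + 4 * i * (r - i))"
      by (simp add: elt_norm_pair algebra_simps power2_eq_square)
    then show "\<bar>elt_norm (?g (r, i))\<bar> = int (2 * r\<^sup>2 + 6 * r + 3 + 4 * i * (r - i))"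
      by (simp only: abs_minus_cancel abs_of_nat)
  qed
  then show ?thesis
    unfolding neg_principal_ideals[of "\<lambda>n. n mod 2 = 1"] neg_dom_odd[symmetric]
    by (intro has_sum_PIdl inj_on_subset[OF inj_on_PIdl_neg_dom]) (auto simp: neg_dom_def)
qed

lemma has_sum_ideals_1_mod_6:
  assumes "norm q < 1"
  shows "((\<lambda>I. q ^ ideal_norm I) has_sum (suminf (pos_term q 1) + suminf (pos_term q 5)))
    {I \<in> nz_ideals. ideal_norm I mod 6 = 1}"
proof -
  have ideals: "{I \<in> nz_ideals. ideal_norm I mod 6 = 1} =
     (\<lambda>x. PIdl\<^bsub>OL\<^esub> x) ` {x \<in> pos_dom. nat \<bar>elt_norm x\<bar> mod 6 = 1}"
    by (rule ideals_norm_1_mod_3) presburger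
  have "((\<lambda>x. q ^ nat \<bar>elt_norm x\<bar>) has_sum (suminf (pos_term q 1) + suminf (pos_term q 5)))
    {x \<in> pos_dom. nat \<bar>elt_norm x\<bar> mod 6 = 1}"
    unfolding pos_dom_1_mod_6 by (rule has_sum_pos_families[OF assms]) simp_all
  then show ?thesis
    unfolding ideals by (intro has_sum_PIdl inj_on_subset[OF inj_on_PIdl_pos_dom]) (auto simp: pos_dom_def)
qed

lemma has_sum_ideals_4_mod_6:
  assumes "norm q < 1"
  shows "((\<lambda>I. q ^ ideal_norm I) has_sum (suminf (pos_term q 2) + suminf (pos_term q 4)))
    {I \<in> nz_ideals. ideal_norm I mod 6 = 4}"
proof -
  have ideals: "{I \<in> nz_ideals. ideal_norm I mod 6 = 4} =
     (\<lambda>x. PIdl\<^bsub>OL\<^esub> x) ` {x \<in> pos_dom. nat \<bar>elt_norm x\<bar> mod 6 = 4}"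
    by (rule ideals_norm_1_mod_3) presburger
  have "((\<lambda>x. q ^ nat \<bar>elt_norm x\<bar>) has_sum (suminf (pos_term q 2) + suminf (pos_term q 4)))
    {x \<in> pos_dom. nat \<bar>elt_norm x\<bar> mod 6 = 4}"
    unfolding pos_dom_4_mod_6 by (rule has_sum_pos_families[OF assms]) simp_all
  then show ?thesis
    unfolding ideals by (intro has_sum_PIdl inj_on_subset[OF inj_on_PIdl_pos_dom]) (auto simp: pos_dom_def)
qed

section \<open>Matching the q-series with the ideal sums\<close>

lemma q_disc_power: "norm q < 1 \<Longrightarrow> k > 0 \<Longrightarrow> q_disc (q ^ k)"
  by (simp add: q_disc_def q_disc.norm_q_power_less)

lemma L5_eq:
  assumes q: "norm q < 1"
  shows "L5 (q\<^sup>2) = 2 * q\<^sup>2 * (\<Sum>r. \<Sum>i\<le>r. q ^ (2 * (r + 1)\<^sup>2 + 4 * i * (r + 1 - i)))"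
proof -
  interpret q_disc "q\<^sup>2" by (rule q_disc_power[OF q]) simp
  have "2 * (q\<^sup>2) ^ (r\<^sup>2 + 2 * r + 1) * P5 (Suc r) = 2 * (\<Sum>i\<le>r. q ^ (2 * (r + 1)\<^sup>2 + 4 * i * (r + 1 - i)))" for r
  proof -
    have "(q\<^sup>2) ^ (r\<^sup>2 + 2 * r + 1) * P5 (Suc r) = (\<Sum>i\<le>r. (q\<^sup>2) ^ (r\<^sup>2 + 2 * r + 1) * (q\<^sup>2) ^ (2 * i * (Suc r - i)))"
      using P5_P6_eq[of "Suc r"] by (simp only: lessThan_Suc_atMost sum_distrib_left)
    also have "\<dots> = (\<Sum>i\<le>r. q ^ (2 * (r + 1)\<^sup>2 + 4 * i * (r + 1 - i)))"
      unfolding power_mult[symmetric] power_add[symmetric]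
      by (rule sum.cong) (auto intro!: arg_cong[where f = "power q"] simp: power2_eq_square algebra_simps)
    finally show ?thesis by (simp only: mult.assoc)
  qed
  moreover have "summable (\<lambda>r. \<Sum>i\<le>r. q ^ (2 * (r + 1)\<^sup>2 + 4 * i * (r + 1 - i)))"
    by (rule has_sum_triangle(1)[OF q]) (simp add: power2_eq_square)
  ultimately have "(\<Sum>n. L5_term (q\<^sup>2) n) = 2 * (\<Sum>r. \<Sum>i\<le>r. q ^ (2 * (r + 1)\<^sup>2 + 4 * i * (r + 1 - i)))"
    using sums_unique[OF L5_term_sums] by (simp only: suminf_mult)
  then show ?thesis by (simp only: L5_def) simp
qed

lemma L6_eq:
  assumes q: "norm q < 1"
  shows "L6 (q\<^sup>2) = 2 * q * (\<Sum>r. \<Sum>i\<le>r. q ^ (2 * r\<^sup>2 + 6 * r + 3 + 4 * i * (r - i)))"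
proof -
  interpret q_disc "q\<^sup>2" by (rule q_disc_power[OF q]) simp
  have "2 * (q\<^sup>2) ^ (r\<^sup>2 + 3 * r + 2) * P6 (Suc r) = 2 * q * (\<Sum>i\<le>r. q ^ (2 * r\<^sup>2 + 6 * r + 3 + 4 * i * (r - i)))" for r
  proof -
    have "(q\<^sup>2) ^ (r\<^sup>2 + 3 * r + 2) * P6 (Suc r) = (\<Sum>i\<le>r. (q\<^sup>2) ^ (r\<^sup>2 + 3 * r + 2) * (q\<^sup>2) ^ (2 * i * (Suc r - Suc i)))"
      using P5_P6_eq[of "Suc r"] by (simp only: lessThan_Suc_atMost sum_distrib_left)
    also have "\<dots> = (\<Sum>i\<le>r. q * q ^ (2 * r\<^sup>2 + 6 * r + 3 + 4 * i * (r - i)))"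
      unfolding power_mult[symmetric] power_add[symmetric] power_Suc[symmetric]
      by (rule sum.cong) (auto intro!: arg_cong[where f = "power q"] simp: algebra_simps simp del: power_Suc)
    finally show ?thesis by (simp only: mult.assoc sum_distrib_left)
  qed
  moreover have "summable (\<lambda>r. \<Sum>i\<le>r. q ^ (2 * r\<^sup>2 + 6 * r + 3 + 4 * i * (r - i)))"
    by (rule has_sum_triangle(1)[OF q]) simp
  ultimately show ?thesis
    unfolding L6_def using sums_unique[OF L6_term_sums] by (simp only: suminf_mult)
qed

text \<open>This expresses the ideal sums through the same \<open>P6\<close>, in base q^6, to which
  \<open>P5_Suc\<close> and \<open>P6_Suc\<close> reduce the coefficients of \<open>L7\<close> and
  \<open>L8\<close>.\<close>

lemma pos_term_eq:
  assumes "q_disc (q ^ 6)"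
  shows "pos_term q c r = q ^ c\<^sup>2 * (q ^ 6) ^ (r\<^sup>2 + c * r) * q_disc.P6 (q ^ 6) (Suc r)"
proof -
  interpret q_disc "q ^ 6" by fact
  have "q ^ c\<^sup>2 * (q ^ 6) ^ (r\<^sup>2 + c * r) * P6 (Suc r) =
    (\<Sum>i\<le>r. q ^ c\<^sup>2 * (q ^ 6) ^ (r\<^sup>2 + c * r) * (q ^ 6) ^ (2 * i * (Suc r - Suc i)))"
    using P5_P6_eq[of "Suc r"] by (simp only: lessThan_Suc_atMost sum_distrib_left)
  also have "\<dots> = pos_term q c r"
    unfolding pos_term_def power_mult[symmetric] power_add[symmetric]
    by (rule sum.cong) (auto intro!: arg_cong[where f = "power q"] simp: algebra_simps)
  finally show ?thesis ..
qed

text \<open>By \<open>P5_Suc\<close> and \<open>P6_Suc\<close> the constants cancel in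
  \<open>P5 (Suc r) + P5 r = P6 (Suc r) + Q^(2r) * P6 r\<close>. The first part is the family
  \<open>c = 1\<close>; the second, \<open>h\<close>, is 0 at \<open>r = 0\<close> and becomes the
  family \<open>c = 5\<close> after a shift by one.\<close>

lemma L7_eq:
  assumes q: "norm q < 1"
  shows "q * L7 (q ^ 6) = suminf (pos_term q 1) + suminf (pos_term q 5)"
proof -
  have disc: "q_disc (q ^ 6)" by (rule q_disc_power[OF q]) simp
  interpret q_disc "q ^ 6" by (rule disc)
  define Q where "Q = q ^ 6"
  define f where "f r = Q ^ (r\<^sup>2 + r) * (P5 (Suc r) + P5 r)" for r
  define h where "h r = q * Q ^ (r\<^sup>2 + 3 * r) * P6 r" for r
  have "h (Suc r) = pos_term q 5 r" for r
  proof -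
    have "q * Q ^ ((Suc r)\<^sup>2 + 3 * Suc r) = q ^ 5\<^sup>2 * Q ^ (r\<^sup>2 + 5 * r)"
      unfolding Q_def power_mult[symmetric] power_add[symmetric] power_Suc[symmetric]
      by (rule arg_cong[where f = "power q"]) (simp add: power2_eq_square algebra_simps)
    then show ?thesis unfolding h_def pos_term_eq[OF disc] Q_def[symmetric] by simp
  qed
  moreover have "h 0 = 0" by (simp add: h_def P6_def)
  ultimately have "h sums suminf (pos_term q 5)"
    using pos_term_sums[OF q, of 5] sums_Suc_iff[of h "suminf (pos_term q 5)"] by simp
  then have "(\<lambda>r. pos_term q 1 r + h r) sums (suminf (pos_term q 1) + suminf (pos_term q 5))"
    by (intro sums_add pos_term_sums q) simp_all
  moreover have "pos_term q 1 r + h r = q * f r" for r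
  proof -
    have "P5 (Suc r) + P5 r = P6 (Suc r) + Q ^ (2 * r) * P6 r"
      using P5_Suc[of r] P6_Suc[of r] by (simp add: Q_def)
    moreover have "Q ^ (r\<^sup>2 + r) * Q ^ (2 * r) = Q ^ (r\<^sup>2 + 3 * r)"
      unfolding power_add[symmetric] by (rule arg_cong[where f = "power Q"]) simp
    ultimately show ?thesis
      unfolding f_def h_def pos_term_eq[OF disc] Q_def[symmetric]
      by (simp add: distrib_left mult.assoc[symmetric])
  qed
  ultimately have s: "(\<lambda>r. q * f r) sums (suminf (pos_term q 1) + suminf (pos_term q 5))" by simp
  have "starsum (L7_term Q) = suminf f / 2"
    using starsum_eq[OF L7_term_starsums] unfolding f_def Q_def .
  then have "L7 Q = suminf f" by (simp only: L7_def) simp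
  moreover have "q * suminf f = suminf (pos_term q 1) + suminf (pos_term q 5)"
  \<comment> \<open>Summability of \<open>f\<close> follows from that of \<open>q * f\<close> only
    when q can be cancelled.\<close>
  proof (cases "q = 0")
    case True
    then show ?thesis using sums_unique[OF s] by simp
  next
    case False
    then have "summable f" using s summable_cmult_iff[of q f] sums_summable by blast
    then show ?thesis using sums_unique[OF s] suminf_mult by metis
  qed
  ultimately show ?thesis by (simp add: Q_def)
qed

text \<open>Here the constants leave \<open>Q^(r^2) - Q^((r+1)^2)\<close>, which telescopes to 1 and
  cancels the -1 in \<open>L8\<close>. The rest is the family \<open>c = 2\<close> and, after a
  shift by one, the family \<open>c = 4\<close>.\<close>

lemma L8_eq:
  assumes q: "norm q < 1"
  shows "L8 (q ^ 6) = q\<^sup>2 * (suminf (pos_term q 2) + suminf (pos_term q 4))"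
proof -
  have disc: "q_disc (q ^ 6)" by (rule q_disc_power[OF q]) simp
  interpret q_disc "q ^ 6" by (rule disc)
  define Q where "Q = q ^ 6"
  define f where "f r = Q ^ r\<^sup>2 * (P5 (Suc r) + Q ^ (2 * r + 1) * P5 r)" for r
  define h where "h r = Q ^ (r\<^sup>2 + 2 * r) * P6 r" for r
  have "h (Suc r) = q\<^sup>2 * pos_term q 4 r" for r
  proof -
    have "Q ^ ((Suc r)\<^sup>2 + 2 * Suc r) = q\<^sup>2 * (q ^ 4\<^sup>2 * Q ^ (r\<^sup>2 + 4 * r))"
      unfolding Q_def power_mult[symmetric] power_add[symmetric]
      by (rule arg_cong[where f = "power q"]) (simp add: power2_eq_square algebra_simps)
    then show ?thesis unfolding h_def pos_term_eq[OF disc] Q_def[symmetric] by simp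
  qed
  moreover have "h 0 = 0" by (simp add: h_def P6_def)
  ultimately have h: "h sums (q\<^sup>2 * suminf (pos_term q 4))"
    using sums_mult[OF pos_term_sums[OF q, of 4], of "q\<^sup>2"] sums_Suc_iff[of h "q\<^sup>2 * suminf (pos_term q 4)"] by simp
  have "(\<lambda>r. Q ^ r) \<longlonglongrightarrow> 0" using norm_q by (simp add: Q_def LIMSEQ_power_zero)
  then have "(\<lambda>r. Q ^ r\<^sup>2) \<longlonglongrightarrow> 0"
    by (rule filterlim_compose) (rule filterlim_at_top_mono[OF filterlim_ident], simp add: power2_eq_square)
  from telescope_sums'[OF this] have "(\<lambda>r. Q ^ r\<^sup>2 - Q ^ (Suc r)\<^sup>2) sums 1" by simp
  from sums_add[OF sums_add[OF this h] sums_mult[OF pos_term_sums[OF q, of 2], of "q\<^sup>2"]]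
  have "(\<lambda>r. Q ^ r\<^sup>2 - Q ^ (Suc r)\<^sup>2 + h r + q\<^sup>2 * pos_term q 2 r) sums
     (1 + q\<^sup>2 * suminf (pos_term q 4) + q\<^sup>2 * suminf (pos_term q 2))" by simp
  moreover have "Q ^ r\<^sup>2 - Q ^ (Suc r)\<^sup>2 + h r + q\<^sup>2 * pos_term q 2 r = f r" for r
  proof -
    have 1: "q\<^sup>2 * pos_term q 2 r = Q ^ (Suc r)\<^sup>2 * P6 (Suc r)"
    proof -
      have "q\<^sup>2 * (q ^ 2\<^sup>2 * Q ^ (r\<^sup>2 + 2 * r)) = Q ^ (Suc r)\<^sup>2"
        unfolding Q_def power_mult[symmetric] power_add[symmetric]
        by (rule arg_cong[where f = "power q"]) (simp add: power2_eq_square algebra_simps)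
      then show ?thesis unfolding pos_term_eq[OF disc] Q_def[symmetric] by simp
    qed
    have 2: "P5 (Suc r) = 1 + Q ^ (2 * r) * P6 r" "P5 r = P6 (Suc r) - 1"
      using P5_Suc[of r] P6_Suc[of r] by (simp_all add: Q_def)
    have 3: "Q ^ r\<^sup>2 * Q ^ (2 * r) = Q ^ (r\<^sup>2 + 2 * r)" "Q ^ r\<^sup>2 * Q ^ (2 * r + 1) = Q ^ (Suc r)\<^sup>2"
      unfolding power_add[symmetric] by (auto intro!: arg_cong[where f = "power Q"] simp: power2_eq_square)
    have "f r = Q ^ r\<^sup>2 + (Q ^ r\<^sup>2 * Q ^ (2 * r)) * P6 r + (Q ^ r\<^sup>2 * Q ^ (2 * r + 1)) * (P6 (Suc r) - 1)"
      unfolding f_def 2 by (simp only: distrib_left mult.assoc mult_1_right)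
    then show ?thesis unfolding 3 1 h_def by (simp add: right_diff_distrib)
  qed
  ultimately have "f sums (1 + q\<^sup>2 * suminf (pos_term q 4) + q\<^sup>2 * suminf (pos_term q 2))" by simp
  moreover have "starsum (L8_term Q) = suminf f / 2"
    using starsum_eq[OF L8_term_starsums] unfolding f_def Q_def .
  then have "L8 Q = - 1 + suminf f" by (simp only: L8_def) simp
  ultimately show ?thesis by (simp add: Q_def sums_iff algebra_simps)
qed

theorem theorem1p2:
  fixes q :: complex
  assumes "norm q < 1" and "q \<noteq> 0"
  shows "summable (L5_term (q^2)) \<and> summable (L6_term (q^2))
       \<and> ((\<lambda>I. 2 * q ^ ideal_norm I) has_sum (q powi (-2) * L5 (q^2)))
           {I \<in> nz_ideals. ideal_norm I mod 2 = 0 \<and> neg_principal I}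
       \<and> ((\<lambda>I. 2 * q ^ ideal_norm I) has_sum (q powi (-1) * L6 (q^2)))
           {I \<in> nz_ideals. ideal_norm I mod 2 = 1 \<and> neg_principal I}
       \<and> (\<exists>s. starsums (L7_term (q^6)) s)
       \<and> ((\<lambda>I. q ^ ideal_norm I) has_sum (q * L7 (q^6)))
           {I \<in> nz_ideals. ideal_norm I mod 6 = 1}
       \<and> (\<exists>s. starsums (L8_term (q^6)) s)
       \<and> ((\<lambda>I. q ^ ideal_norm I) has_sum (q powi (-2) * L8 (q^6)))
           {I \<in> nz_ideals. ideal_norm I mod 6 = 4}"
proof -
  note disc = q_disc_power[OF assms(1)]
  have p: "q powi (-2) * (2 * q\<^sup>2 * x) = 2 * x" "q powi (-1) * (2 * q * x) = 2 * x" "q powi (-2) * (q\<^sup>2 * x) = x" for x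
    using assms(2) by (simp_all add: power_int_minus field_simps)
  have "summable (L5_term (q^2))" "summable (L6_term (q^2))"
    using q_disc.L5_term_sums[OF disc[of 2]] q_disc.L6_term_sums[OF disc[of 2]] by (auto intro: sums_summable)
  moreover have "((\<lambda>I. 2 * q ^ ideal_norm I) has_sum (q powi (-2) * L5 (q^2)))
           {I \<in> nz_ideals. ideal_norm I mod 2 = 0 \<and> neg_principal I}"
    unfolding L5_eq[OF assms(1)] p
    by (rule has_sum_cmult_right[OF has_sum_even_neg_principal[OF assms(1)]])
  moreover have "((\<lambda>I. 2 * q ^ ideal_norm I) has_sum (q powi (-1) * L6 (q^2)))
           {I \<in> nz_ideals. ideal_norm I mod 2 = 1 \<and> neg_principal I}"
    unfolding L6_eq[OF assms(1)] p
    by (rule has_sum_cmult_right[OF has_sum_odd_neg_principal[OF assms(1)]])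
  moreover have "\<exists>s. starsums (L7_term (q^6)) s" "\<exists>s. starsums (L8_term (q^6)) s"
    using q_disc.L7_term_starsums[OF disc[of 6]] q_disc.L8_term_starsums[OF disc[of 6]] by auto
  moreover have "((\<lambda>I. q ^ ideal_norm I) has_sum (q * L7 (q^6))) {I \<in> nz_ideals. ideal_norm I mod 6 = 1}"
    unfolding L7_eq[OF assms(1)] by (rule has_sum_ideals_1_mod_6[OF assms(1)])
  moreover have "((\<lambda>I. q ^ ideal_norm I) has_sum (q powi (-2) * L8 (q^6))) {I \<in> nz_ideals. ideal_norm I mod 6 = 4}"
    unfolding L8_eq[OF assms(1)] p by (rule has_sum_ideals_4_mod_6[OF assms(1)])
  ultimately show ?thesis by blast
qed

end
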